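(* Let $k\ge 3$ be an integer and let $\gamma\subset\mathbb{R}^2$ be a $C^2$-smooth, planar, strictly convex closed curve which is invariant under a linear map of order $k$. Consider the Minkowski billiard system in $K$, the interior of $\gamma$, with the norm induced by $K$. If the Minkowski billiard map of $K$ is totally integrable on the entire phase cylinder, then $\gamma$ is a (Euclidean) ellipse.
   Context: A linear map $A$ has order $k$ if $k$ is the least positive integer with $A^k=I$. The norm (not necessarily symmetric) induced by $K$ is the gauge function $g_K(x)=\inf\{r>0 : x\in rK\}$. Minkowski billiard map in $K$ with the norm induced by $K$: parametrize $\gamma$ counterclockwise so that $g_K(\dot\gamma(t))=1$. The map $T$ is the twist map of the phase cylinder (oriented chords of $\gamma$, i.e. ordered pairs of distinct points $\gamma(t),\gamma(t_1)$) with generating function $L(t,t_1)=g_K(\gamma(t_1)-\gamma(t))$, i.e. $T(t,s)=(t_1,s_1)$ iff $s=-\partial L/\partial t\,(t,t_1)$ and $s_1=\partial L/\partial t_1\,(t,t_1)$. Equivalently, $\gamma(t_0),\gamma(t_1),\gamma(t_2)$ are consecutive bounce points iff $t_1$ is a critical point of $\tau\mapsto L(t_0,\tau)+L(\tau,t_2)$. A rotational invariant curve is a simple closed curve in the phase cylinder, homotopically non-trivial (winding once around the cylinder), that is mapped to itself by $T$. $T$ is totally integrable in an open subset $U$ of the phase cylinder if $U$ admits a $C^1$ foliation by rotational invariant curves of $T$. *)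

theory Defs
  imports "HOL-Analysis.Analysis"
begin

type_synonym plane = "real^2"

definition has_order :: "('a \<Rightarrow> 'a) \<Rightarrow> nat \<Rightarrow> bool" where
  "has_order A k \<longleftrightarrow> 0 < k \<and> A ^^ k = id \<and> (\<forall>j. 0 < j \<and> j < k \<longrightarrow> A ^^ j \<noteq> id)"

definition is_ellipse :: "plane set \<Rightarrow> bool" where
  "is_ellipse E \<longleftrightarrow> (\<exists>c u v a b. norm u = 1 \<and> norm v = 1 \<and> u \<bullet> v = 0 \<and> 0 < a \<and> 0 < b \<and>
     E = range (\<lambda>\<theta>. c + (a * cos \<theta>) *\<^sub>R u + (b * sin \<theta>) *\<^sub>R v))"

definition strictly_convex :: "'a::real_normed_vector set \<Rightarrow> bool" where
  "strictly_convex S \<longleftrightarrow> (\<forall>x\<in>S. \<forall>y\<in>S. x \<noteq> y \<longrightarrow> open_segment x y \<subseteq> interior S)"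

text \<open>A regular \<open>C\<^sup>2\<close> parametrization of the simple closed curve \<open>\<Gamma>\<close>,
  extended periodically with period \<open>P\<close>.\<close>

definition C2_closed_param :: "plane set \<Rightarrow> real \<Rightarrow> (real \<Rightarrow> plane) \<Rightarrow> bool" where
  "C2_closed_param \<Gamma> P \<gamma> \<longleftrightarrow> 0 < P \<and> (\<forall>t. \<gamma> (t + P) = \<gamma> t) \<and> inj_on \<gamma> {0..<P} \<and> range \<gamma> = \<Gamma> \<and>
     (\<exists>\<gamma>'. (\<forall>t. (\<gamma> has_vector_derivative \<gamma>' t) (at t) \<and> \<gamma>' t \<noteq> 0) \<and> \<gamma>' C1_differentiable_on UNIV)"

definition C2_closed_curve :: "plane set \<Rightarrow> bool" where
  "C2_closed_curve \<Gamma> \<longleftrightarrow> (\<exists>P \<gamma>. C2_closed_param \<Gamma> P \<gamma>)"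

text \<open>The convexity is that of the closed region bounded by \<open>\<Gamma>\<close>; points of vanishing
  curvature are not excluded.\<close>

definition strictly_convex_curve :: "plane set \<Rightarrow> bool" where
  "strictly_convex_curve \<Gamma> \<longleftrightarrow> strictly_convex (\<Gamma> \<union> inside \<Gamma>)"

definition gauge_fun :: "'a::real_vector set \<Rightarrow> 'a \<Rightarrow> real" where
  "gauge_fun K x = Inf {r. 0 < r \<and> x \<in> (\<lambda>y. r *\<^sub>R y) ` K}"

text \<open>In the last conjunct, the determinant of \<open>\<gamma>'(t)\<close> and \<open>x - \<gamma>(t)\<close> is positive
  iff \<open>x\<close> lies to the left of the oriented tangent line, so it says that the curve is traversed
  counterclockwise.\<close>

definition minkowski_param :: "plane set \<Rightarrow> real \<Rightarrow> (real \<Rightarrow> plane) \<Rightarrow> bool" where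
  "minkowski_param \<Gamma> P \<gamma> \<longleftrightarrow> C2_closed_param \<Gamma> P \<gamma> \<and>
     (\<forall>t. gauge_fun (inside \<Gamma>) (vector_derivative \<gamma> (at t)) = 1) \<and>
     (\<forall>t. \<forall>x\<in>inside \<Gamma>.
        0 < vector_derivative \<gamma> (at t) $ 1 * (x - \<gamma> t) $ 2
          - vector_derivative \<gamma> (at t) $ 2 * (x - \<gamma> t) $ 1)"

text \<open>Oriented chords, with the topology of the product of the plane with itself.\<close>

definition phase_cylinder :: "plane set \<Rightarrow> (plane \<times> plane) set" where
  "phase_cylinder \<Gamma> = {(x, y). x \<in> \<Gamma> \<and> y \<in> \<Gamma> \<and> x \<noteq> y}"

definition gen_fun :: "plane set \<Rightarrow> (real \<Rightarrow> plane) \<Rightarrow> real \<Rightarrow> real \<Rightarrow> real" where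
  "gen_fun K \<gamma> t t\<^sub>1 = gauge_fun K (\<gamma> t\<^sub>1 - \<gamma> t)"

text \<open>A chord \<open>(\<gamma>(t), \<gamma>(t\<^sub>1))\<close> has the coordinates \<open>(t, s)\<close> with
  \<open>s = - \<partial>L/\<partial>t (t, t\<^sub>1)\<close>. The twist map takes \<open>(t\<^sub>0, s\<^sub>0)\<close> to \<open>(t\<^sub>1, s\<^sub>1)\<close> with
  \<open>s\<^sub>1 = \<partial>L/\<partial>t\<^sub>1 (t\<^sub>0, t\<^sub>1)\<close>, so it takes the chord \<open>(\<gamma>(t\<^sub>0), \<gamma>(t\<^sub>1))\<close> to the chord
  \<open>(\<gamma>(t\<^sub>1), \<gamma>(t\<^sub>2))\<close> for which \<open>s\<^sub>1\<close> is also \<open>- \<partial>L/\<partial>t (t\<^sub>1, t\<^sub>2)\<close>.\<close>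

definition consecutive :: "plane set \<Rightarrow> (real \<Rightarrow> plane) \<Rightarrow> plane \<Rightarrow> plane \<Rightarrow> plane \<Rightarrow> bool" where
  "consecutive K \<gamma> x y z \<longleftrightarrow> x \<noteq> y \<and> y \<noteq> z \<and>
     (\<exists>t\<^sub>0 t\<^sub>1 t\<^sub>2 s\<^sub>1. x = \<gamma> t\<^sub>0 \<and> y = \<gamma> t\<^sub>1 \<and> z = \<gamma> t\<^sub>2 \<and>
        ((\<lambda>\<tau>. gen_fun K \<gamma> t\<^sub>0 \<tau>) has_real_derivative s\<^sub>1) (at t\<^sub>1) \<and>
        ((\<lambda>\<tau>. gen_fun K \<gamma> \<tau> t\<^sub>2) has_real_derivative - s\<^sub>1) (at t\<^sub>1))"

definition billiard_map :: "plane set \<Rightarrow> (real \<Rightarrow> plane) \<Rightarrow> plane \<times> plane \<Rightarrow> plane \<times> plane" where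
  "billiard_map K \<gamma> = (\<lambda>(x, y). (y, THE z. consecutive K \<gamma> x y z))"

text \<open>On the cylinder, a simple closed curve is homotopically non-trivial iff it winds around
  exactly once.\<close>

definition rotational_invariant_curve ::
  "'a::topological_space set \<Rightarrow> ('a \<Rightarrow> 'a) \<Rightarrow> 'a set \<Rightarrow> bool" where
  "rotational_invariant_curve Z T C \<longleftrightarrow>
     (\<exists>p. simple_path p \<and> pathfinish p = pathstart p \<and> path_image p = C \<and> C \<subseteq> Z \<and>
        (\<forall>a. \<not> homotopic_loops Z p (\<lambda>_. a))) \<and>
     T ` C = C"

definition C1_map_on :: "'a::real_normed_vector set \<Rightarrow> ('a \<Rightarrow> 'b::real_normed_vector) \<Rightarrow> bool" where
  "C1_map_on V f \<longleftrightarrow>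
     (\<exists>f'. (\<forall>x\<in>V. (f has_derivative blinfun_apply (f' x)) (at x)) \<and> continuous_on V f')"

text \<open>The \<open>C\<^sup>1\<close> structure of the phase cylinder is the one with local coordinates \<open>(t, t\<^sub>1)\<close>.
  Every point has a \<open>C\<^sup>1\<close> foliated chart onto the open unit square, in which the plaques (the
  connected components of the leaves in the chart domain) are the horizontal segments.\<close>

definition C1_foliation ::
  "(real \<Rightarrow> plane) \<Rightarrow> (plane \<times> plane) set \<Rightarrow> (plane \<times> plane) set set \<Rightarrow> bool" where
  "C1_foliation \<gamma> U \<F> \<longleftrightarrow> partition_on U \<F> \<and>
     (\<forall>q. map_prod \<gamma> \<gamma> q \<in> U \<longrightarrow>
       (\<exists>V \<phi> \<psi>. open V \<and> q \<in> V \<and> map_prod \<gamma> \<gamma> ` V \<subseteq> U \<and>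
          homeomorphism V ({0<..<1} \<times> {0<..<1}) \<phi> \<psi> \<and>
          C1_map_on V \<phi> \<and> C1_map_on ({0<..<1::real} \<times> {0<..<1::real}) \<psi> \<and>
          (\<forall>C\<in>\<F>. \<forall>D\<in>components {q\<in>V. map_prod \<gamma> \<gamma> q \<in> C}.
             \<exists>h\<in>{0<..<1}. \<phi> ` D = {0<..<1} \<times> {h})))"

definition totally_integrable_on ::
  "plane set \<Rightarrow> (real \<Rightarrow> plane) \<Rightarrow> (plane \<times> plane) set \<Rightarrow> bool" where
  "totally_integrable_on \<Gamma> \<gamma> U \<longleftrightarrow> openin (top_of_set (phase_cylinder \<Gamma>)) U \<and>
     (\<exists>\<F>. C1_foliation \<gamma> U \<F> \<and>
        (\<forall>C\<in>\<F>. rotational_invariant_curve (phase_cylinder \<Gamma>) (billiard_map (inside \<Gamma>) \<gamma>) C))"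

end

theory Submission
  imports Defs "HOL-Complex_Analysis.Complex_Analysis"
begin

text \<open>
  Let \<open>B\<close> be a linear symmetry of \<open>\<Gamma>\<close> of finite order without fixed points on \<open>\<Gamma>\<close>, and consider
  the chords from \<open>x\<close> to \<open>B x\<close>. Since \<open>B\<close> preserves the gauge \<open>g\<close>, the chord on which
  \<open>g (B x - x)\<close> is least satisfies the reflection law at \<open>B x\<close>, so that \<open>x\<close>, \<open>B x\<close>, \<open>B\<^sup>2 x\<close>, ...
  is a periodic billiard orbit. Total integrability forces every periodic orbit to maximize the
  length among the closed polygons inscribed in \<open>\<Gamma>\<close> with the same number of vertices and the same
  winding (\<open>periodic_orbits_maximize\<close>). The polygons \<open>y\<close>, \<open>B y\<close>, \<open>B\<^sup>2 y\<close>, ... compete with this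
  orbit, and so the least value of \<open>g (B x - x)\<close> is also the greatest one: the chords from \<open>x\<close> to
  \<open>B x\<close> all have the same length \<open>c > 0\<close> (\<open>symmetric_chords_constant\<close>). In other words,
  \<open>(B - I) / c\<close> maps \<open>\<Gamma>\<close> to itself.

  In suitable linear coordinates the given map of order \<open>k\<close> is a rotation, and a power of it is
  the rotation by \<open>2 \<pi> / k\<close>. If the rotation by an angle \<open>\<phi>\<close> is a symmetry of \<open>\<Gamma>\<close>, then the
  preceding observation makes the rotation by \<open>\<phi> / 2 + \<pi> / 2\<close>, which is the direction of \<open>B - I\<close>,
  a symmetry as well; applied to the angle \<open>2 \<phi>\<close> it yields the rotation by \<open>\<phi> + \<pi> / 2\<close>, and the
  quotient of the two is the rotation by \<open>\<phi> / 2\<close> (\<open>curve_rot_halve\<close>). Repeated halving gives a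
  dense set of rotations, hence all of them, and \<open>\<Gamma>\<close> is a circle in these coordinates
  (\<open>rotation_symmetric_is_ellipse\<close>).

  Periodic orbits maximize the length for the following reasons. In the coordinates \<open>(t, y)\<close> of
  two consecutive bounce points the billiard map lifts to a twist map of the strip
  \<open>t < y < t + P\<close>, which preserves a finite area and is therefore nonwandering (\<open>nonwandering\<close>).
  Saturations of open sets by the leaves of the foliation are open (\<open>leaf_saturation_open\<close>), and
  so Baire's theorem shows that on a dense set of leaves the map is nonwandering along the leaf
  itself. Such a leaf is a graph over the circle: a fold of the curve would grow under iteration,
  while the recurrence of circle homeomorphisms brings some iterate of the map along the leaf
  uniformly close to the identity (\<open>recurrent_line_is_graph\<close>, which plays the role of Birkhoff's
  theorem). An invariant graph \<open>c\<close> is calibrated: for suitable \<open>M\<close> and \<open>U\<close>, the length of a chord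
  \<open>(t, y)\<close> is at most \<open>M + U y - U t\<close>, with equality on \<open>c\<close> (\<open>graph_line_calibrated\<close>). Summed
  along a closed polygon this bounds its length by that of an orbit segment on \<open>c\<close>, up to the
  failure of the segment to close up; letting \<open>c\<close> approach the given periodic orbit yields the
  claim.\<close>

section \<open>Recurrence of circle homeomorphisms\<close>

text \<open>
  The lift to the line of an orientation preserving homeomorphism of the circle \<open>\<real> / \<int>\<close> and the
  lift of its inverse.\<close>

locale circle_lift =
  fixes f f' :: "real \<Rightarrow> real"
  assumes f_mono: "strict_mono f"
    and f_cont: "continuous_on UNIV f"
    and f_shift1: "f (x + 1) = f x + 1"
    and f'_f [simp]: "f' (f x) = x"
    and f_f' [simp]: "f (f' x) = x"
begin

lemma f'_mono: "strict_mono f'"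
proof (rule strict_monoI)
  fix x y :: real assume "x < y"
  then have "f (f' x) < f (f' y)" by simp
  then show "f' x < f' y" by (simp only: strict_mono_less[OF f_mono])
qed

lemma f'_cont: "continuous_on UNIV f'"
proof (rule continuous_onI_mono)
  have "surj f'" by (rule surjI[of _ f]) simp
  then show "open (range f')" by simp
  show "f' x \<le> f' y" if "x \<le> y" for x y
    using that by (simp add: strict_mono_less_eq[OF f'_mono])
qed

lemma shift_nat: "f (x + real n) = f x + real n"
proof (induction n)
  case (Suc n)
  then show ?case using f_shift1[of "x + real n"] by (simp add: algebra_simps)
qed simp

lemma shift_int: "f (x + of_int k) = f x + of_int k"
proof (cases "k \<ge> 0")
  case True
  then show ?thesis using shift_nat[of x "nat k"] by simp
next
  case False
  then show ?thesis using shift_nat[of "x + of_int k" "nat (-k)"] by simp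
qed

lemma inverse_lift: "circle_lift f' f"
proof
  show "strict_mono f'" by (rule f'_mono)
  show "continuous_on UNIV f'" by (rule f'_cont)
  show "f' (x + 1) = f' x + 1" for x using f'_f[of "f' x + 1"] f_shift1[of "f' x"] by simp
qed simp_all

lemma funpow_mono: "strict_mono (f ^^ n)"
  by (induction n) (use f_mono in \<open>auto simp: strict_mono_def\<close>)

lemma funpow_shift: "(f ^^ n) (x + of_int k) = (f ^^ n) x + of_int k"
  by (induction n) (simp_all add: shift_int)

lemma funpow_cont: "continuous_on UNIV (f ^^ n)"
proof (induction n)
  case (Suc n)
  then show ?case using f_cont continuous_on_compose2[OF f_cont Suc] by (simp add: o_def)
qed (simp add: id_def)

lemma funpow_inv: "(f ^^ n) ((f' ^^ n) x) = x"
  by (induction n arbitrary: x) (simp_all add: funpow_swap1)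

text \<open>
  Negative exponents put the iterates of \<open>f\<close> and of its inverse into one family, which is linearly
  ordered up to integer translations if \<open>f\<close> has no periodic points.\<close>

definition iter :: "int \<Rightarrow> real \<Rightarrow> real" where
  "iter i = (if i \<ge> 0 then f ^^ nat i else f' ^^ nat (- i))"

lemma iter_Suc: "iter (i + 1) x = f (iter i x)"
proof (cases "i \<ge> 0")
  case True
  then have "nat (i + 1) = Suc (nat i)" by simp
  with True show ?thesis by (simp add: iter_def)
next
  case False
  then have *: "nat (- i) = Suc (nat (- (i + 1)))" by simp
  show ?thesis
  proof (cases "i = -1")
    case False
    with \<open>\<not> i \<ge> 0\<close> have "\<not> i + 1 \<ge> 0" by simp
    with \<open>\<not> i \<ge> 0\<close> show ?thesis unfolding iter_def * by simp
  qed (simp add: iter_def)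
qed

lemma iter_pred: "iter (i - 1) x = f' (iter i x)"
  using iter_Suc[of "i - 1" x] by simp

lemma iter_add: "iter (i + j) x = iter i (iter j x)"
proof (induction i rule: int_induct[where k = 0])
  case base
  show ?case by (simp add: iter_def)
next
  case (step1 i)
  then show ?case using iter_Suc[of "i + j" x] iter_Suc[of i] by (simp add: algebra_simps)
next
  case (step2 i)
  then show ?case using iter_pred[of "i + j" x] iter_pred[of i] by (simp add: algebra_simps)
qed

lemma iter_of_nat: "iter (int n) = f ^^ n"
  by (simp add: iter_def)

lemma iter_0 [simp]: "iter 0 x = x"
  by (simp add: iter_def)

lemma iter_mono: "strict_mono (iter i)"
  unfolding iter_def using funpow_mono circle_lift.funpow_mono[OF inverse_lift] by auto

lemma iter_cont: "continuous_on UNIV (iter i)"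
  unfolding iter_def using funpow_cont circle_lift.funpow_cont[OF inverse_lift] by auto

lemma iter_shift: "iter i (x + of_int k) = iter i x + of_int k"
  unfolding iter_def using funpow_shift circle_lift.funpow_shift[OF inverse_lift] by auto

lemma iter_shift_diff: "iter i (x - of_int k) = iter i x - of_int k"
  using iter_shift[of i x "- k"] by simp

text \<open>
  Take \<open>n\<close> least such that \<open>g = f\<^sup>n - m\<close> has a fixed point, and suppose that \<open>g\<close> moves \<open>\<sigma>\<close>. An
  iterate that returns from the interval between \<open>\<sigma>\<close> and \<open>g \<sigma>\<close> to itself commutes with \<open>g\<close>, hence
  permutes the gaps of the fixed point set of \<open>g\<close>; it maps the gap around \<open>\<sigma>\<close> to itself and fixes
  its end points. As \<open>n\<close> is least, it is a power of \<open>g\<close>. But on the gap \<open>g\<close> moves all points in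
  one direction, and no positive power of it returns to an interval between a point and its image.\<close>

lemma nonwandering_periodic_imp_translation:
  assumes nw: "\<And>u v. u < v \<Longrightarrow> \<exists>n\<ge>1. \<exists>m::int. \<exists>x. u < x \<and> x < v \<and>
      u < (f ^^ n) x - of_int m \<and> (f ^^ n) x - of_int m < v"
    and per: "\<exists>n\<ge>1. \<exists>e (m::int). (f ^^ n) e = e + of_int m"
  shows "\<exists>n\<ge>1. \<exists>m::int. \<forall>x. (f ^^ n) x = x + of_int m"
proof -
  define Q where "Q n \<longleftrightarrow> n \<ge> 1 \<and> (\<exists>e (m::int). (f ^^ n) e = e + of_int m)" for n
  define n where "n = (LEAST n. Q n)"
  have "\<exists>n. Q n" using per unfolding Q_def by blast
  then have "Q n" unfolding n_def by (rule LeastI_ex)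
  then obtain e0 :: real and m :: int where n1: "n \<ge> 1" and e0: "(f ^^ n) e0 = e0 + of_int m"
    unfolding Q_def by auto
  have least: "n \<le> n'" if "n' \<ge> 1" "(f ^^ n') e = e + of_int m'" for n' e and m' :: int
    unfolding n_def by (rule Least_le) (use that Q_def in blast)
  define g where "g x = (f ^^ n) x - of_int m" for x
  have g_mono: "strict_mono g" using funpow_mono[of n] by (auto simp: g_def strict_mono_def)
  have g_cont: "continuous_on UNIV g" unfolding g_def by (intro continuous_intros funpow_cont)
  have g_shift: "g (x + of_int k) = g x + of_int k" for x k by (simp add: g_def funpow_shift)
  have "g \<sigma> = \<sigma>" for \<sigma>
  proof (rule ccontr)
    assume ne: "g \<sigma> \<noteq> \<sigma>"
    define E where "E = {e. g e = e}"
    have clE: "closed E"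
      unfolding E_def using g_cont
      by (intro closed_Collect_eq) (auto intro: continuous_intros)
    have E_shift: "e0 + of_int k \<in> E" for k using e0 g_shift[of e0 k] by (auto simp: E_def g_def)
    \<comment> \<open>the gap of the fixed point set that contains \<open>\<sigma>\<close>\<close>
    define e1 where "e1 = Sup (E \<inter> {..\<sigma>})"
    define e2 where "e2 = Inf (E \<inter> {\<sigma>..})"
    have ne1: "E \<inter> {..\<sigma>} \<noteq> {}"
    proof -
      have "e0 + of_int \<lfloor>\<sigma> - e0\<rfloor> \<le> \<sigma>" using of_int_floor_le[of "\<sigma> - e0"] by linarith
      then show ?thesis using E_shift[of "\<lfloor>\<sigma> - e0\<rfloor>"] by blast
    qed
    have ne2: "E \<inter> {\<sigma>..} \<noteq> {}"
    proof -
      have "e0 + of_int \<lceil>\<sigma> - e0\<rceil> \<ge> \<sigma>" using le_of_int_ceiling[of "\<sigma> - e0"] by linarith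
      then show ?thesis using E_shift[of "\<lceil>\<sigma> - e0\<rceil>"] by blast
    qed
    have bd1: "bdd_above (E \<inter> {..\<sigma>})" by (auto intro: bdd_aboveI)
    have bd2: "bdd_below (E \<inter> {\<sigma>..})" by (auto intro: bdd_belowI)
    have e1: "e1 \<in> E \<inter> {..\<sigma>}" unfolding e1_def
      by (rule closed_contains_Sup) (use ne1 bd1 clE in auto)
    have e2: "e2 \<in> E \<inter> {\<sigma>..}" unfolding e2_def
      by (rule closed_contains_Inf) (use ne2 bd2 clE in auto)
    have e1\<sigma>: "e1 < \<sigma>" and \<sigma>e2: "\<sigma> < e2" using e1 e2 ne unfolding E_def
      by (auto simp: less_le)
    have gap: "e \<le> e1 \<or> e \<ge> e2" if "e \<in> E" for e
    proof (cases "e \<le> \<sigma>")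
      case True
      then have "e \<le> e1" unfolding e1_def using that bd1 by (intro cSup_upper) auto
      then show ?thesis ..
    next
      case False
      then have "e \<ge> e2" unfolding e2_def using that bd2 by (intro cInf_lower) auto
      then show ?thesis ..
    qed
    have g\<sigma>: "e1 < g \<sigma>" "g \<sigma> < e2"
      using strict_monoD[OF g_mono e1\<sigma>] strict_monoD[OF g_mono \<sigma>e2] e1 e2 by (auto simp: E_def)
    define u where "u = min \<sigma> (g \<sigma>)"
    define v where "v = max \<sigma> (g \<sigma>)"
    have "u < v" using ne by (auto simp: u_def v_def)
    \<comment> \<open>a return to the interval between \<open>\<sigma>\<close> and \<open>g \<sigma>\<close>\<close>
    from nw[OF this] obtain N :: nat and M :: int and \<tau> where N: "N \<ge> 1"
      and \<tau>: "u < \<tau>" "\<tau> < v" "u < (f ^^ N) \<tau> - of_int M" "(f ^^ N) \<tau> - of_int M < v" by blast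
    define g' where "g' x = (f ^^ N) x - of_int M" for x
    define gi where "gi x = (f' ^^ N) (x + of_int M)" for x
    have gi_g': "g' (gi x) = x" and g'_gi: "gi (g' x) = x" for x
      using circle_lift.funpow_inv[OF inverse_lift, of N x] by (simp_all add: g'_def gi_def funpow_inv)
    have g'_mono: "strict_mono g'" using funpow_mono[of N] by (auto simp: g'_def strict_mono_def)
    have gi_mono: "strict_mono gi"
      using circle_lift.funpow_mono[OF inverse_lift, of N] by (auto simp: gi_def strict_mono_def)
    have comm: "g (g' x) = g' (g x)" for x
    proof -
      have "(f ^^ n) ((f ^^ N) x) = (f ^^ N) ((f ^^ n) x)"
        by (metis add.commute comp_apply funpow_add)
      then show ?thesis
        using funpow_shift[of n "(f ^^ N) x" "- M"] funpow_shift[of N "(f ^^ n) x" "- m"]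
        by (simp add: g_def g'_def)
    qed
    have comm_i: "g (gi x) = gi (g x)" for x by (metis comm g'_gi gi_g')
    have uv: "e1 < u" "v < e2" using g\<sigma> e1\<sigma> \<sigma>e2 by (auto simp: u_def v_def)
    have "g' e1 \<in> E" "gi e1 \<in> E" using e1 comm[of e1] comm_i[of e1] by (auto simp: E_def)
    moreover have "g' e1 < e2"
      using strict_monoD[OF g'_mono, of e1 \<tau>] uv \<tau> by (simp add: g'_def)
    moreover have "gi e1 < e2"
    proof -
      have "gi e1 < gi (g' \<tau>)" by (rule strict_monoD[OF gi_mono]) (use uv \<tau> in \<open>simp add: g'_def\<close>)
      then show ?thesis using g'_gi \<tau> uv by simp
    qed
    ultimately have le: "g' e1 \<le> e1" "gi e1 \<le> e1" using gap[of "g' e1"] gap[of "gi e1"] by linarith+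
    have "g' (gi e1) \<le> g' e1" using le(2) by (simp add: strict_mono_less_eq[OF g'_mono])
    then have g'e1: "g' e1 = e1" using le(1) gi_g' by simp
    have ge1: "g e1 = e1" using e1 by (simp add: E_def)
    have pw: "(f ^^ (n * c)) x = (g ^^ c) x + of_int (int c * m)" for c x
    proof (induction c)
      case (Suc c)
      have "(f ^^ (n * Suc c)) x = (f ^^ n) ((f ^^ (n * c)) x)"
        by (simp add: funpow_add)
      also have "\<dots> = (f ^^ n) ((g ^^ c) x) + of_int (int c * m)" unfolding Suc by (rule funpow_shift)
      finally show ?case using g_def[of "(g ^^ c) x"] by (simp add: algebra_simps)
    qed simp
    have pe1: "(g ^^ c) e1 = e1" for c by (induction c) (simp_all add: ge1)
    define c where "c = N div n"
    have Nn: "N = N mod n + n * c" by (simp add: c_def)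
    have "(f ^^ (N mod n)) (e1 + of_int (int c * m)) = e1 + of_int M"
    proof -
      have "(f ^^ N) e1 = (f ^^ (N mod n)) ((f ^^ (n * c)) e1)"
        by (subst Nn) (simp only: funpow_add comp_apply)
      then show ?thesis using g'e1 by (simp add: pw pe1 g'_def)
    qed
    then have r: "(f ^^ (N mod n)) e1 = e1 + of_int (M - int c * m)"
      unfolding funpow_shift by simp
    have "N mod n = 0"
    proof (rule ccontr)
      assume "N mod n \<noteq> 0"
      then have "n \<le> N mod n" using least[OF _ r] by simp
      then show False using n1 mod_less_divisor[of n N] by linarith
    qed
    with r have "real_of_int (M - int c * m) = 0" by simp
    then have M: "M = int c * m" by linarith
    have Nc: "N = n * c" using Nn \<open>N mod n = 0\<close> by simp
    have c1: "c \<ge> 1" using Nc N by (cases c) auto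
    have g'_c: "g' \<tau> = (g ^^ c) \<tau>" by (simp add: g'_def Nc M pw)
    have gc_mono: "strict_mono (g ^^ c)" for c
      by (induction c) (use g_mono in \<open>auto simp: strict_mono_def\<close>)
    show False
    proof (cases "\<sigma> < g \<sigma>")
      case True
      have "(g ^^ c) \<sigma> \<ge> g \<sigma>" using c1
      proof (induction c rule: dec_induct)
        case (step c)
        have "g ((g ^^ c) \<sigma>) \<ge> g \<sigma>"
          using step True by (simp add: strict_mono_less_eq[OF g_mono])
        then show ?case by simp
      qed simp
      moreover have "(g ^^ c) \<sigma> < (g ^^ c) \<tau>"
        by (rule strict_monoD[OF gc_mono]) (use \<tau> True in \<open>auto simp: u_def\<close>)
      ultimately show False using g'_c \<tau> True by (simp add: v_def g'_def)
    next
      case False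
      then have lt: "g \<sigma> < \<sigma>" using ne by simp
      have "(g ^^ c) \<sigma> \<le> g \<sigma>" using c1
      proof (induction c rule: dec_induct)
        case (step c)
        have "g ((g ^^ c) \<sigma>) \<le> g \<sigma>"
          using step lt by (simp add: strict_mono_less_eq[OF g_mono])
        then show ?case by simp
      qed simp
      moreover have "(g ^^ c) \<tau> < (g ^^ c) \<sigma>"
        by (rule strict_monoD[OF gc_mono]) (use \<tau> lt in \<open>auto simp: v_def\<close>)
      ultimately show False using g'_c \<tau> lt by (simp add: u_def g'_def)
    qed
  qed
  then show ?thesis using n1 by (intro exI[of _ n] conjI exI[of _ m]) (auto simp: g_def algebra_simps)
qed

lemma aperiodic_iter_neq:
  assumes aper: "\<not> (\<exists>n\<ge>1. \<exists>e (m::int). (f ^^ n) e = e + of_int m)" and "i \<noteq> 0"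
  shows "iter i x \<noteq> x + of_int m"
proof
  assume eq: "iter i x = x + of_int m"
  show False
  proof (cases "i > 0")
    case True
    then have "(f ^^ nat i) x = x + of_int m" using eq by (simp add: iter_def)
    moreover have "nat i \<ge> 1" using True by simp
    ultimately show False using aper by blast
  next
    case False
    have "x = iter (- i) (iter i x)" by (simp flip: iter_add)
    then have "x = iter (- i) x + of_int m" by (simp add: eq iter_shift)
    then have "(f ^^ nat (- i)) x = x + of_int (- m)" using False by (simp add: iter_def split: if_splits)
    moreover have "nat (- i) \<ge> 1" using False assms(2) by simp
    ultimately show False using aper by blast
  qed
qed

text \<open>
  The difference of translates of two distinct iterates vanishes nowhere, since a zero would give
  a periodic point; so it has constant sign.\<close>

lemma aperiodic_ordered:
  assumes aper: "\<not> (\<exists>n\<ge>1. \<exists>e (m::int). (f ^^ n) e = e + of_int m)"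
    and le: "iter i x + of_int m \<le> iter j x + of_int k"
  shows "iter i y + of_int m \<le> iter j y + of_int k"
proof (cases "i = j")
  case True
  with le show ?thesis by simp
next
  case False
  define d where "d x = iter j x + of_int k - (iter i x + of_int m)" for x
  have nz: "d x \<noteq> 0" for x
  proof
    assume "d x = 0"
    then have "iter j x = iter i x + of_int (m - k)" by (simp add: d_def)
    then have "iter (- i) (iter j x) = iter (- i) (iter i x) + of_int (m - k)" by (simp only: iter_shift)
    then have "iter (j - i) x = x + of_int (m - k)" by (simp flip: iter_add)
    then show False using aperiodic_iter_neq[OF aper, of "j - i" x "m - k"] False by simp
  qed
  have "connected (range d)"
    by (intro connected_continuous_image)
      (auto simp: d_def intro!: continuous_intros iter_cont)
  then have *: "(\<exists>z. d z = 0)" if "d x \<ge> 0" "d y \<le> 0" for x y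
    using that connectedD_interval[of "range d" "d y" "d x" 0] by (auto simp: image_iff)
  have "d x \<ge> 0" using le by (simp add: d_def)
  then have "\<not> d y \<le> 0" using *[of x y] nz by blast
  then show ?thesis by (simp add: d_def)
qed

text \<open>
  If there is a periodic point, then some iterate is a translation. Otherwise cut the circle into
  \<open>K\<close> arcs. A return to an arc, or the inverse of that return, is a translated iterate that lies
  above the identity and moves the left end of the arc by less than \<open>1 / K\<close>. Translated iterates
  are linearly ordered, so that the least of these \<open>K\<close> maps moves the left ends of all arcs by
  less than \<open>1 / K\<close>, and hence moves no point by \<open>2 / K\<close> or more.\<close>

lemma nonwandering_imp_uniformly_recurrent:
  assumes nw: "\<And>u v. u < v \<Longrightarrow> \<exists>n\<ge>1. \<exists>m::int. \<exists>x. u < x \<and> x < v \<and>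
      u < (f ^^ n) x - of_int m \<and> (f ^^ n) x - of_int m < v"
    and "\<epsilon> > 0"
  shows "\<exists>n\<ge>1. \<exists>m::int. \<forall>x. \<bar>(f ^^ n) x - of_int m - x\<bar> < \<epsilon>"
proof (cases "\<exists>n\<ge>1. \<exists>e (m::int). (f ^^ n) e = e + of_int m")
  case True
  obtain n and m :: int where "n \<ge> 1" "\<forall>x. (f ^^ n) x = x + of_int m" using nonwandering_periodic_imp_translation[OF nw True] by blast
  then show ?thesis using \<open>\<epsilon> > 0\<close> by (intro exI[of _ n] conjI exI[of _ m]) auto
next
  case aper: False
  obtain K :: nat where K: "K > 0" "2 / real K < \<epsilon>"
  proof -
    obtain K :: nat where "real K > 2 / \<epsilon>" using reals_Archimedean2 by blast
    moreover from this have "K > 0" using \<open>\<epsilon> > 0\<close> by (cases K) auto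
    ultimately show ?thesis using \<open>\<epsilon> > 0\<close> by (intro that[of K]) (auto simp: field_simps)
  qed
  define s where "s (i::nat) = real i / real K" for i
  have s_less: "s i < s (Suc i)" for i using K by (simp add: s_def field_simps)
  \<comment> \<open>every translated iterate lies entirely above or entirely below the identity\<close>
  have id_le: "(\<forall>x. x < iter i x + of_int m) \<or> (\<forall>x. iter i x + of_int m < x)" if "i \<noteq> 0" for i m
  proof -
    have "iter i x + of_int m \<noteq> x" for x
      using aperiodic_iter_neq[OF aper that, of x "- m"] by auto
    then have ne: "iter i x + of_int m < x \<or> x < iter i x + of_int m" for x by (meson linorder_neqE)
    have "iter i y + of_int m \<le> y" if "iter i x + of_int m \<le> x" for x y
      using aperiodic_ordered[OF aper, of i x m 0 0 y] that by simp
    then show ?thesis using ne by (meson less_le_not_le linorder_not_less)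
  qed
  have "\<exists>N M. N \<noteq> 0 \<and> (\<forall>x. x < iter N x + of_int M) \<and> iter N (s i) + of_int M < s (Suc i)" for i
  proof -
    obtain n m x where n: "n \<ge> 1" and x: "s i < x" "x < s (Suc i)"
      "s i < (f ^^ n) x - of_int m" "(f ^^ n) x - of_int m < s (Suc i)"
      using nw[OF s_less[of i]] by blast
    have n0: "int n \<noteq> 0" using n by simp
    from id_le[OF n0, of "- m"] show ?thesis
    proof
      assume *: "\<forall>x. x < iter (int n) x + of_int (- m)"
      have "(f ^^ n) (s i) < (f ^^ n) x" by (rule strict_monoD[OF funpow_mono x(1)])
      then have "iter (int n) (s i) + of_int (- m) < s (Suc i)" using x by (simp add: iter_of_nat)
      with * n0 show ?thesis by blast
    next
      assume *: "\<forall>x. iter (int n) x + of_int (- m) < x"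
      have inv: "iter (- int n) (iter (int n) z - of_int m) + of_int m = z" for z
        by (simp only: iter_shift_diff) (simp flip: iter_add)
      have **: "z < iter (- int n) z + of_int m" for z
      proof -
        have "iter (int n) (iter (- int n) z + of_int m) + of_int (- m) = z"
          by (simp only: iter_shift) (simp flip: iter_add)
        then show ?thesis using *[rule_format, of "iter (- int n) z + of_int m"] by simp
      qed
      have "iter (- int n) (s i) < iter (- int n) (iter (int n) x - of_int m)"
        by (rule strict_monoD[OF iter_mono]) (use x in \<open>simp add: iter_of_nat\<close>)
      then have "iter (- int n) (s i) + of_int m < s (Suc i)" using inv[of x] x by linarith
      with ** n0 show ?thesis by (metis neg_equal_0_iff_equal)
    qed
  qed
  then obtain N M where NM: "\<And>i. N i \<noteq> 0" "\<And>i x. x < iter (N i) x + of_int (M i)"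
    "\<And>i. iter (N i) (s i) + of_int (M i) < s (Suc i)" by metis
  \<comment> \<open>\<open>h i\<close> is the return of the arc that starts at \<open>s i\<close>; \<open>h j\<close> is the least of these maps\<close>
  define h where "h i x = iter (N i) x + of_int (M i)" for i :: nat and x
  obtain j where j: "\<And>i. i < K \<Longrightarrow> h j 0 \<le> h i 0"
  proof -
    have "\<exists>j\<in>{..<K}. \<forall>i\<in>{..<K}. h j 0 \<le> h i 0"
    proof -
      have "Min ((\<lambda>i. h i 0) ` {..<K}) \<in> (\<lambda>i. h i 0) ` {..<K}" using K by (intro Min_in) auto
      then obtain j where "j < K" "h j 0 = Min ((\<lambda>i. h i 0) ` {..<K})" by auto
      then show ?thesis by (intro bexI[of _ j]) auto
    qed
    then show ?thesis using that by auto
  qed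
  have jle: "h j x \<le> h i x" if "i < K" for i x
    using aperiodic_ordered[OF aper j[OF that, unfolded h_def]] by (simp add: h_def)
  have step: "h j x < x + 2 / real K" for x
  proof -
    define i where "i = nat \<lfloor>real K * frac x\<rfloor>"
    have fr: "0 \<le> real K * frac x" "real K * frac x < real K"
      using K frac_lt_1[of x] frac_ge_0[of x] by simp_all
    have iK: "i < K" using fr unfolding i_def by linarith
    have i: "real i \<le> real K * frac x" "real K * frac x < real i + 1"
      using fr unfolding i_def by linarith+
    have si: "s i \<le> frac x" "frac x < s (Suc i)" using i K by (simp_all add: s_def field_simps)
    have "h j (frac x) < s (Suc (Suc i))"
    proof -
      have "h j (frac x) < h j (s (Suc i))"
        unfolding h_def using strict_monoD[OF iter_mono si(2)] by simp
      also have "h j (s (Suc i)) < s (Suc (Suc i))"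
      proof (cases "Suc i < K")
        case True
        then show ?thesis using jle[OF True, of "s (Suc i)"] NM(3)[of "Suc i"] by (simp add: h_def)
      next
        case False
        then have e: "Suc i = K" using iK by simp
        have "s (Suc i) = s 0 + of_int 1" using K e by (simp add: s_def)
        moreover have "s (Suc (Suc i)) = s (Suc 0) + 1" 
        proof -
          have "real i + 1 = real K" using e by linarith
          then show ?thesis using K by (simp add: s_def divide_simps)
        qed
        moreover have "h j (s 0 + of_int 1) = h j (s 0) + 1" unfolding h_def iter_shift by simp
        moreover have "h j (s 0) < s (Suc 0)" using jle[of 0 "s 0"] NM(3)[of 0] K by (simp add: h_def)
        ultimately show ?thesis by simp
      qed
      finally show ?thesis .
    qed
    also have "s (Suc (Suc i)) = s i + 2 / real K" by (simp add: s_def flip: add_divide_distrib)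
    finally have "h j (frac x) < frac x + 2 / real K" using si by simp
    moreover have "h j x = h j (frac x) + of_int \<lfloor>x\<rfloor>"
      using iter_shift[of "N j" "frac x" "\<lfloor>x\<rfloor>"] by (simp add: h_def frac_def)
    ultimately show ?thesis by (simp add: frac_def)
  qed
  show ?thesis
  proof (cases "N j > 0")
    case True
    then have "iter (N j) = f ^^ nat (N j)" by (simp add: iter_def)
    moreover have "\<bar>iter (N j) x - of_int (- M j) - x\<bar> < \<epsilon>" for x
      using step[of x] NM(2)[of x j] K by (simp add: h_def)
    moreover have "nat (N j) \<ge> 1" using True by simp
    ultimately show ?thesis by metis
  next
    case False
    have "\<bar>iter (- N j) x - of_int (M j) - x\<bar> < \<epsilon>" for x
    proof -
      define y where "y = iter (- N j) x - of_int (M j)"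
      have "h j y = iter (N j) (iter (- N j) x)" unfolding h_def y_def iter_shift_diff by simp
      then have "h j y = x" by (simp flip: iter_add)
      then show ?thesis using step[of y] NM(2)[of y j] K by (simp add: h_def y_def)
    qed
    moreover have "iter (- N j) = f ^^ nat (- N j)" using False NM(1)[of j] by (simp add: iter_def)
    moreover have "nat (- N j) \<ge> 1" using False NM(1)[of j] by simp
    ultimately show ?thesis by metis
  qed
qed

end

section \<open>Folded curves of recurrent circle homeomorphisms\<close>

text \<open>
  The function \<open>a\<close> is a bounded perturbation of a linear one, and so it attains \<open>x\<close> on a nonempty
  compact set.\<close>

lemma first_and_last_hit:
  fixes a :: "real \<Rightarrow> real"
  assumes cont: "continuous_on UNIV a" and per: "\<And>\<sigma>. a (\<sigma> + 1) = a \<sigma> + P" and "P > 0"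
  shows "\<exists>p q. a p = x \<and> (\<forall>\<sigma><p. a \<sigma> < x) \<and> a q = x \<and> (\<forall>\<sigma>>q. x < a \<sigma>)"
proof -
  have pn: "a (\<sigma> + real n) = a \<sigma> + real n * P" for \<sigma> n
  proof (induction n)
    case (Suc n)
    then show ?case using per[of "\<sigma> + real n"] by (simp add: algebra_simps)
  qed simp
  have pi: "a (\<sigma> + of_int k) = a \<sigma> + of_int k * P" for \<sigma> k
  proof (cases "k \<ge> 0")
    case True
    then show ?thesis using pn[of \<sigma> "nat k"] by simp
  next
    case False
    then show ?thesis using pn[of "\<sigma> + of_int k" "nat (- k)"] by simp
  qed
  have "compact (a ` {0..1})"
    by (intro compact_continuous_image continuous_on_subset[OF cont]) auto
  then have "bounded (a ` {0..1})" by (rule compact_imp_bounded)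
  then obtain C where C: "\<And>\<sigma>. \<sigma> \<in> {0..1} \<Longrightarrow> \<bar>a \<sigma>\<bar> \<le> C"
    unfolding bounded_real by (metis imageI)
  have near: "\<bar>a \<sigma> - of_int \<lfloor>\<sigma>\<rfloor> * P\<bar> \<le> C" for \<sigma>
  proof -
    have "a \<sigma> = a (frac \<sigma>) + of_int \<lfloor>\<sigma>\<rfloor> * P" using pi[of "frac \<sigma>" "\<lfloor>\<sigma>\<rfloor>"] by (simp only: frac_def) simp
    moreover have "frac \<sigma> \<in> {0..1}" using frac_ge_0[of \<sigma>] frac_lt_1[of \<sigma>] by simp
    ultimately show ?thesis using C by simp
  qed
  define R where "R = (\<bar>x\<bar> + C) / P + 1"
  have low: "a \<sigma> < x" if "\<sigma> < - R" for \<sigma>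
  proof -
    have "of_int \<lfloor>\<sigma>\<rfloor> * P \<le> \<sigma> * P" using \<open>P > 0\<close> by (intro mult_right_mono) auto
    also have "\<dots> < - R * P" using mult_strict_right_mono[OF that \<open>P > 0\<close>] by simp
    also have "\<dots> \<le> - (\<bar>x\<bar> + C)" using \<open>P > 0\<close> by (simp add: R_def field_simps)
    finally show ?thesis using near[of \<sigma>] by linarith
  qed
  have high: "a \<sigma> > x" if "\<sigma> > R" for \<sigma>
  proof -
    have "R - 1 \<le> of_int \<lfloor>\<sigma>\<rfloor>" using that by linarith
    have "of_int \<lfloor>\<sigma>\<rfloor> * P > (R - 1) * P" using that \<open>P > 0\<close> by (intro mult_strict_right_mono) linarith+
    moreover have "(R - 1) * P = \<bar>x\<bar> + C" using \<open>P > 0\<close> by (simp add: R_def)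
    ultimately show ?thesis using near[of \<sigma>] by linarith
  qed
  define S where "S = {\<sigma>. a \<sigma> = x}"
  have ivt: "\<exists>\<sigma>. u \<le> \<sigma> \<and> \<sigma> \<le> v \<and> a \<sigma> = x" if "a u \<le> x" "x \<le> a v" "u \<le> v" for u v
    using that IVT'[of a u x v] continuous_on_subset[OF cont] by auto
  have "-R - 1 \<le> R + 1" using C[of 0] \<open>P > 0\<close> by (simp add: R_def field_simps)
  then have ne: "S \<noteq> {}"
    using ivt[of "- R - 1" "R + 1"] low[of "- R - 1"] high[of "R + 1"] unfolding S_def by force
  have cl: "closed S" unfolding S_def using cont by (intro closed_Collect_eq) auto
  have sub: "S \<subseteq> {-R..R}"
  proof
    fix \<sigma> assume "\<sigma> \<in> S"
    then have "a \<sigma> = x" by (simp add: S_def)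
    then show "\<sigma> \<in> {-R..R}" using low[of \<sigma>] high[of \<sigma>] by force
  qed
  have bd: "bdd_below S" "bdd_above S"
    using bdd_below_mono[OF bdd_below_Icc sub] bdd_above_mono[OF bdd_above_Icc sub] by blast+
  have p: "Inf S \<in> S" and q: "Sup S \<in> S" using closed_contains_Inf[OF ne bd(1) cl] closed_contains_Sup[OF ne bd(2) cl] .
  have "a \<sigma> < x" if "\<sigma> < Inf S" for \<sigma>
  proof (rule ccontr)
    assume "\<not> a \<sigma> < x"
    moreover have "a (min \<sigma> (- R - 1)) < x" by (rule low) linarith
    ultimately obtain \<tau> where "\<tau> \<le> \<sigma>" "a \<tau> = x"
      using ivt[of "min \<sigma> (- R - 1)" \<sigma>] by (meson less_imp_le linorder_not_less min.cobounded1)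
    moreover from this have "Inf S \<le> \<tau>" by (intro cInf_lower[OF _ bd(1)]) (simp add: S_def)
    ultimately show False using that by simp
  qed
  moreover have "x < a \<sigma>" if "\<sigma> > Sup S" for \<sigma>
  proof (rule ccontr)
    assume "\<not> x < a \<sigma>"
    moreover have "x < a (max \<sigma> (R + 1))" by (rule high) linarith
    ultimately obtain \<tau> where "\<sigma> \<le> \<tau>" "a \<tau> = x"
      using ivt[of \<sigma> "max \<sigma> (R + 1)"] by (meson less_imp_le linorder_not_less max.cobounded1)
    moreover from this have "\<tau> \<le> Sup S" by (intro cSup_upper[OF _ bd(2)]) (simp add: S_def)
    ultimately show False using that by simp
  qed
  ultimately show ?thesis using p q unfolding S_def by blast
qed

context circle_lift
begin

text \<open>
  Let \<open>F x\<close> and \<open>G x\<close> be the first and the last parameter at which \<open>a\<close> takes the value \<open>x\<close>. The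
  curve is folded over \<open>x\<close> if \<open>F x < G x\<close>; the fold is positive if the image of its last point is
  to the left of the image of its first one. Over every value between these two images the curve
  is folded again, the new fold contains the image of the old one, and by \<open>cross\<close> it is positive.
  The folds obtained in this way from a fold over \<open>x\<close> therefore contain the iterates of an
  interval \<open>[u, v]\<close> that is strictly larger than \<open>[F x, G x]\<close>. An iterate close to a translation
  then gives a fold over some \<open>y\<close> that contains a translate of \<open>[F x, G x]\<close> in its interior, with
  \<open>a < x\<close> at one end and \<open>a > x\<close> at the other end after translation back; but \<open>a\<close> takes the same
  value at both ends.\<close>

lemma no_positive_fold:
  fixes a :: "real \<Rightarrow> real"
  assumes cont: "continuous_on UNIV a" and per: "\<And>\<sigma>. a (\<sigma> + 1) = a \<sigma> + P" and "P > 0"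
    and cross: "\<And>\<sigma> \<sigma>'. a \<sigma> = a \<sigma>' \<Longrightarrow> a (f \<sigma>) < a (f \<sigma>') \<longleftrightarrow> a (f' \<sigma>') < a (f' \<sigma>)"
    and rec: "\<And>\<epsilon>. \<epsilon> > 0 \<Longrightarrow> \<exists>n\<ge>1. \<exists>m::int. \<forall>x. \<bar>(f ^^ n) x - of_int m - x\<bar> < \<epsilon>"
    and fold: "a l = x" "\<And>\<sigma>. \<sigma> < l \<Longrightarrow> a \<sigma> < x" "a r = x" "\<And>\<sigma>. \<sigma> > r \<Longrightarrow> x < a \<sigma>"
      "l < r" "a (f r) < a (f l)"
  shows False
proof -
  have "\<forall>x. \<exists>p q. a p = x \<and> (\<forall>\<sigma><p. a \<sigma> < x) \<and> a q = x \<and> (\<forall>\<sigma>>q. x < a \<sigma>)"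
    using first_and_last_hit[OF cont per \<open>P > 0\<close>] by blast
  then obtain F G where F: "\<And>x. a (F x) = x" "\<And>x \<sigma>. \<sigma> < F x \<Longrightarrow> a \<sigma> < x"
    and G: "\<And>x. a (G x) = x" "\<And>x \<sigma>. \<sigma> > G x \<Longrightarrow> x < a \<sigma>" by metis
  have F_least: "F x \<le> \<sigma>" if "x \<le> a \<sigma>" for x \<sigma> using F(2)[of \<sigma> x] that by fastforce
  have G_greatest: "\<sigma> \<le> G x" if "a \<sigma> \<le> x" for x \<sigma> using G(2)[of x \<sigma>] that by fastforce
  have F_mono: "F x < F y" if "x < y" for x y
    using F_least[of x "F y"] F(1)[of x] F(1)[of y] that by (force simp: less_le)
  have G_mono: "G x < G y" if "x < y" for x y
    using G_greatest[of "G x" y] G(1)[of x] G(1)[of y] that by (force simp: less_le)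
  have FG: "F x \<le> G x" for x by (rule F_least) (simp add: G)
  define pos where "pos x \<longleftrightarrow> F x < G x \<and> a (f (G x)) < a (f (F x))" for x
  define nxt where "nxt x = (a (f (G x)) + a (f (F x))) / 2" for x
  have lr: "l = F x" "r = G x"
  proof -
    have "F x \<le> l" "r \<le> G x" using F_least G_greatest fold by auto
    moreover have "\<not> F x < l" "\<not> r < G x" using fold(2)[of "F x"] fold(4)[of "G x"] F(1)[of x] G(1)[of x] by auto
    ultimately show "l = F x" "r = G x" by auto
  qed
  have pos_x: "pos x" using fold lr by (simp add: pos_def)
  have nxt: "F (nxt y) < f (F y)" "f (G y) < G (nxt y)" "pos (nxt y)" if "pos y" for y
  proof -
    have between: "a (f (G y)) < nxt y" "nxt y < a (f (F y))" using that by (simp_all add: pos_def nxt_def)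
    show 1: "F (nxt y) < f (F y)"
      using F_least[of "nxt y" "f (F y)"] F(1)[of "nxt y"] between by (auto simp: less_le)
    show 2: "f (G y) < G (nxt y)"
      using G_greatest[of "f (G y)" "nxt y"] G(1)[of "nxt y"] between by (auto simp: less_le)
    have "f' (F (nxt y)) < F y" using strict_monoD[OF f'_mono 1] by simp
    moreover have "G y < f' (G (nxt y))" using strict_monoD[OF f'_mono 2] by simp
    ultimately have "a (f' (F (nxt y))) < a (f' (G (nxt y)))"
      using F(2)[of "f' (F (nxt y))" y] G(2)[of y "f' (G (nxt y))"] by linarith
    then have "a (f (G (nxt y))) < a (f (F (nxt y)))"
      using cross[of "G (nxt y)" "F (nxt y)"] F(1)[of "nxt y"] G(1)[of "nxt y"] by simp
    moreover have "F (nxt y) \<noteq> G (nxt y)" using calculation by auto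
    ultimately show "pos (nxt y)" using FG[of "nxt y"] by (simp add: pos_def)
  qed
  have pos_n: "pos ((nxt ^^ n) x)" for n
    by (induction n) (use pos_x nxt in auto)
  define u where "u = f' (F (nxt x))"
  define v where "v = f' (G (nxt x))"
  have u: "u < F x" and v: "G x < v"
    using strict_monoD[OF f'_mono nxt(1)[OF pos_x]] strict_monoD[OF f'_mono nxt(2)[OF pos_x]]
    by (simp_all add: u_def v_def)
  have grow: "F ((nxt ^^ n) x) \<le> (f ^^ n) u \<and> (f ^^ n) v \<le> G ((nxt ^^ n) x)" if "n \<ge> 1" for n
    using that
  proof (induction n rule: dec_induct)
    case base
    show ?case by (simp add: u_def v_def)
  next
    case (step n)
    have "f (F ((nxt ^^ n) x)) \<le> f ((f ^^ n) u)" "f ((f ^^ n) v) \<le> f (G ((nxt ^^ n) x))"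
      using step by (simp_all add: strict_mono_less_eq[OF f_mono])
    then show ?case using nxt(1,2)[OF pos_n[of n]] by simp
  qed
  obtain n :: nat and m :: int where n: "n \<ge> 1"
    and nm: "\<And>y. \<bar>(f ^^ n) y - of_int m - y\<bar> < min (F x - u) (v - G x)"
    using rec[of "min (F x - u) (v - G x)"] u v by auto
  define y where "y = (nxt ^^ n) x"
  have "F y < F x + of_int m" using grow[OF n] nm[of u] unfolding y_def by linarith
  moreover have "G x + of_int m < G y" using grow[OF n] nm[of v] unfolding y_def by linarith
  moreover have a_shift: "a (\<sigma> + of_int k) = a \<sigma> + of_int k * P" for \<sigma> k
  proof (induction k rule: int_induct[where k = 0])
    case (step1 i)
    then show ?case using per[of "\<sigma> + of_int i"] by (simp add: algebra_simps)
  next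
    case (step2 i)
    then show ?case using per[of "\<sigma> + of_int i - 1"] by (simp add: algebra_simps)
  qed simp
  ultimately have "a (F y - of_int m) < x" "x < a (G y - of_int m)"
    using F(2)[of "F y - of_int m" x] G(2)[of x "G y - of_int m"] by simp_all
  then show False using a_shift[of "F y" "- m"] a_shift[of "G y" "- m"] F(1)[of y] G(1)[of y] by simp
qed

lemma recurrent_inverse:
  assumes "\<And>x. \<bar>(f ^^ n) x - of_int m - x\<bar> < \<epsilon>"
  shows "\<bar>(f' ^^ n) x - of_int (- m) - x\<bar> < \<epsilon>"
  using assms[of "(f' ^^ n) x"] by (simp add: funpow_inv abs_minus_commute algebra_simps)

text \<open>
  The function \<open>a\<close> is the projection of an invariant curve to the circle, and \<open>f\<close> is the dynamics
  on the curve. The hypothesis \<open>cross\<close> expresses the twist: on a fibre the order of the images is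
  opposite to that of the preimages. If \<open>a\<close> is not injective then the curve has a fold, which is
  positive either for \<open>f\<close> or for its inverse, and both are recurrent.\<close>

theorem recurrent_imp_graph:
  fixes a :: "real \<Rightarrow> real"
  assumes cont: "continuous_on UNIV a" and per: "\<And>\<sigma>. a (\<sigma> + 1) = a \<sigma> + P" and "P > 0"
    and cross: "\<And>\<sigma> \<sigma>'. a \<sigma> = a \<sigma>' \<Longrightarrow> a (f \<sigma>) < a (f \<sigma>') \<longleftrightarrow> a (f' \<sigma>') < a (f' \<sigma>)"
    and ne: "\<And>\<sigma> \<sigma>'. a \<sigma> = a \<sigma>' \<Longrightarrow> \<sigma> \<noteq> \<sigma>' \<Longrightarrow> a (f \<sigma>) \<noteq> a (f \<sigma>')"
    and rec: "\<And>\<epsilon>. \<epsilon> > 0 \<Longrightarrow> \<exists>n\<ge>1. \<exists>m::int. \<forall>x. \<bar>(f ^^ n) x - of_int m - x\<bar> < \<epsilon>"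
  shows "strict_mono a"
proof -
  have inj: "\<sigma> = \<sigma>'" if "a \<sigma> = a \<sigma>'" for \<sigma> \<sigma>'
  proof (rule ccontr)
    assume "\<sigma> \<noteq> \<sigma>'"
    obtain l r where l: "a l = a \<sigma>" "\<And>\<tau>. \<tau> < l \<Longrightarrow> a \<tau> < a \<sigma>" and r: "a r = a \<sigma>" "\<And>\<tau>. \<tau> > r \<Longrightarrow> a \<sigma> < a \<tau>"
      using first_and_last_hit[OF cont per \<open>P > 0\<close>, of "a \<sigma>"] by metis
    have "l \<le> \<sigma>" "l \<le> \<sigma>'" "\<sigma> \<le> r" "\<sigma>' \<le> r" using l(2) r(2) that by (metis less_irrefl not_less)+
    with \<open>\<sigma> \<noteq> \<sigma>'\<close> have lr: "l < r" by linarith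
    then have "a (f l) \<noteq> a (f r)" using ne[of l r] l r by simp
    then consider "a (f r) < a (f l)" | "a (f l) < a (f r)" by linarith
    then show False
    proof cases
      case 1
      show False
        by (rule no_positive_fold[OF cont per \<open>P > 0\<close> cross rec l r lr 1])
    next
      case 2
      then have 2: "a (f' r) < a (f' l)" using cross[of l r] l r by simp
      interpret inv: circle_lift f' f by (rule inverse_lift)
      show False
      proof (rule inv.no_positive_fold[OF cont per \<open>P > 0\<close> _ _ l r lr 2])
        show "a (f' \<tau>) < a (f' \<tau>') \<longleftrightarrow> a (f \<tau>') < a (f \<tau>)" if "a \<tau> = a \<tau>'" for \<tau> \<tau>'
          using cross[of \<tau>' \<tau>] that by simp
        show "\<exists>n\<ge>1. \<exists>m::int. \<forall>x. \<bar>(f' ^^ n) x - of_int m - x\<bar> < \<epsilon>" if "\<epsilon> > 0" for \<epsilon>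
          using rec[OF that] recurrent_inverse by metis
      qed
    qed
  qed
  then have "inj_on a UNIV" by (auto intro: injI)
  then have "strict_mono a \<or> strict_antimono_on UNIV a"
    using injective_eq_monotone_map[of UNIV a] cont by simp
  moreover have "\<not> strict_antimono_on UNIV a"
  proof
    assume "strict_antimono_on UNIV a"
    then have "a (0 + 1) < a 0" using monotone_onD[of UNIV "(<)" "(>)" a 0 1] by simp
    then show False using per[of 0] \<open>P > 0\<close> by simp
  qed
  ultimately show ?thesis by blast
qed

end

section \<open>Twist maps given by a generating function\<close>

text \<open>
  The lift of an area preserving twist map of an annulus, in the coordinates \<open>(t, y)\<close> of two
  consecutive points of an orbit. The monotonicity of \<open>L1\<close> and \<open>L2\<close> is the twist condition, stated
  without second derivatives because the generating functions of interest are only \<open>C\<^sup>1\<close>. The law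
  \<open>L1 y z = - L2 t y\<close> determines the next point \<open>z\<close>; by \<open>forward\<close> it can be solved. The bound on
  \<open>L1\<close> makes the area of the annulus finite.\<close>

locale twist_map =
  fixes P \<kappa> :: real and L L1 L2 :: "real \<Rightarrow> real \<Rightarrow> real"
  assumes P_pos: "P > 0"
    and deriv1: "\<And>t y. t < y \<Longrightarrow> y < t + P \<Longrightarrow> ((\<lambda>\<tau>. L \<tau> y) has_real_derivative L1 t y) (at t)"
    and deriv2: "\<And>t y. t < y \<Longrightarrow> y < t + P \<Longrightarrow> (L t has_real_derivative L2 t y) (at y)"
    and cont0: "continuous_on {(t, y). t < y \<and> y < t + P} (\<lambda>(t, y). L t y)"
    and cont1: "continuous_on {(t, y). t < y \<and> y < t + P} (\<lambda>(t, y). L1 t y)"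
    and cont2: "continuous_on {(t, y). t < y \<and> y < t + P} (\<lambda>(t, y). L2 t y)"
    and mono1: "\<And>t y y'. t < y \<Longrightarrow> y < y' \<Longrightarrow> y' < t + P \<Longrightarrow> L1 t y < L1 t y'"
    and mono2: "\<And>t t' y. y < t + P \<Longrightarrow> t < t' \<Longrightarrow> t' < y \<Longrightarrow> L2 t y < L2 t' y"
    and L1_shift: "\<And>t y. L1 (t + P) (y + P) = L1 t y"
    and L2_shift: "\<And>t y. L2 (t + P) (y + P) = L2 t y"
    and forward: "\<And>t y. t < y \<Longrightarrow> y < t + P \<Longrightarrow> \<exists>z. y < z \<and> z < y + P \<and> L1 y z = - L2 t y"
    and bound1: "\<And>t y. t < y \<Longrightarrow> y < t + P \<Longrightarrow> \<bar>L1 t y\<bar> \<le> \<kappa>"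
begin

definition strip :: "(real \<times> real) set" where
  "strip = {(t, y). t < y \<and> y < t + P}"

lemma strip_iff: "(t, y) \<in> strip \<longleftrightarrow> t < y \<and> y < t + P"
  by (simp add: strip_def)

lemma open_strip: "open strip"
proof -
  have "strip = {q. fst q < snd q} \<inter> {q. snd q < fst q + P}" by (auto simp: strip_def)
  moreover have "open {q :: real \<times> real. fst q < snd q}" "open {q :: real \<times> real. snd q < fst q + P}"
    by (intro open_Collect_less continuous_intros)+
  ultimately show ?thesis by auto
qed

definition T :: "real \<times> real \<Rightarrow> real \<times> real" where
  "T = (\<lambda>(t, y). (y, THE z. y < z \<and> z < y + P \<and> L1 y z = - L2 t y))"

definition shift :: "int \<Rightarrow> real \<times> real \<Rightarrow> real \<times> real" where
  "shift m q = (fst q + of_int m * P, snd q + of_int m * P)"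

lemma T_eqI:
  assumes "y < z" "z < y + P" "L1 y z = - L2 t y"
  shows "T (t, y) = (y, z)"
proof -
  have uniq: "z' = z" if "y < z'" "z' < y + P" "L1 y z' = - L2 t y" for z'
  proof (rule ccontr)
    assume "z' \<noteq> z"
    then consider "z < z'" | "z' < z" by linarith
    then show False
    proof cases
      case 1
      then show False using assms that mono1[of y z z'] by simp
    next
      case 2
      then show False using assms that mono1[of y z' z] by simp
    qed
  qed
  have "(THE z. y < z \<and> z < y + P \<and> L1 y z = - L2 t y) = z"
  proof (rule the_equality)
    show "y < z \<and> z < y + P \<and> L1 y z = - L2 t y" using assms by blast
  qed (use uniq in blast)
  then show ?thesis by (simp add: T_def)
qed

lemma T_props:
  assumes "(t, y) \<in> strip"
  obtains z where "T (t, y) = (y, z)" "(y, z) \<in> strip" "L1 y z = - L2 t y"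
proof -
  obtain z where "y < z" "z < y + P" "L1 y z = - L2 t y" using forward[of t y] assms by (auto simp: strip_iff)
  then show ?thesis using that[of z] T_eqI by (simp add: strip_iff)
qed

lemma T_ex: "q \<in> strip \<Longrightarrow> q = (t, y) \<Longrightarrow> \<exists>z. T (t, y) = (y, z) \<and> (y, z) \<in> strip \<and> L1 y z = - L2 t y"
  by (metis T_props)

lemma fst_T [simp]: "fst (T q) = snd q"
  by (cases q) (simp add: T_def)

lemma T_strip: "q \<in> strip \<Longrightarrow> T q \<in> strip"
  by (cases q) (auto elim: T_props)

lemma T_inj: "inj_on T strip"
proof (rule inj_onI)
  fix q q' assume *: "q \<in> strip" "q' \<in> strip" "T q = T q'"
  obtain t y where q: "q = (t, y)" by (cases q)
  obtain t' y' where q': "q' = (t', y')" by (cases q')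
  have y: "y' = y" using * fst_T[of q] fst_T[of q'] q q' by simp
  obtain z where z: "T (t, y) = (y, z)" "L1 y z = - L2 t y" using T_ex[OF *(1) q] by blast
  obtain z' where z': "T (t', y) = (y, z')" "L1 y z' = - L2 t' y" using T_ex[OF *(2) q'] y by blast
  have "L2 t y = L2 t' y" using * z z' q q' y by simp
  then have "t = t'"
  proof (cases t t' rule: linorder_cases)
    case less
    then show ?thesis using mono2[of y t t'] \<open>L2 t y = L2 t' y\<close> * q q' y by (simp add: strip_iff)
  next
    case greater
    then show ?thesis using mono2[of y t' t] \<open>L2 t y = L2 t' y\<close> * q q' y by (simp add: strip_iff)
  qed
  then show "q = q'" using q q' y by simp
qed

lemma shift_strip [simp]: "shift m q \<in> strip \<longleftrightarrow> q \<in> strip"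
  by (cases q) (simp add: shift_def strip_iff algebra_simps)

lemma shift_shift [simp]: "shift m (shift n q) = shift (m + n) q"
  by (simp add: shift_def algebra_simps)

lemma shift_0 [simp]: "shift 0 q = q"
  by (simp add: shift_def)

lemma periodic_int:
  fixes h :: "real \<Rightarrow> real \<Rightarrow> 'a"
  assumes "\<And>t y. h (t + P) (y + P) = h t y"
  shows "h (t + of_int m * P) (y + of_int m * P) = h t y"
proof (induction m rule: int_induct[where k = 0])
  case (step1 i)
  then show ?case using assms[of "t + of_int i * P" "y + of_int i * P"] by (simp add: algebra_simps)
next
  case (step2 i)
  then show ?case using assms[of "t + of_int i * P - P" "y + of_int i * P - P"] by (simp add: algebra_simps)
qed simp

lemma T_shift:
  assumes "q \<in> strip"
  shows "T (shift m q) = shift m (T q)"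
proof -
  obtain t y where q: "q = (t, y)" by (cases q)
  obtain z where z: "T (t, y) = (y, z)" "(y, z) \<in> strip" "L1 y z = - L2 t y" using T_ex[OF assms q] by blast
  have "T (t + of_int m * P, y + of_int m * P) = (y + of_int m * P, z + of_int m * P)"
    using z by (intro T_eqI) (auto simp: strip_iff periodic_int[of L1, OF L1_shift] periodic_int[of L2, OF L2_shift])
  then show ?thesis using q z by (simp add: shift_def)
qed

lemma T_pow_strip: "q \<in> strip \<Longrightarrow> (T ^^ n) q \<in> strip"
  by (induction n) (auto intro: T_strip)

lemma T_pow_shift: "q \<in> strip \<Longrightarrow> (T ^^ n) (shift m q) = shift m ((T ^^ n) q)"
  by (induction n) (auto simp: T_shift T_pow_strip)

text \<open>
  The solution \<open>z\<close> of \<open>L1 y z = - L2 t y\<close> depends continuously on \<open>(t, y)\<close> because the left side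
  is strictly increasing in \<open>z\<close>: the sign of \<open>L1 y w + L2 t y\<close> at a fixed \<open>w\<close> on either side of
  the solution persists in a neighbourhood.\<close>

lemma T_cont: "continuous_on strip T"
proof -
  have c1: "isCont (\<lambda>q. L1 (fst q) (snd q)) q" and c2: "isCont (\<lambda>q. L2 (fst q) (snd q)) q"
    if "q \<in> strip" for q
    using cont1 cont2 that open_strip unfolding strip_def[symmetric]
    by (simp_all add: continuous_on_eq_continuous_at case_prod_unfold)
  have "(\<lambda>q. snd (T q)) \<midarrow>q0\<rightarrow> snd (T q0)" if q0: "q0 \<in> strip" for q0
  proof (rule order_tendstoI)
    obtain t0 y0 where q0_eq: "q0 = (t0, y0)" by (cases q0)
    obtain z0 where z0: "T q0 = (y0, z0)" "(y0, z0) \<in> strip" "L1 y0 z0 = - L2 t0 y0"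
      using T_ex[OF q0 q0_eq] q0_eq by blast
    have near: "\<forall>\<^sub>F q in at q0. q \<in> strip" by (rule eventually_at_in_open'[OF open_strip q0])
    have near': "\<forall>\<^sub>F q in at q0. (snd q, w) \<in> strip" if "(y0, w) \<in> strip" for w
    proof -
      have "((\<lambda>q. (snd q, w)) \<longlongrightarrow> (snd q0, w)) (at q0)" by (intro tendsto_intros)
      then show ?thesis using topological_tendstoD[OF _ open_strip] that q0_eq by fastforce
    qed
    have lim: "((\<lambda>q. L1 (snd q) w + L2 (fst q) (snd q)) \<longlongrightarrow> L1 y0 w + L2 t0 y0) (at q0)"
      if w: "(y0, w) \<in> strip" for w
    proof -
      have "((\<lambda>q. (snd q, w)) \<longlongrightarrow> (y0, w)) (at q0)" using q0_eq by (auto intro!: tendsto_eq_intros)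
      from isCont_tendsto_compose[OF c1[OF w] this]
      have "((\<lambda>q. L1 (snd q) w) \<longlongrightarrow> L1 y0 w) (at q0)" by simp
      moreover have "((\<lambda>q. L2 (fst q) (snd q)) \<longlongrightarrow> L2 t0 y0) (at q0)"
        using c2[OF q0] q0_eq by (simp add: isCont_def)
      ultimately show ?thesis by (intro tendsto_add)
    qed
    fix b
    {
      assume "b < snd (T q0)"
      define w where "w = (max b y0 + z0) / 2"
      have w: "y0 < w" "b < w" "w < z0" using \<open>b < snd (T q0)\<close> z0 by (auto simp: w_def strip_iff)
      have ws: "(y0, w) \<in> strip" using w z0 by (auto simp: strip_iff)
      have "L1 y0 w < L1 y0 z0" using w z0 by (intro mono1) (auto simp: strip_iff)
      then have "\<forall>\<^sub>F q in at q0. L1 (snd q) w + L2 (fst q) (snd q) < 0"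
        using order_tendstoD(2)[OF lim[OF ws]] z0 by simp
      then show "\<forall>\<^sub>F q in at q0. b < snd (T q)"
        using near near'[OF ws]
      proof eventually_elim
        case (elim q)
        obtain t y where q: "q = (t, y)" by (cases q)
        obtain z where z: "T q = (y, z)" "(y, z) \<in> strip" "L1 y z = - L2 t y"
          using T_ex[OF _ q] elim q by blast
        have "w < z"
        proof (rule ccontr)
          assume "\<not> w < z"
          then have "L1 y z \<le> L1 y w"
            using mono1[of y z w] z elim q by (cases "z = w") (auto simp: strip_iff)
          then show False using elim q z by simp
        qed
        then show ?case using w z by simp
      qed
    }
    {
      assume "snd (T q0) < b"
      define w where "w = (min b (y0 + P) + z0) / 2"
      have w: "w < y0 + P" "w < b" "z0 < w" using \<open>snd (T q0) < b\<close> z0 by (auto simp: w_def strip_iff)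
      have ws: "(y0, w) \<in> strip" using w z0 by (auto simp: strip_iff)
      have "L1 y0 z0 < L1 y0 w" using w z0 by (intro mono1) (auto simp: strip_iff)
      then have "\<forall>\<^sub>F q in at q0. 0 < L1 (snd q) w + L2 (fst q) (snd q)"
        using order_tendstoD(1)[OF lim[OF ws]] z0 by simp
      then show "\<forall>\<^sub>F q in at q0. snd (T q) < b"
        using near near'[OF ws]
      proof eventually_elim
        case (elim q)
        obtain t y where q: "q = (t, y)" by (cases q)
        obtain z where z: "T q = (y, z)" "(y, z) \<in> strip" "L1 y z = - L2 t y"
          using T_ex[OF _ q] elim q by blast
        have "z < w"
        proof (rule ccontr)
          assume "\<not> z < w"
          then have "L1 y w \<le> L1 y z"
            using mono1[of y w z] z elim q by (cases "z = w") (auto simp: strip_iff)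
          then show False using elim q z by simp
        qed
        then show ?case using w z by simp
      qed
    }
  qed
  then have "isCont (\<lambda>q. (snd q, snd (T q))) q" if "q \<in> strip" for q
    using that by (intro isCont_Pair) (auto simp: isCont_def intro!: tendsto_intros)
  moreover have "T = (\<lambda>q. (snd q, snd (T q)))" by (auto simp: prod_eq_iff)
  ultimately show ?thesis by (metis continuous_at_imp_continuous_on)
qed

lemma T_open: "open V \<Longrightarrow> V \<subseteq> strip \<Longrightarrow> open (T ` V)"
  by (rule invariance_of_domain) (auto intro: continuous_on_subset[OF T_cont] inj_on_subset[OF T_inj])

lemma T_pow_open: "open V \<Longrightarrow> V \<subseteq> strip \<Longrightarrow> open ((T ^^ n) ` V)"
proof (induction n)
  case (Suc n)
  have "(T ^^ Suc n) ` V = T ` ((T ^^ n) ` V)" by (simp add: image_comp)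
  moreover have "(T ^^ n) ` V \<subseteq> strip" using Suc.prems T_pow_strip by blast
  ultimately show ?case using T_open Suc by metis
qed simp

lemma T_pow_inj: "q \<in> strip \<Longrightarrow> q' \<in> strip \<Longrightarrow> (T ^^ n) q = (T ^^ n) q' \<Longrightarrow> q = q'"
proof (induction n)
  case (Suc n)
  then show ?case using inj_onD[OF T_inj, of "(T ^^ n) q" "(T ^^ n) q'"] T_pow_strip by simp
qed simp

end

section \<open>The invariant area of a twist map\<close>

lemma region_between_area:
  fixes f g H :: "real \<Rightarrow> real"
  assumes "a \<le> b" and fg: "\<And>t. a \<le> t \<Longrightarrow> t \<le> b \<Longrightarrow> f t \<le> g t"
    and f: "continuous_on {a..b} f" and g: "continuous_on {a..b} g"
    and H: "\<And>t. a \<le> t \<Longrightarrow> t \<le> b \<Longrightarrow> (H has_real_derivative g t - f t) (at t)"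
  shows "emeasure lborel {(t, s). a \<le> t \<and> t \<le> b \<and> f t \<le> s \<and> s \<le> g t} = ennreal (H b - H a)"
proof -
  let ?R = "{(t, s). a \<le> t \<and> t \<le> b \<and> f t \<le> s \<and> s \<le> g t}"
  define d where "d t = (if t \<in> {a..b} then g t - f t else 0)" for t
  have dm: "d \<in> borel_measurable borel" unfolding d_def
    by (rule borel_measurable_continuous_on_if) (auto intro!: continuous_intros f g)
  have "closed ?R"
  proof -
    have c: "continuous_on ({a..b} \<times> UNIV) (\<lambda>q. f (fst q))" "continuous_on ({a..b} \<times> UNIV) (\<lambda>q. g (fst q))"
      by (intro continuous_on_compose2[OF f] continuous_on_compose2[OF g] continuous_intros; auto)+
    have c1: "closed {q \<in> {a..b} \<times> (UNIV :: real set). f (fst q) \<le> snd q}"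
      by (rule continuous_on_closed_Collect_le) (auto intro!: closed_Times continuous_intros c)
    have c2: "closed {q \<in> {a..b} \<times> (UNIV :: real set). snd q \<le> g (fst q)}"
      by (rule continuous_on_closed_Collect_le) (auto intro!: closed_Times continuous_intros c)
    have eq: "?R = {q \<in> {a..b} \<times> (UNIV :: real set). f (fst q) \<le> snd q} \<inter>
        {q \<in> {a..b} \<times> (UNIV :: real set). snd q \<le> g (fst q)}" by auto
    show ?thesis unfolding eq by (rule closed_Int[OF c1 c2])
  qed
  then have R: "?R \<in> sets borel" by auto
  have "emeasure lborel ?R = emeasure (lborel \<Otimes>\<^sub>M lborel) ?R" by (simp add: lborel_prod)
  also have "\<dots> = (\<integral>\<^sup>+t. emeasure lborel (Pair t -` ?R) \<partial>lborel)"
  proof (rule lborel.emeasure_pair_measure_alt)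
    show "?R \<in> sets (lborel \<Otimes>\<^sub>M lborel)" by (subst lborel_prod) (simp add: R)
  qed
  also have "\<dots> = (\<integral>\<^sup>+t. ennreal (d t) * indicator {a..b} t \<partial>lborel)"
  proof (rule nn_integral_cong)
    fix t :: real
    show "emeasure lborel (Pair t -` ?R) = ennreal (d t) * indicator {a..b} t"
    proof (cases "t \<in> {a..b}")
      case True
      then have eq: "Pair t -` ?R = {f t..g t}" by auto
      show ?thesis unfolding eq using True fg by (simp add: d_def)
    next
      case False
      then have eq: "Pair t -` ?R = {}" by auto
      show ?thesis unfolding eq using False by (simp add: indicator_def)
    qed
  qed
  also have "\<dots> = ennreal (H b - H a)"
    by (rule nn_integral_FTC_Icc[OF dm]) (use assms in \<open>auto simp: d_def\<close>)
  finally show "emeasure lborel ?R = ennreal (H b - H a)" .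
qed

lemma emeasure_lborel_plus:
  fixes c :: "'a::euclidean_space"
  shows "emeasure lborel ((+) c ` Y) = emeasure lborel Y"
proof -
  have img: "(+) c ` Y \<in> sets borel" if "Y \<in> sets borel" for Y and c :: 'a
  proof -
    have "(\<lambda>x. x - c) -` Y \<inter> space borel \<in> sets borel"
      by (rule measurable_sets[OF _ that]) simp
    moreover have "(\<lambda>x. x - c) -` Y \<inter> space borel = (+) c ` Y"
      by (auto simp: image_iff algebra_simps intro!: bexI[of _ "_ - c"])
    ultimately show ?thesis by simp
  qed
  show ?thesis
  proof (cases "Y \<in> sets borel")
    case True
    have "emeasure lborel ((+) c ` Y) = emeasure (distr lborel borel ((+) c)) ((+) c ` Y)"
      by (simp add: lborel_distr_plus)
    also have "\<dots> = emeasure lborel ((+) c -` ((+) c ` Y))"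
      using img[OF True, of c] by (subst emeasure_distr) auto
    also have "(+) c -` ((+) c ` Y) = Y" by auto
    finally show ?thesis .
  next
    case False
    have "Y = (+) (- c) ` ((+) c ` Y)" by (simp add: image_image)
    then have "(+) c ` Y \<notin> sets borel" using img[of "(+) c ` Y" "- c"] False by auto
    then show ?thesis using False by (simp add: emeasure_notin_sets)
  qed
qed

context twist_map
begin

text \<open>
  With the momentum \<open>s\<close> as second coordinate, \<open>out_coords\<close> describes a chord by its starting point
  and \<open>in_coords\<close> by its end point. The first coordinates of \<open>T q\<close> are the second ones of \<open>q\<close>; the
  invariance of the area \<open>dt ds\<close> under \<open>T\<close> thus says that both coordinate systems induce the same
  area.\<close>

definition out_coords :: "real \<times> real \<Rightarrow> real \<times> real" where
  "out_coords q = (fst q, - L1 (fst q) (snd q))"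

definition in_coords :: "real \<times> real \<Rightarrow> real \<times> real" where
  "in_coords q = (snd q, L2 (fst q) (snd q))"

lemma out_coords_T: "q \<in> strip \<Longrightarrow> out_coords (T q) = in_coords q"
  using T_ex[of q "fst q" "snd q"] by (auto simp: out_coords_def in_coords_def)

lemma cont0': "continuous_on strip (\<lambda>q. L (fst q) (snd q))"
  and cont1': "continuous_on strip (\<lambda>q. L1 (fst q) (snd q))"
  and cont2': "continuous_on strip (\<lambda>q. L2 (fst q) (snd q))"
  using cont0 cont1 cont2 by (simp_all add: strip_def case_prod_unfold)

lemma out_cont: "continuous_on strip out_coords"
  unfolding out_coords_def by (intro continuous_intros cont1')

lemma in_cont: "continuous_on strip in_coords"
  unfolding in_coords_def by (intro continuous_intros cont2')

lemma out_inj: "inj_on out_coords strip"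
proof (rule inj_onI)
  fix q q' assume *: "q \<in> strip" "q' \<in> strip" "out_coords q = out_coords q'"
  obtain t y where q: "q = (t, y)" by (cases q)
  obtain t' y' where q': "q' = (t', y')" by (cases q')
  have t: "t' = t" "L1 t y = L1 t y'" using * q q' by (auto simp: out_coords_def)
  have "y = y'"
  proof (cases y y' rule: linorder_cases)
    case less
    then show ?thesis using mono1[of t y y'] t * q q' by (simp add: strip_iff)
  next
    case greater
    then show ?thesis using mono1[of t y' y] t * q q' by (simp add: strip_iff)
  qed
  then show "q = q'" using q q' t by simp
qed

lemma in_inj: "inj_on in_coords strip"
proof (rule inj_onI)
  fix q q' assume *: "q \<in> strip" "q' \<in> strip" "in_coords q = in_coords q'"
  then have "T q = T q'" using out_coords_T inj_onD[OF out_inj, of "T q" "T q'"] T_strip by simp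
  then show "q = q'" using * inj_onD[OF T_inj] by blast
qed

text \<open>
  The image of a box lies between the graphs of \<open>- L1\<close> at its two horizontal sides, and \<open>L1\<close>
  integrates to \<open>L\<close>: the area is the mixed second difference of \<open>L\<close>.\<close>

lemma out_box:
  assumes "a \<le> b" "c \<le> d" and box: "cbox (a, c) (b, d) \<subseteq> strip"
  shows "emeasure lborel (out_coords ` cbox (a, c) (b, d)) = ennreal (L b d - L b c - (L a d - L a c))"
proof -
  have s: "t < y \<and> y < t + P" if "a \<le> t" "t \<le> b" "c \<le> y" "y \<le> d" for t y
  proof -
    have "(t, y) \<in> cbox (a, c) (b, d)" using that by (simp add: cbox_Pair_eq)
    then have "(t, y) \<in> strip" using box by blast
    then show ?thesis by (simp add: strip_def)
  qed
  have col: "continuous_on {c..d} (\<lambda>y. L1 t y)" if "a \<le> t" "t \<le> b" for t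
    by (rule continuous_on_compose2[OF cont1', of _ "\<lambda>y. (t, y)", simplified])
      (use s that in \<open>auto intro!: continuous_intros simp: strip_def\<close>)
  have row: "continuous_on {a..b} (\<lambda>t. L1 t y)" if "c \<le> y" "y \<le> d" for y
    by (rule continuous_on_compose2[OF cont1', of _ "\<lambda>t. (t, y)", simplified])
      (use s that in \<open>auto intro!: continuous_intros simp: strip_def\<close>)
  have mono: "L1 t y \<le> L1 t y'" if "a \<le> t" "t \<le> b" "c \<le> y" "y \<le> y'" "y' \<le> d" for t y y'
    using mono1[of t y y'] s[of t y] s[of t y'] that by (cases "y = y'") auto
  have eq: "out_coords ` cbox (a, c) (b, d) = {(t, s). a \<le> t \<and> t \<le> b \<and> - L1 t d \<le> s \<and> s \<le> - L1 t c}"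
    (is "_ = ?R")
  proof (intro subset_antisym subsetI)
    fix q assume "q \<in> ?R"
    then obtain t s where q: "q = (t, s)" "a \<le> t" "t \<le> b" "L1 t c \<le> - s" "- s \<le> L1 t d" by auto
    obtain y where "c \<le> y" "y \<le> d" "L1 t y = - s"
      using IVT'[of "L1 t" c "- s" d] q col assms by auto
    then show "q \<in> out_coords ` cbox (a, c) (b, d)"
      using q by (intro image_eqI[of _ _ "(t, y)"]) (auto simp: out_coords_def cbox_Pair_eq)
  qed (use mono in \<open>auto simp: out_coords_def cbox_Pair_eq\<close>)
  show ?thesis
    unfolding eq
    by (rule region_between_area[where H = "\<lambda>t. L t d - L t c"])
      (use assms mono s in \<open>auto intro!: continuous_intros row derivative_eq_intros deriv1\<close>)
qed

text \<open>
  The same mixed second difference, now obtained by integrating \<open>L2\<close> over the vertical sides.\<close>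

lemma in_box:
  assumes "a \<le> b" "c \<le> d" and box: "cbox (a, c) (b, d) \<subseteq> strip"
  shows "emeasure lborel (in_coords ` cbox (a, c) (b, d)) = ennreal (L b d - L b c - (L a d - L a c))"
proof -
  have s: "t < y \<and> y < t + P" if "a \<le> t" "t \<le> b" "c \<le> y" "y \<le> d" for t y
  proof -
    have "(t, y) \<in> cbox (a, c) (b, d)" using that by (simp add: cbox_Pair_eq)
    then have "(t, y) \<in> strip" using box by blast
    then show ?thesis by (simp add: strip_def)
  qed
  have col: "continuous_on {c..d} (\<lambda>y. L2 t y)" if "a \<le> t" "t \<le> b" for t
    by (rule continuous_on_compose2[OF cont2', of _ "\<lambda>y. (t, y)", simplified])
      (use s that in \<open>auto intro!: continuous_intros simp: strip_def\<close>)
  have row: "continuous_on {a..b} (\<lambda>t. L2 t y)" if "c \<le> y" "y \<le> d" for y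
    by (rule continuous_on_compose2[OF cont2', of _ "\<lambda>t. (t, y)", simplified])
      (use s that in \<open>auto intro!: continuous_intros simp: strip_def\<close>)
  have mono: "L2 t y \<le> L2 t' y" if "a \<le> t" "t \<le> t'" "t' \<le> b" "c \<le> y" "y \<le> d" for t t' y
    using mono2[of y t t'] s[of t y] s[of t' y] that by (cases "t = t'") auto
  have eq: "in_coords ` cbox (a, c) (b, d) = {(y, s). c \<le> y \<and> y \<le> d \<and> L2 a y \<le> s \<and> s \<le> L2 b y}"
    (is "_ = ?R")
  proof (intro subset_antisym subsetI)
    fix q assume "q \<in> ?R"
    then obtain y s where q: "q = (y, s)" "c \<le> y" "y \<le> d" "L2 a y \<le> s" "s \<le> L2 b y" by auto
    obtain t where "a \<le> t" "t \<le> b" "L2 t y = s"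
      using IVT'[of "\<lambda>t. L2 t y" a s b] q row assms by auto
    then show "q \<in> in_coords ` cbox (a, c) (b, d)"
      using q by (intro image_eqI[of _ _ "(t, y)"]) (auto simp: in_coords_def cbox_Pair_eq)
  qed (use mono in \<open>auto simp: in_coords_def cbox_Pair_eq\<close>)
  have "emeasure lborel (in_coords ` cbox (a, c) (b, d)) = ennreal ((L b d - L a d) - (L b c - L a c))"
    unfolding eq
    by (rule region_between_area[where H = "\<lambda>y. L b y - L a y"])
      (use assms mono s in \<open>auto intro!: continuous_intros col derivative_eq_intros deriv2\<close>)
  then show ?thesis by (simp add: algebra_simps)
qed

text \<open>
  The measure on the strip that \<open>e\<close> carries to the Lebesgue measure of the plane. It is written as
  the image measure under the inverse of \<open>e\<close>; the values of \<open>inv_into\<close> outside the image are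
  excluded by the restriction of the space.\<close>

definition pullback :: "(real \<times> real \<Rightarrow> real \<times> real) \<Rightarrow> (real \<times> real) measure" where
  "pullback e = distr (restrict_space lborel (e ` strip)) (restrict_space borel strip) (inv_into strip e)"

lemma pullback:
  assumes cont: "continuous_on strip e" and inj: "inj_on e strip"
    and X: "X \<in> sets (restrict_space borel strip)"
  shows "emeasure (pullback e) X = emeasure lborel (e ` X)"
proof -
  have op: "open (e ` strip)" by (rule invariance_of_domain[OF cont open_strip inj])
  have ci: "continuous_on (e ` strip) (inv_into strip e)"
  proof (rule continuous_on_inverse_open)
    show "continuous_on strip e" by (rule cont)
  qed (use open_strip inj in auto)
  have meas: "inv_into strip e \<in> restrict_space lborel (e ` strip) \<rightarrow>\<^sub>M restrict_space borel strip"
  proof (rule measurable_restrict_space2)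
    show "inv_into strip e \<in> space (restrict_space lborel (e ` strip)) \<rightarrow> strip"
      by (auto simp: space_restrict_space inj)
    show "inv_into strip e \<in> restrict_space lborel (e ` strip) \<rightarrow>\<^sub>M borel"
      using borel_measurable_continuous_on_restrict[OF ci]
      by (subst measurable_cong_sets[OF sets_restrict_space_cong[OF sets_lborel] refl])
  qed
  have Xs: "X \<subseteq> strip" using sets.sets_into_space[OF X] by (simp add: space_restrict_space)
  have "inv_into strip e -` X \<inter> space (restrict_space lborel (e ` strip)) = e ` X"
    using Xs inj by (auto simp: space_restrict_space image_iff)
  then have "emeasure (pullback e) X = emeasure (restrict_space lborel (e ` strip)) (e ` X)"
    unfolding pullback_def using emeasure_distr[OF meas X] by simp
  also have "\<dots> = emeasure lborel (e ` X)"
    using op Xs by (intro emeasure_restrict_space) auto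
  finally show ?thesis .
qed

lemma sets_pullback: "sets (pullback e) = sets (restrict_space borel strip)"
  by (simp add: pullback_def)

lemma borel_strip: "sets (restrict_space borel strip) = sigma_sets strip {cbox u v |u v. cbox u v \<subseteq> strip}"
  (is "_ = sigma_sets strip ?E")
proof
  have "?E \<subseteq> sets (restrict_space borel strip)"
  proof
    fix X assume "X \<in> ?E"
    then have "X = strip \<inter> X" "X \<in> sets borel" by auto
    then show "X \<in> sets (restrict_space borel strip)" unfolding sets_restrict_space by blast
  qed
  then show "sigma_sets strip ?E \<subseteq> sets (restrict_space borel strip)"
    using sets.sigma_sets_subset[of ?E "restrict_space borel strip"] by (simp add: space_restrict_space)
  interpret S: sigma_algebra strip "sigma_sets strip ?E" by (rule sigma_algebra_sigma_sets) auto
  have "strip \<inter> S \<in> sigma_sets strip ?E" if "open S" for S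
  proof -
    have "open (strip \<inter> S)" using open_strip that by blast
    then obtain \<D> where D: "countable \<D>" "\<D> \<subseteq> Pow (strip \<inter> S)" "\<And>X. X \<in> \<D> \<Longrightarrow> \<exists>a b. X = cbox a b" "\<Union>\<D> = strip \<inter> S"
      using open_countable_Union_open_cbox[of "strip \<inter> S"] by metis
    have "X \<in> sigma_sets strip ?E" if "X \<in> \<D>" for X
    proof (rule sigma_sets.Basic)
      show "X \<in> ?E" using D(2,3) that by blast
    qed
    then have "\<Union>\<D> \<in> sigma_sets strip ?E" using D(1) by (intro S.countable_Union) auto
    then show ?thesis by (simp only: D(4))
  qed
  then have "(\<inter>) strip ` {S. open S} \<subseteq> sigma_sets strip ?E" by auto
  then have "sigma_sets strip ((\<inter>) strip ` {S. open S}) \<subseteq> sigma_sets strip ?E"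
    by (rule S.sigma_sets_subset)
  moreover have "sets (restrict_space borel strip) = sigma_sets strip ((\<inter>) strip ` {S. open S})"
  proof -
    have "strip \<in> sigma_sets UNIV {S. open S}" using open_strip by auto
    then show ?thesis
      unfolding sets_restrict_space sets_borel by (rule sigma_sets_Int) simp
  qed
  ultimately show "sets (restrict_space borel strip) \<subseteq> sigma_sets strip ?E" by simp
qed

text \<open>
  The boxes in the strip form a generator that is stable under intersection, and the two measures
  of a box are the same mixed second difference of \<open>L\<close>.\<close>

lemma pullback_eq: "pullback out_coords = pullback in_coords"
proof -
  let ?E = "{cbox u v |u v. cbox u v \<subseteq> strip}"
  have box: "emeasure (pullback out_coords) X = emeasure (pullback in_coords) X \<and>
      emeasure (pullback out_coords) X \<noteq> \<infinity>" if X: "X \<in> ?E" for X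
  proof -
    obtain a c b d where eq: "X = cbox (a, c) (b, d)" and sub: "cbox (a, c) (b, d) \<subseteq> strip"
      using X by auto
    have "X \<in> sets (restrict_space borel strip)" unfolding borel_strip using X by (rule sigma_sets.Basic)
    note pb = pullback[OF out_cont out_inj this] pullback[OF in_cont in_inj this]
    show ?thesis
    proof (cases "a \<le> b \<and> c \<le> d")
      case True
      then show ?thesis unfolding pb unfolding eq using out_box in_box sub by simp
    next
      case False
      then have "X = {}" unfolding eq by (auto simp: cbox_Pair_eq)
      then show ?thesis by simp
    qed
  qed
  obtain \<D> where D: "countable \<D>" "\<D> \<subseteq> Pow strip" "\<And>X. X \<in> \<D> \<Longrightarrow> \<exists>a b. X = cbox a b" "\<Union>\<D> = strip"
    using open_countable_Union_open_cbox[OF open_strip] by metis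
  have DE: "\<D> \<subseteq> ?E" using D(2,3) by blast
  have "(0, P / 2) \<in> strip" using P_pos by (simp add: strip_iff)
  then have "\<D> \<noteq> {}" using D(4) by auto
  then have rng: "range (from_nat_into \<D>) = \<D>" using D(1) by (intro range_from_nat_into)
  show ?thesis
  proof (rule measure_eqI_generator_eq[where E = ?E and \<Omega> = strip and A = "from_nat_into \<D>"])
    show "Int_stable ?E"
    proof (rule Int_stableI)
      fix X Y assume XY: "X \<in> ?E" "Y \<in> ?E"
      then have "X \<inter> Y \<subseteq> strip" by auto
      moreover have "\<exists>u v. X \<inter> Y = cbox u v"
      proof -
        obtain u v u' v' where "X = cbox u v" "Y = cbox u' v'" using XY by blast
        then show ?thesis by (simp only: Int_interval) (rule exI, rule exI, rule refl)
      qed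
      ultimately show "X \<inter> Y \<in> ?E" by blast
    qed
    show "?E \<subseteq> Pow strip" by auto
    show "sets (pullback out_coords) = sigma_sets strip ?E" "sets (pullback in_coords) = sigma_sets strip ?E"
      unfolding sets_pullback borel_strip by auto
    show "range (from_nat_into \<D>) \<subseteq> ?E" using rng DE by simp
    show "(\<Union>i. from_nat_into \<D> i) = strip" using rng D(4) by simp
    show "emeasure (pullback out_coords) (from_nat_into \<D> i) \<noteq> \<infinity>" for i
      using box[of "from_nat_into \<D> i"] rng DE by blast
  qed (use box in blast)
qed

abbreviation area :: "(real \<times> real) measure" where
  "area \<equiv> pullback out_coords"

lemma open_strip_sets: "open X \<Longrightarrow> X \<subseteq> strip \<Longrightarrow> X \<in> sets area"
  unfolding sets_pullback sets_restrict_space by (auto intro!: image_eqI[of _ _ X])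

lemma area_T:
  assumes "open X" "X \<subseteq> strip"
  shows "emeasure area (T ` X) = emeasure area X"
proof -
  have "T ` X \<subseteq> strip" using assms(2) T_strip by blast
  then have "T ` X \<in> sets area" using T_open[OF assms] by (intro open_strip_sets)
  then have "emeasure area (T ` X) = emeasure lborel (out_coords ` (T ` X))"
    by (intro pullback[OF out_cont out_inj]) (simp add: sets_pullback)
  also have "out_coords ` (T ` X) = in_coords ` X"
    using assms(2) out_coords_T by (force simp: image_image)
  also have "emeasure lborel (in_coords ` X) = emeasure (pullback in_coords) X"
    using open_strip_sets[OF assms] by (intro pullback[OF in_cont in_inj, symmetric]) (simp add: sets_pullback)
  finally show ?thesis by (simp add: pullback_eq)
qed

lemma area_T_pow:
  assumes "open X" "X \<subseteq> strip"
  shows "emeasure area ((T ^^ n) ` X) = emeasure area X"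
proof (induction n)
  case (Suc n)
  have "(T ^^ n) ` X \<subseteq> strip" using assms(2) T_pow_strip by blast
  then have "emeasure area (T ` ((T ^^ n) ` X)) = emeasure area X"
    using area_T[OF T_pow_open[OF assms, of n]] Suc by simp
  then show ?case by (simp add: image_comp)
qed simp

lemma shift_inverse: "shift m ` X = shift (- m) -` X"
proof (intro subset_antisym subsetI)
  fix q assume "q \<in> shift (- m) -` X"
  then show "q \<in> shift m ` X" by (intro image_eqI[of _ _ "shift (- m) q"]) auto
qed auto

lemma shift_cont: "continuous_on S (shift m)"
  unfolding shift_def by (intro continuous_intros)

lemma shift_sets:
  assumes "X \<in> sets area"
  shows "shift m ` X \<in> sets area"
proof -
  obtain Y where Y: "X = strip \<inter> Y" "Y \<in> sets borel"
    using assms by (auto simp: sets_pullback sets_restrict_space)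
  have "shift (- m) \<in> borel_measurable borel" using shift_cont by (rule borel_measurable_continuous_onI)
  then have "shift (- m) -` Y \<in> sets borel" using Y(2) by (auto dest: measurable_sets_borel)
  moreover have "shift m ` X = strip \<inter> shift (- m) -` Y" unfolding shift_inverse Y(1) using shift_strip by blast
  ultimately show ?thesis unfolding sets_pullback sets_restrict_space by blast
qed

lemma area_shift:
  assumes X: "X \<in> sets area"
  shows "emeasure area (shift m ` X) = emeasure area X"
proof -
  have Xs: "X \<subseteq> strip" using sets.sets_into_space[OF X] by (simp add: pullback_def space_restrict_space)
  have "emeasure area (shift m ` X) = emeasure lborel (out_coords ` (shift m ` X))"
    using shift_sets[OF X] by (intro pullback[OF out_cont out_inj]) (simp add: sets_pullback)
  also have "out_coords ` (shift m ` X) = (+) (of_int m * P, 0) ` (out_coords ` X)"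
    by (auto simp: image_image out_coords_def shift_def periodic_int[of L1, OF L1_shift] add.commute)
  also have "emeasure lborel \<dots> = emeasure lborel (out_coords ` X)"
    by (rule emeasure_lborel_plus)
  also have "\<dots> = emeasure area X"
    using X by (intro pullback[OF out_cont out_inj, symmetric]) (simp add: sets_pullback)
  finally show ?thesis .
qed

end

section \<open>Poincare recurrence\<close>

context twist_map
begin

text \<open>
  A fundamental domain of the strip for the translations \<open>shift\<close>.\<close>

definition slab :: "(real \<times> real) set" where
  "slab = strip \<inter> {0..<P} \<times> UNIV"

lemma slab_sets: "slab \<in> sets area"
  unfolding slab_def sets_pullback sets_restrict_space
  by (intro image_eqI[of _ _ "{0..<P} \<times> UNIV"] borel_Times) auto

lemma area_slab: "emeasure area slab < \<infinity>"
proof -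
  have "emeasure area slab = emeasure lborel (out_coords ` slab)"
    using slab_sets by (intro pullback[OF out_cont out_inj]) (simp add: sets_pullback)
  also have "\<dots> \<le> emeasure lborel (cbox (0, - \<kappa>) (P, \<kappa>))"
  proof (rule emeasure_mono)
    show "out_coords ` slab \<subseteq> cbox (0, - \<kappa>) (P, \<kappa>)"
    proof
      fix q assume "q \<in> out_coords ` slab"
      then obtain t y where ty: "(t, y) \<in> slab" "q = (t, - L1 t y)" by (auto simp: out_coords_def)
      then have "\<bar>L1 t y\<bar> \<le> \<kappa>" "0 \<le> t" "t \<le> P" using bound1[of t y] by (auto simp: slab_def strip_iff)
      then show "q \<in> cbox (0, - \<kappa>) (P, \<kappa>)" using ty by (auto simp: cbox_Pair_eq)
    qed
  qed simp
  also have "\<dots> < \<infinity>" by (rule emeasure_lborel_cbox_finite)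
  finally show ?thesis .
qed

lemma shift_slab_disjoint:
  assumes "q \<in> shift m ` slab" "q \<in> shift m' ` slab"
  shows "m = m'"
proof -
  have *: "of_int m * P \<le> fst q \<and> fst q < of_int (m + 1) * P" if "q \<in> shift m ` slab" for m
    using that by (auto simp: shift_def slab_def algebra_simps)
  have "of_int m * P < of_int (m' + 1) * P" "of_int m' * P < of_int (m + 1) * P"
    using *[OF assms(1)] *[OF assms(2)] by linarith+
  then have "m < m' + 1" "m' < m + 1" using P_pos by (simp_all only: mult_less_cancel_right_pos of_int_less_iff)
  then show ?thesis by simp
qed

lemma in_shift_slab:
  assumes "q \<in> strip"
  shows "q \<in> shift \<lfloor>fst q / P\<rfloor> ` slab"
proof (rule image_eqI[of _ _ "shift (- \<lfloor>fst q / P\<rfloor>) q"])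
  have "of_int \<lfloor>fst q / P\<rfloor> * P \<le> fst q" "fst q < (of_int \<lfloor>fst q / P\<rfloor> + 1) * P"
    using floor_divide_lower[OF P_pos] floor_divide_upper[OF P_pos] by auto
  moreover have "shift (- \<lfloor>fst q / P\<rfloor>) q \<in> strip" using assms by simp
  ultimately show "shift (- \<lfloor>fst q / P\<rfloor>) q \<in> slab"
    by (simp add: slab_def shift_def mem_Times_iff algebra_simps)
qed simp

text \<open>
  The translates of \<open>X\<close> cut out pieces of the slab that are translates of pieces of \<open>X\<close>; none of
  them overlap, since \<open>X\<close> meets none of its own translates.\<close>

lemma area_fold_slab:
  assumes X: "X \<in> sets area" and disj: "\<And>m q. q \<in> X \<Longrightarrow> shift m q \<in> X \<Longrightarrow> m = 0"
  shows "emeasure area (\<Union>m. shift m ` X \<inter> slab) = emeasure area X"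
proof -
  have Xs: "X \<subseteq> strip" using sets.sets_into_space[OF X] by (simp add: pullback_def space_restrict_space)
  have "emeasure area (\<Union>m. shift m ` X \<inter> slab)
      = (\<integral>\<^sup>+m. emeasure area (shift m ` X \<inter> slab) \<partial>count_space UNIV)"
  proof (rule emeasure_UN_countable)
    show "disjoint_family_on (\<lambda>m. shift m ` X \<inter> slab) UNIV"
      unfolding disjoint_family_on_def
    proof (intro ballI impI)
      fix m n :: int assume "m \<noteq> n"
      show "shift m ` X \<inter> slab \<inter> (shift n ` X \<inter> slab) = {}"
      proof (rule ccontr)
        assume "\<not> ?thesis"
        then obtain p where "p \<in> shift m ` X" "p \<in> shift n ` X" by blast
        then obtain q q' where q: "q \<in> X" "q' \<in> X" "shift m q = shift n q'" by (metis imageE)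
        have "shift (- n) (shift m q) = q'" unfolding q(3) by simp
        then have "shift (m - n) q = q'" by simp
        then have "shift (m - n) q \<in> X" using q by simp
        then show False using disj[OF q(1)] \<open>m \<noteq> n\<close> by force
      qed
    qed
  qed (use shift_sets[OF X] slab_sets in auto)
  also have "\<dots> = (\<integral>\<^sup>+m. emeasure area (X \<inter> shift m ` slab) \<partial>count_space UNIV)"
  proof -
    have "(\<integral>\<^sup>+m. emeasure area (X \<inter> shift m ` slab) \<partial>count_space UNIV)
        = (\<integral>\<^sup>+m. emeasure area (X \<inter> shift (- m) ` slab) \<partial>count_space UNIV)"
      by (rule nn_integral_bij_count_space[symmetric]) (rule bij_uminus)
    moreover have "emeasure area (X \<inter> shift (- m) ` slab) = emeasure area (shift m ` X \<inter> slab)" for m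
    proof -
      have "shift m ` X \<inter> slab = shift m ` (X \<inter> shift (- m) ` slab)"
        by (force simp: image_iff)
      moreover have "X \<inter> shift (- m) ` slab \<in> sets area" using X shift_sets[OF slab_sets] by auto
      ultimately show ?thesis using area_shift by simp
    qed
    ultimately show ?thesis by simp
  qed
  also have "\<dots> = emeasure area (\<Union>m. X \<inter> shift m ` slab)"
  proof (rule emeasure_UN_countable[symmetric])
    show "disjoint_family_on (\<lambda>m. X \<inter> shift m ` slab) UNIV"
      unfolding disjoint_family_on_def using shift_slab_disjoint by blast
  qed (use X shift_sets[OF slab_sets] in auto)
  also have "(\<Union>m. X \<inter> shift m ` slab) = X" using in_shift_slab Xs by blast
  finally show ?thesis .
qed

lemma out_coords_open: "open X \<Longrightarrow> X \<subseteq> strip \<Longrightarrow> open (out_coords ` X)"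
  by (rule invariance_of_domain) (auto intro: continuous_on_subset[OF out_cont] inj_on_subset[OF out_inj])

lemma area_pos:
  assumes "open X" "X \<subseteq> strip" "X \<noteq> {}"
  shows "emeasure area X > 0"
proof -
  have "emeasure area X = emeasure lborel (out_coords ` X)"
    using open_strip_sets[OF assms(1,2)] by (intro pullback[OF out_cont out_inj]) (simp add: sets_pullback)
  moreover have "emeasure lborel (out_coords ` X) \<noteq> 0"
  proof
    assume "emeasure lborel (out_coords ` X) = 0"
    then have "out_coords ` X \<in> null_sets lborel"
      using out_coords_open[OF assms(1,2)] by auto
    then have "negligible (out_coords ` X)" by (simp add: negligible_iff_null_sets null_sets_completionI)
    then show False using open_not_negligible out_coords_open[OF assms(1,2)] assms(3) by blast
  qed
  ultimately show ?thesis by (simp add: zero_less_iff_neq_zero)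
qed

text \<open>
  Poincare's argument on the annulus: the images of a small open set \<open>W\<close>, folded into the slab,
  all have the positive area of \<open>W\<close>, but the slab has finite area, so that two of them meet.\<close>

theorem nonwandering:
  assumes V: "open V" "V \<subseteq> strip" "V \<noteq> {}"
  shows "\<exists>n\<ge>1. \<exists>m. \<exists>q\<in>V. shift m ((T ^^ n) q) \<in> V"
proof (rule ccontr)
  assume neg: "\<not> ?thesis"
  obtain q0 where q0: "q0 \<in> V" using V by auto
  \<comment> \<open>\<open>W\<close> is small enough to be disjoint from its translates\<close>
  define W where "W = V \<inter> {q. \<bar>fst q - fst q0\<bar> < P / 2}"
  have "open {q :: real \<times> real. \<bar>fst q - fst q0\<bar> < P / 2}" by (intro open_Collect_less continuous_intros)
  then have W: "open W" "W \<subseteq> strip" "W \<noteq> {}" "W \<subseteq> V"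
    using V q0 P_pos unfolding W_def by auto
  have Wm: "m = 0" if "q \<in> W" "shift m q \<in> W" for q m
  proof (rule ccontr)
    assume "m \<noteq> 0"
    then have "\<bar>of_int m\<bar> * P \<ge> 1 * P" using P_pos by (intro mult_right_mono) auto
    moreover have "\<bar>fst q - fst q0\<bar> < P / 2" "\<bar>fst q + of_int m * P - fst q0\<bar> < P / 2"
      using that by (simp_all add: W_def shift_def)
    then have "\<bar>of_int m * P\<bar> < P" by linarith
    ultimately show False using P_pos by (simp add: abs_mult)
  qed
  define X where "X n = (T ^^ n) ` W" for n
  have X_open: "open (X n)" and X_strip: "X n \<subseteq> strip" for n
    using T_pow_open[OF W(1,2)] T_pow_strip W(2) by (auto simp: X_def)
  have X_sets: "X n \<in> sets area" for n using open_strip_sets[OF X_open X_strip] .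
  have Xm: "m = 0" if "q \<in> X n" "shift m q \<in> X n" for q m n
  proof -
    obtain w w' where w: "w \<in> W" "w' \<in> W" "q = (T ^^ n) w" "shift m q = (T ^^ n) w'"
      using \<open>q \<in> X n\<close> \<open>shift m q \<in> X n\<close> by (auto simp: X_def)
    then have "(T ^^ n) (shift m w) = (T ^^ n) w'" using T_pow_shift[OF subsetD[OF W(2) w(1)], of n m] by simp
    then have "shift m w = w'" using T_pow_inj[of "shift m w" w' n] w W(2) by auto
    then show ?thesis using Wm w by blast
  qed
  define Y where "Y n = (\<Union>m. shift m ` X n \<inter> slab)" for n
  have Y_sets: "Y n \<in> sets area" for n
    unfolding Y_def using shift_sets[OF X_sets] slab_sets by (intro sets.countable_UN'') auto
  have Y_area: "emeasure area (Y n) = emeasure area W" for n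
    unfolding Y_def using area_fold_slab[OF X_sets[of n] Xm[of _ n]] area_T_pow[OF W(1,2)] by (simp add: X_def)
  have Y_disj: "Y n \<inter> Y k = {}" if "n < k" for n k
  proof (rule ccontr)
    assume "Y n \<inter> Y k \<noteq> {}"
    then obtain p i j where "p \<in> shift i ` X n" "p \<in> shift j ` X k"
      unfolding Y_def by blast
    then obtain q q' where q: "q \<in> X n" "q' \<in> X k" "shift i q = shift j q'" by (metis imageE)
    then obtain w w' where w: "w \<in> W" "w' \<in> W" "q = (T ^^ n) w" "q' = (T ^^ k) w'" by (auto simp: X_def)
    have "q' = (T ^^ n) ((T ^^ (k - n)) w')"
      using that w by (simp add: funpow_add[of n "k - n", unfolded comp_def, THEN fun_cong, symmetric])
    then have "(T ^^ n) (shift i w) = (T ^^ n) (shift j ((T ^^ (k - n)) w'))"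
      using q w W(2) T_pow_shift T_pow_strip by (metis subsetD)
    then have "shift i w = shift j ((T ^^ (k - n)) w')"
      using T_pow_inj[of "shift i w" "shift j ((T ^^ (k - n)) w')" n] subsetD[OF W(2) w(1)]
        T_pow_strip[OF subsetD[OF W(2) w(2)]] by simp
    then have "shift (- i) (shift j ((T ^^ (k - n)) w')) = w" by (metis shift_shift shift_0 add.left_inverse)
    then have "shift (j - i) ((T ^^ (k - n)) w') \<in> V" using w W(4) by (auto simp: algebra_simps)
    then show False using neg w W(4) that by (metis Suc_leI One_nat_def zero_less_diff subsetD)
  qed
  have "disjoint_family Y"
    unfolding disjoint_family_on_def using Y_disj by (metis inf_commute linorder_neqE_nat)
  then have "(\<Sum>i. emeasure area (Y i)) = emeasure area (\<Union>i. Y i)"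
    using Y_sets by (intro suminf_emeasure) auto
  also have "\<dots> \<le> emeasure area slab" using slab_sets by (intro emeasure_mono) (auto simp: Y_def)
  also have "\<dots> < \<infinity>" by (rule area_slab)
  finally have "(\<Sum>i::nat. emeasure area W) < \<infinity>" by (simp add: Y_area)
  moreover have "(\<Sum>i::nat. emeasure area W) = \<infinity>"
  proof -
    have "(\<Sum>i::nat. emeasure area W) = (\<integral>\<^sup>+i. emeasure area W \<partial>count_space (UNIV :: nat set))"
      by (rule nn_integral_count_space_nat[symmetric])
    also have "\<dots> = emeasure area W * \<infinity>" by (simp add: emeasure_count_space_infinite)
    also have "\<dots> = \<infinity>" using area_pos[OF W(1-3)] by (simp add: ennreal_mult_top)
    finally show ?thesis .
  qed
  ultimately show False by simp
qed

end

section \<open>Recurrent invariant curves are graphs\<close>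

context twist_map
begin

text \<open>
  The lift to the strip of an invariant closed curve that winds once around the annulus.\<close>

definition invariant_line :: "(real \<Rightarrow> real \<times> real) \<Rightarrow> bool" where
  "invariant_line c \<longleftrightarrow> continuous_on UNIV c \<and> inj c \<and> (\<forall>\<sigma>. c (\<sigma> + 1) = shift 1 (c \<sigma>)) \<and>
     range c \<subseteq> strip \<and> T ` range c = range c"

lemma line_near_linear:
  assumes c: "invariant_line c"
  shows "\<exists>D. \<forall>\<sigma>. \<bar>fst (c \<sigma>) - P * \<sigma>\<bar> \<le> D"
proof -
  have cont: "continuous_on UNIV (\<lambda>\<sigma>. fst (c \<sigma>) - P * \<sigma>)" (is "continuous_on _ ?e")
    using c by (auto simp: invariant_line_def intro!: continuous_intros)
  have "bounded (?e ` {0..1})"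
    by (intro compact_imp_bounded compact_continuous_image continuous_on_subset[OF cont]) auto
  then obtain D where D: "\<forall>\<sigma>\<in>{0..1}. \<bar>?e \<sigma>\<bar> \<le> D" by (auto simp: bounded_real)
  have per: "?e (\<sigma> + 1) = ?e \<sigma>" for \<sigma>
  proof -
    have "c (\<sigma> + 1) = shift 1 (c \<sigma>)" using c by (simp add: invariant_line_def)
    then show ?thesis by (simp add: shift_def algebra_simps)
  qed
  have per': "?e (\<sigma> + of_int k) = ?e \<sigma>" for \<sigma> and k :: int
  proof (induction k rule: int_induct[where k = 0])
    case (step1 i)
    then show ?case using per[of "\<sigma> + of_int i"] by (simp add: add.assoc)
  next
    case (step2 i)
    then show ?case using per[of "\<sigma> + of_int i - 1"] by (simp add: algebra_simps)
  qed simp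
  have "\<bar>?e \<sigma>\<bar> \<le> D" for \<sigma>
  proof -
    have "?e \<sigma> = ?e (frac \<sigma>)" using per'[of "frac \<sigma>" "\<lfloor>\<sigma>\<rfloor>"] by (simp only: frac_def) simp
    moreover have "frac \<sigma> \<in> {0..1}" using frac_lt_1[of \<sigma>] by simp
    ultimately show ?thesis using D by metis
  qed
  then show ?thesis by blast
qed

text \<open>
  Far from \<open>\<sigma>0\<close> the line is far away because it is a bounded perturbation of a linear function;
  the remaining parameters away from \<open>\<sigma>0\<close> form a compact set, whose image misses \<open>c \<sigma>0\<close>.\<close>

lemma line_locally_closed:
  assumes c: "invariant_line c" and "\<epsilon> > 0"
  shows "\<exists>N. open N \<and> c \<sigma>0 \<in> N \<and> (\<forall>\<sigma>. c \<sigma> \<in> N \<longrightarrow> \<bar>\<sigma> - \<sigma>0\<bar> < \<epsilon>)"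
proof -
  obtain D where D: "\<And>\<sigma>. \<bar>fst (c \<sigma>) - P * \<sigma>\<bar> \<le> D" using line_near_linear[OF c] by blast
  define R where "R = (2 * D + 1) / P"
  define K where "K = {\<sigma>0 - R..\<sigma>0 + R} - {\<sigma>0 - \<epsilon><..<\<sigma>0 + \<epsilon>}"
  have "compact K" unfolding K_def by (intro compact_diff) auto
  then have "compact (c ` K)"
    using c by (intro compact_continuous_image) (auto simp: invariant_line_def intro: continuous_on_subset)
  then have cl: "closed (c ` K)" by (rule compact_imp_closed)
  define N where "N = - (c ` K) \<inter> {q. \<bar>fst q - fst (c \<sigma>0)\<bar> < 1}"
  have "open {q :: real \<times> real. \<bar>fst q - fst (c \<sigma>0)\<bar> < 1}" by (intro open_Collect_less continuous_intros)
  then have "open N" unfolding N_def using cl by auto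
  moreover have "c \<sigma>0 \<in> N" using c \<open>\<epsilon> > 0\<close> by (auto simp: N_def K_def invariant_line_def dest: injD)
  moreover have "\<bar>\<sigma> - \<sigma>0\<bar> < \<epsilon>" if "c \<sigma> \<in> N" for \<sigma>
  proof -
    have "\<bar>P * \<sigma> - P * \<sigma>0\<bar> \<le> 2 * D + 1" using that D[of \<sigma>] D[of \<sigma>0] unfolding N_def by simp linarith
    then have "P * \<bar>\<sigma> - \<sigma>0\<bar> \<le> 2 * D + 1" using P_pos by (simp add: abs_mult flip: right_diff_distrib)
    then have "\<bar>\<sigma> - \<sigma>0\<bar> \<le> R" using P_pos by (simp add: R_def field_simps)
    moreover have "\<sigma> \<notin> K" using that by (auto simp: N_def)
    ultimately show ?thesis unfolding K_def by auto
  qed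
  ultimately show ?thesis by blast
qed

lemma invariant_line_lift:
  assumes c: "invariant_line c"
  shows "\<exists>f f'. circle_lift f f' \<and> (\<forall>\<sigma>. T (c \<sigma>) = c (f \<sigma>))"
proof -
  have cont: "continuous_on UNIV c" and inj: "\<And>\<sigma> \<sigma>'. c \<sigma> = c \<sigma>' \<Longrightarrow> \<sigma> = \<sigma>'"
    and sh: "\<And>\<sigma>. c (\<sigma> + 1) = shift 1 (c \<sigma>)" and sub: "\<And>\<sigma>. c \<sigma> \<in> strip" and inv: "T ` range c = range c"
    using c by (auto simp: invariant_line_def dest: injD)
  have "\<forall>\<sigma>. \<exists>\<tau>. T (c \<sigma>) = c \<tau>" using inv by blast
  then obtain f where f: "\<And>\<sigma>. T (c \<sigma>) = c (f \<sigma>)" by metis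
  have "\<forall>\<sigma>. \<exists>\<tau>. T (c \<tau>) = c \<sigma>" using inv by (metis (no_types, lifting) image_iff rangeE rangeI)
  then obtain f' where f': "\<And>\<sigma>. T (c (f' \<sigma>)) = c \<sigma>" by metis
  have ff': "f (f' \<sigma>) = \<sigma>" for \<sigma> using f[of "f' \<sigma>"] f' inj by metis
  have f_inj: "\<sigma> = \<tau>" if "f \<sigma> = f \<tau>" for \<sigma> \<tau>
  proof -
    have "T (c \<sigma>) = T (c \<tau>)" using f that by simp
    then show ?thesis using inj_onD[OF T_inj] sub inj by blast
  qed
  have f'f: "f' (f \<sigma>) = \<sigma>" for \<sigma> using ff' f_inj by blast
  have shift1: "f (\<sigma> + 1) = f \<sigma> + 1" for \<sigma>
  proof (rule inj)
    show "c (f (\<sigma> + 1)) = c (f \<sigma> + 1)" using f[of "\<sigma> + 1"] f[of \<sigma>] sh T_shift[OF sub] by metis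
  qed
  have fc: "continuous_on UNIV f"
  proof (rule continuous_at_imp_continuous_on, rule ballI)
    fix \<sigma>0
    have "continuous_on UNIV (\<lambda>\<sigma>. T (c \<sigma>))"
      by (rule continuous_on_compose2[OF T_cont cont]) (use sub in auto)
    then have lim: "(\<lambda>\<sigma>. c (f \<sigma>)) \<midarrow>\<sigma>0\<rightarrow> c (f \<sigma>0)" unfolding f by (simp add: continuous_on_def)
    show "isCont f \<sigma>0" unfolding isCont_def
    proof (rule tendstoI)
      fix \<epsilon> :: real assume "\<epsilon> > 0"
      then obtain N where N: "open N" "c (f \<sigma>0) \<in> N" "\<And>\<sigma>. c \<sigma> \<in> N \<Longrightarrow> \<bar>\<sigma> - f \<sigma>0\<bar> < \<epsilon>"
        using line_locally_closed[OF c] by metis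
      show "\<forall>\<^sub>F \<sigma> in at \<sigma>0. dist (f \<sigma>) (f \<sigma>0) < \<epsilon>"
        using topological_tendstoD[OF lim N(1,2)] by (rule eventually_mono) (simp add: N(3) dist_real_def)
    qed
  qed
  have "inj_on f UNIV" using f_inj by (auto intro: injI)
  then have "strict_mono f \<or> strict_antimono_on UNIV f"
    using injective_eq_monotone_map[of UNIV f] fc by simp
  moreover have "\<not> strict_antimono_on UNIV f"
    using monotone_onD[of UNIV "(<)" "(>)" f 0 1] shift1[of 0] by auto
  ultimately have "circle_lift f f'" by unfold_locales (use fc shift1 ff' f'f in auto)
  then show ?thesis using f by blast
qed

text \<open>
  The points of \<open>V\<close> that come back to \<open>V\<close>, as seen on the annulus.\<close>

definition returning :: "(real \<times> real) set \<Rightarrow> (real \<times> real) set" where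
  "returning V = {q \<in> V. \<exists>n\<ge>1. \<exists>m. shift m ((T ^^ n) q) \<in> V}"

text \<open>
  On the line \<open>T\<close> acts as a lift of a circle homeomorphism \<open>f\<close>, and the hypothesis \<open>nw\<close> makes \<open>f\<close>
  nonwandering. Two points of the line over the same \<open>x\<close> satisfy the law \<open>L1 x z = - L2 t x\<close> with
  their successors \<open>z\<close> and predecessors \<open>t\<close>; as \<open>L1\<close> and \<open>L2\<close> are increasing in \<open>z\<close> and \<open>t\<close>, the
  point with the larger successor has the smaller predecessor.\<close>

lemma recurrent_line_is_graph:
  assumes c: "invariant_line c"
    and nw: "\<And>V. open V \<Longrightarrow> V \<subseteq> strip \<Longrightarrow> V \<inter> range c \<noteq> {} \<Longrightarrow> \<exists>B. open B \<and> B \<subseteq> V \<and> returning B \<inter> range c \<noteq> {}"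
  shows "strict_mono (\<lambda>\<sigma>. fst (c \<sigma>))"
proof -
  have cont: "continuous_on UNIV c" and inj: "\<And>\<sigma> \<sigma>'. c \<sigma> = c \<sigma>' \<Longrightarrow> \<sigma> = \<sigma>'"
    and sh: "\<And>\<sigma>. c (\<sigma> + 1) = shift 1 (c \<sigma>)" and sub: "\<And>\<sigma>. c \<sigma> \<in> strip"
    using c by (auto simp: invariant_line_def dest: injD)
  obtain f f' where cl: "circle_lift f f'" and f: "\<And>\<sigma>. T (c \<sigma>) = c (f \<sigma>)"
    using invariant_line_lift[OF c] by blast
  interpret circle_lift f f' by (rule cl)
  have Tn: "(T ^^ n) (c \<sigma>) = c ((f ^^ n) \<sigma>)" for n \<sigma> by (induction n) (simp_all add: f)
  have shm: "shift m (c \<sigma>) = c (\<sigma> + of_int m)" for m \<sigma>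
  proof (induction m rule: int_induct[where k = 0])
    case (step1 i)
    have "shift (i + 1) (c \<sigma>) = shift 1 (shift i (c \<sigma>))" by (simp add: add.commute)
    then show ?case using step1 sh[of "\<sigma> + of_int i"] by (simp add: algebra_simps)
  next
    case (step2 i)
    have "shift (i - 1) (c \<sigma>) = shift (- 1) (shift i (c \<sigma>))" by (simp add: algebra_simps)
    also have "\<dots> = shift (- 1) (shift 1 (c (\<sigma> + of_int i - 1)))"
      using step2 sh[of "\<sigma> + of_int i - 1"] by simp
    finally show ?case by (simp add: algebra_simps)
  qed simp
  have snd_c: "snd (c \<sigma>) = fst (c (f \<sigma>))" for \<sigma> using f[of \<sigma>] fst_T[of "c \<sigma>"] by simp
  have law: "L1 x (fst (c (f \<sigma>))) = - L2 (fst (c (f' \<sigma>))) x \<and> fst (c (f' \<sigma>)) < x \<and> x < fst (c (f' \<sigma>)) + P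
      \<and> x < fst (c (f \<sigma>)) \<and> fst (c (f \<sigma>)) < x + P"
    if "fst (c \<sigma>) = x" for \<sigma> x
  proof -
    have 1: "c (f' \<sigma>) = (fst (c (f' \<sigma>)), x)" using snd_c[of "f' \<sigma>"] that by (simp add: prod_eq_iff)
    have 2: "c \<sigma> = (x, fst (c (f \<sigma>)))" using snd_c[of \<sigma>] that by (simp add: prod_eq_iff)
    obtain z where "T (c (f' \<sigma>)) = (x, z)" "L1 x z = - L2 (fst (c (f' \<sigma>))) x"
      using T_ex[OF sub 1] 1 by auto
    then have "L1 x (fst (c (f \<sigma>))) = - L2 (fst (c (f' \<sigma>))) x" using f[of "f' \<sigma>"] 2 by simp
    then show ?thesis using sub[of \<sigma>] sub[of "f' \<sigma>"] 1 2 strip_iff by metis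
  qed
  show ?thesis
  proof (rule recurrent_imp_graph[where P = P])
    show "continuous_on UNIV (\<lambda>\<sigma>. fst (c \<sigma>))" using cont by (intro continuous_intros)
    show "fst (c (\<sigma> + 1)) = fst (c \<sigma>) + P" for \<sigma> by (simp add: sh shift_def)
    show "P > 0" by (rule P_pos)
    show "(fst (c (f \<sigma>)) < fst (c (f \<sigma>'))) = (fst (c (f' \<sigma>')) < fst (c (f' \<sigma>)))"
      if eq: "fst (c \<sigma>) = fst (c \<sigma>')" for \<sigma> \<sigma>'
    proof -
      define x where "x = fst (c \<sigma>')"
      note l = law[OF eq] law[OF refl, of \<sigma>'] 
      show ?thesis
      proof
        assume "fst (c (f \<sigma>)) < fst (c (f \<sigma>'))"
        then have "L1 x (fst (c (f \<sigma>))) < L1 x (fst (c (f \<sigma>')))" using l unfolding x_def by (intro mono1) auto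
        then have lt: "L2 (fst (c (f' \<sigma>'))) x < L2 (fst (c (f' \<sigma>))) x" using l by (simp add: x_def)
        show "fst (c (f' \<sigma>')) < fst (c (f' \<sigma>))"
        proof (rule ccontr)
          assume "\<not> ?thesis"
          then have "L2 (fst (c (f' \<sigma>))) x \<le> L2 (fst (c (f' \<sigma>'))) x"
            using mono2[of x "fst (c (f' \<sigma>))" "fst (c (f' \<sigma>'))"] l
            by (cases "fst (c (f' \<sigma>)) = fst (c (f' \<sigma>'))") (auto simp: x_def)
          with lt show False by simp
        qed
      next
        assume "fst (c (f' \<sigma>')) < fst (c (f' \<sigma>))"
        then have "L2 (fst (c (f' \<sigma>'))) x < L2 (fst (c (f' \<sigma>))) x" using l unfolding x_def by (intro mono2) auto
        then have lt: "L1 x (fst (c (f \<sigma>))) < L1 x (fst (c (f \<sigma>')))" using l by (simp add: x_def)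
        show "fst (c (f \<sigma>)) < fst (c (f \<sigma>'))"
        proof (rule ccontr)
          assume "\<not> ?thesis"
          then have "L1 x (fst (c (f \<sigma>'))) \<le> L1 x (fst (c (f \<sigma>)))"
            using mono1[of x "fst (c (f \<sigma>'))" "fst (c (f \<sigma>))"] l
            by (cases "fst (c (f \<sigma>)) = fst (c (f \<sigma>'))") (auto simp: x_def)
          with lt show False by simp
        qed
      qed
    qed
    show "fst (c (f \<sigma>)) \<noteq> fst (c (f \<sigma>'))" if "fst (c \<sigma>) = fst (c \<sigma>')" "\<sigma> \<noteq> \<sigma>'" for \<sigma> \<sigma>'
    proof
      assume "fst (c (f \<sigma>)) = fst (c (f \<sigma>'))"
      then have "c \<sigma> = c \<sigma>'" using that snd_c by (simp add: prod_eq_iff)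
      then show False using inj that by blast
    qed
    show "\<exists>n\<ge>1. \<exists>m. \<forall>x. \<bar>(f ^^ n) x - of_int m - x\<bar> < \<epsilon>" if "\<epsilon> > 0" for \<epsilon>
    proof (rule nonwandering_imp_uniformly_recurrent[OF _ that])
      fix u v :: real assume "u < v"
      define \<sigma>0 where "\<sigma>0 = (u + v) / 2"
      obtain N where N: "open N" "c \<sigma>0 \<in> N" "\<And>\<sigma>. c \<sigma> \<in> N \<Longrightarrow> \<bar>\<sigma> - \<sigma>0\<bar> < (v - u) / 2"
        using line_locally_closed[OF c, of "(v - u) / 2" \<sigma>0] \<open>u < v\<close> by auto
      have uv: "u < \<sigma> \<and> \<sigma> < v" if "c \<sigma> \<in> N" for \<sigma> 
      proof -
        have "\<bar>\<sigma> - (u + v) / 2\<bar> < (v - u) / 2" using N(3)[OF that] by (simp add: \<sigma>0_def)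
        then have "\<sigma> - (u + v) / 2 < (v - u) / 2" "(u + v) / 2 - \<sigma> < (v - u) / 2" by linarith+
        then show ?thesis by (simp add: field_simps)
      qed
      obtain B where B: "B \<subseteq> N \<inter> strip" "returning B \<inter> range c \<noteq> {}"
        using nw[of "N \<inter> strip"] N open_strip sub by blast
      then obtain \<sigma> n m where \<sigma>: "c \<sigma> \<in> B" "n \<ge> 1" "shift m ((T ^^ n) (c \<sigma>)) \<in> B" by (auto simp: returning_def)
      have "c ((f ^^ n) \<sigma> - of_int (- m)) \<in> B" using \<sigma>(3) by (simp add: Tn shm)
      then show "\<exists>n\<ge>1. \<exists>m. \<exists>x>u. x < v \<and> u < (f ^^ n) x - of_int m \<and> (f ^^ n) x - of_int m < v"
        using \<sigma> B(1) uv by blast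
    qed
  qed
qed

end

section \<open>Invariant graphs are calibrated\<close>

lemma continuous_has_antiderivative:
  fixes u :: "real \<Rightarrow> real"
  assumes "continuous_on UNIV u"
  shows "\<exists>U. \<forall>t. (U has_real_derivative u t) (at t)"
proof -
  have "\<exists>F. \<forall>x::real. - \<infinity> < ereal x \<longrightarrow> ereal x < \<infinity> \<longrightarrow> (F has_vector_derivative u x) (at x)"
    using einterval_antiderivative[of "- \<infinity>" \<infinity> u] assms
    by (auto simp: continuous_on_eq_continuous_at)
  then show ?thesis by (auto simp: has_real_derivative_iff_has_vector_derivative)
qed

context twist_map
begin

text \<open>
  Let the line be the graph of \<open>F\<close>, with inverse \<open>G\<close>, and let \<open>U\<close> be an antiderivative of the
  momentum \<open>- L1 t (F t)\<close> on the line. For fixed \<open>y\<close>, \<open>H t y = L t y + U t - U y\<close> increases in \<open>t\<close>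
  up to \<open>t = G y\<close> and decreases afterwards, by the monotonicity of \<open>L1\<close> and of \<open>F\<close>. Its maximum
  \<open>M y\<close> has derivative zero, because \<open>y \<mapsto> H t y\<close> is stationary at the points of the line by the
  law \<open>L1 y z = - L2 t y\<close>; this is an envelope argument, which does not presuppose that \<open>G\<close> is
  differentiable.\<close>

lemma graph_line_calibrated:
  assumes c: "invariant_line c" and mono: "strict_mono (\<lambda>\<sigma>. fst (c \<sigma>))"
  shows "\<exists>M U \<Delta>. (\<forall>t y. (t, y) \<in> strip \<longrightarrow> L t y \<le> M + U y - U t) \<and>
    (\<forall>t y. (t, y) \<in> range c \<longrightarrow> L t y = M + U y - U t) \<and>
    (\<forall>t. U (t + P) = U t + \<Delta>) \<and> (\<forall>s t. \<bar>U s - U t\<bar> \<le> \<kappa> * \<bar>s - t\<bar>)"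
proof -
  have cont: "continuous_on UNIV c" and sh: "\<And>\<sigma>. c (\<sigma> + 1) = shift 1 (c \<sigma>)" and sub: "\<And>\<sigma>. c \<sigma> \<in> strip"
    using c by (auto simp: invariant_line_def)
  obtain f f' where cl: "circle_lift f f'" and f: "\<And>\<sigma>. T (c \<sigma>) = c (f \<sigma>)"
    using invariant_line_lift[OF c] by blast
  interpret circle_lift f f' by (rule cl)
  define a where "a \<sigma> = fst (c \<sigma>)" for \<sigma>
  have snd_c: "snd (c \<sigma>) = a (f \<sigma>)" for \<sigma> using f[of \<sigma>] fst_T[of "c \<sigma>"] by (simp add: a_def)
  have c_eq: "c \<sigma> = (a \<sigma>, a (f \<sigma>))" for \<sigma> using snd_c[of \<sigma>] by (simp add: prod_eq_iff a_def)
  have a_mono: "strict_mono a" using mono unfolding a_def[abs_def] .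
  have a_cont: "continuous_on UNIV a" unfolding a_def using cont by (intro continuous_intros)
  have a_shift: "a (\<sigma> + 1) = a \<sigma> + P" for \<sigma> by (simp add: a_def sh shift_def)
  have "\<exists>\<sigma>. a \<sigma> = x" for x
    using first_and_last_hit[OF a_cont a_shift P_pos, of x] by blast
  then obtain b where ab [simp]: "a (b x) = x" for x by metis
  have ba [simp]: "b (a \<sigma>) = \<sigma>" for \<sigma> using ab[of "a \<sigma>"] strict_mono_eq[OF a_mono] by blast
  have b_mono: "strict_mono b"
    by (rule strict_monoI) (metis ab a_mono strict_mono_less)
  have b_cont: "continuous_on UNIV b"
  proof (rule continuous_onI_mono)
    have "surj b" by (rule surjI[of _ a]) simp
    then show "open (range b)" by simp
    show "b x \<le> b y" if "x \<le> y" for x y using that by (simp add: strict_mono_less_eq[OF b_mono])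
  qed
  define F where "F t = a (f (b t))" for t
  define G where "G y = a (f' (b y))" for y
  have FG [simp]: "F (G y) = y" and GF [simp]: "G (F y) = y" for y by (simp_all add: F_def G_def)
  have F_mono: "strict_mono F" using a_mono f_mono b_mono by (simp add: F_def strict_mono_def)
  have F_cont: "continuous_on UNIV F" unfolding F_def
    by (intro continuous_on_compose2[OF a_cont] continuous_on_compose2[OF f_cont] b_cont) auto
  have G_cont: "continuous_on UNIV G" unfolding G_def
    by (intro continuous_on_compose2[OF a_cont] continuous_on_compose2[OF f'_cont] b_cont) auto
  have on_line: "(t, F t) \<in> strip" for t using sub[of "b t"] by (simp add: c_eq F_def)
  have line_iff: "(t, y) \<in> range c \<longleftrightarrow> y = F t" for t y
  proof
    assume "y = F t"
    then have "(t, y) = c (b t)" by (simp add: c_eq F_def)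
    then show "(t, y) \<in> range c" by blast
  qed (auto simp: c_eq F_def)
  \<comment> \<open>the momentum on the line; by \<open>u_L2\<close> it is the same at the end of the incoming chord\<close>
  define u where "u t = - L1 t (F t)" for t
  have u_cont: "continuous_on UNIV u"
  proof -
    have "continuous_on UNIV (\<lambda>t. L1 (fst (t, F t)) (snd (t, F t)))"
      by (rule continuous_on_compose2[OF cont1']) (use on_line in \<open>auto intro!: continuous_intros F_cont\<close>)
    then show ?thesis unfolding u_def by (auto intro!: continuous_intros)
  qed
  have u_L2: "u y = L2 t y" if "y = F t" for t y
  proof -
    obtain z where z: "T (t, F t) = (F t, z)" "L1 (F t) z = - L2 t (F t)" using T_ex[OF on_line refl] by blast
    have "T (t, F t) = c (f (b t))" using f[of "b t"] by (simp add: c_eq F_def)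
    then have "z = F (F t)" using z by (simp add: c_eq F_def)
    then show ?thesis using z that by (simp add: u_def)
  qed
  obtain U where U: "\<And>t. (U has_real_derivative u t) (at t)"
    using continuous_has_antiderivative[OF u_cont] by blast
  define H where "H t y = L t y + U t - U y" for t y
  define M where "M y = H (G y) y" for y
  have le: "H t y \<le> M y" if ty: "(t, y) \<in> strip" for t y
  proof -
    have s: "(\<tau>, y) \<in> strip" if "\<tau> \<in> {min t (G y)..max t (G y)}" for \<tau>
      using that ty on_line[of "G y"] by (auto simp: strip_iff)
    have der: "((\<lambda>\<tau>. H \<tau> y) has_real_derivative L1 \<tau> y - L1 \<tau> (F \<tau>)) (at \<tau>)"
      if "\<tau> \<in> {min t (G y)..max t (G y)}" for \<tau>
      using s[OF that] unfolding H_def u_def strip_iff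
      by (auto intro!: derivative_eq_intros deriv1 U simp: u_def)
    show ?thesis unfolding M_def
    proof (cases "t \<le> G y")
      case True
      show "H t y \<le> H (G y) y"
      proof (rule DERIV_nonneg_imp_nondecreasing[where f = "\<lambda>\<tau>. H \<tau> y", OF True])
        fix \<tau> assume \<tau>: "t \<le> \<tau>" "\<tau> \<le> G y"
        then have "F \<tau> \<le> y" using strict_mono_less_eq[OF F_mono, of \<tau> "G y"] by simp
        then have "L1 \<tau> (F \<tau>) \<le> L1 \<tau> y"
          using mono1[of \<tau> "F \<tau>" y] on_line[of \<tau>] s[of \<tau>] \<tau> True by (cases "F \<tau> = y") (auto simp: strip_iff)
        then show "\<exists>d. ((\<lambda>\<tau>. H \<tau> y) has_real_derivative d) (at \<tau>) \<and> 0 \<le> d" using der[of \<tau>] \<tau> True by auto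
      qed
    next
      case False
      show "H t y \<le> H (G y) y"
      proof (rule DERIV_nonpos_imp_nonincreasing[where f = "\<lambda>\<tau>. H \<tau> y" and a = "G y" and b = t])
        show "G y \<le> t" using False by simp
        fix \<tau> assume \<tau>: "G y \<le> \<tau>" "\<tau> \<le> t"
        then have "y \<le> F \<tau>" using strict_mono_less_eq[OF F_mono, of "G y" \<tau>] by simp
        then have "L1 \<tau> y \<le> L1 \<tau> (F \<tau>)"
          using mono1[of \<tau> y "F \<tau>"] on_line[of \<tau>] s[of \<tau>] \<tau> False by (cases "F \<tau> = y") (auto simp: strip_iff)
        then show "\<exists>d. ((\<lambda>\<tau>. H \<tau> y) has_real_derivative d) (at \<tau>) \<and> d \<le> 0" using der[of \<tau>] \<tau> False by auto
      qed
    qed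
  qed
  \<comment> \<open>Both \<open>H t0 y \<le> M y\<close> and \<open>H (G y) y0 \<le> M y0\<close> hold, with equality for \<open>y = y0\<close>. So the increment
    of \<open>M\<close> is squeezed between the increments of \<open>H\<close> in its second argument at \<open>t0\<close> and at \<open>G y\<close>.\<close>
  have dM: "(M has_real_derivative 0) (at y0)" for y0
  proof -
    define t0 where "t0 = G y0"
    have t0: "(t0, y0) \<in> strip" using on_line[of t0] by (simp add: t0_def)
    define g where "g q = L2 (fst q) (snd q) - u (snd q)" for q
    have "continuous_on strip g" unfolding g_def
      by (intro continuous_intros cont2' continuous_on_compose2[OF u_cont]) auto
    then have g_cont: "isCont g (t0, y0)" using open_strip t0 by (simp add: continuous_on_eq_continuous_at)
    have g0: "g (t0, y0) = 0" using u_L2[of y0 t0] by (simp add: g_def t0_def)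
    have Hy: "((\<lambda>y. H t y) has_real_derivative g (t, y)) (at y)" if "(t, y) \<in> strip" for t y
      using that unfolding H_def g_def strip_iff by (auto intro!: derivative_eq_intros deriv2 U)
    have "(\<lambda>y. (M y - M y0) / (y - y0)) \<midarrow>y0\<rightarrow> 0"
    proof (rule tendstoI)
      fix \<epsilon> :: real assume "\<epsilon> > 0"
      then have "\<forall>\<^sub>F q in nhds (t0, y0). dist (g q) 0 < \<epsilon> / 2"
        using tendstoD[OF g_cont[unfolded isCont_def tendsto_at_iff_tendsto_nhds], of "\<epsilon> / 2"] g0 by simp
      moreover have "\<forall>\<^sub>F q in nhds (t0, y0). q \<in> strip" using open_strip t0 by (rule eventually_nhds_in_open)
      ultimately have "\<forall>\<^sub>F q in nhds (t0, y0). \<bar>g q\<bar> < \<epsilon> / 2 \<and> q \<in> strip"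
        by eventually_elim simp
      then obtain d where d: "d > 0" "\<And>q. dist q (t0, y0) < d \<Longrightarrow> \<bar>g q\<bar> < \<epsilon> / 2 \<and> q \<in> strip"
        unfolding eventually_nhds_metric by blast
      have near: "\<bar>g (t, y)\<bar> < \<epsilon> / 2 \<and> (t, y) \<in> strip" if "\<bar>t - t0\<bar> < d / 2" "\<bar>y - y0\<bar> < d / 2" for t y
      proof (rule d(2))
        have "dist (t, y) (t0, y0) \<le> \<bar>t - t0\<bar> + \<bar>y - y0\<bar>"
          unfolding dist_Pair_Pair dist_real_def using sqrt_sum_squares_le_sum_abs[of "t - t0" "y - y0"] by simp
        then show "dist (t, y) (t0, y0) < d" using that by linarith
      qed
      have Hd: "\<bar>H t y - H t y0\<bar> \<le> \<epsilon> / 2 * \<bar>y - y0\<bar>" if "\<bar>t - t0\<bar> < d / 2" "\<bar>y - y0\<bar> < d / 2" for t y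
      proof -
        have "norm (H t y - H t y0) \<le> \<epsilon> / 2 * norm (y - y0)"
        proof (rule field_differentiable_bound[where S = "ball y0 (d / 2)" and f' = "\<lambda>y. g (t, y)"])
          fix z assume "z \<in> ball y0 (d / 2)"
          then have z: "\<bar>z - y0\<bar> < d / 2" by (simp add: dist_real_def abs_minus_commute)
          show "((\<lambda>y. H t y) has_field_derivative g (t, z)) (at z within ball y0 (d / 2))"
            using Hy near[OF that(1) z] by (blast intro: has_field_derivative_at_within)
          show "norm (g (t, z)) \<le> \<epsilon> / 2" using near[OF that(1) z] by simp
        qed (use d(1) that in \<open>auto simp: dist_real_def abs_minus_commute\<close>)
        then show ?thesis by simp
      qed
      have "isCont G y0" using G_cont by (simp add: continuous_on_eq_continuous_at)
      then have "\<forall>\<^sub>F y in at y0. dist (G y) t0 < d / 2"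
        unfolding isCont_def t0_def using tendstoD d(1) by (metis half_gt_zero)
      moreover have "\<forall>\<^sub>F y in at y0. dist y y0 < d / 2" using d(1) by (intro eventually_at_ball'[THEN eventually_mono, of "d/2"]) (auto simp: dist_commute)
      moreover have "\<forall>\<^sub>F y in at y0. y \<noteq> y0" by (simp add: eventually_at_filter)
      ultimately show "\<forall>\<^sub>F y in at y0. dist ((M y - M y0) / (y - y0)) 0 < \<epsilon>"
      proof eventually_elim
        case (elim y)
        then have y: "\<bar>G y - t0\<bar> < d / 2" "\<bar>y - y0\<bar> < d / 2" by (simp_all add: dist_real_def)
        have 1: "H (G y) y0 \<le> M y0" using le near[of "G y" y0] y d(1) by simp
        have 2: "H t0 y \<le> M y" using le near[of t0 y] y d(1) by simp
        define r where "r = \<epsilon> / 2 * \<bar>y - y0\<bar>"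
        have 3: "\<bar>M y - H (G y) y0\<bar> \<le> r" using Hd[OF y] by (simp add: M_def r_def)
        have 4: "\<bar>H t0 y - M y0\<bar> \<le> r" using Hd[of t0 y] y d(1) by (simp add: M_def r_def flip: t0_def)
        have "\<bar>M y - M y0\<bar> \<le> r" using 1 2 3 4 by linarith
        then have "\<bar>M y - M y0\<bar> \<le> \<epsilon> / 2 * \<bar>y - y0\<bar>" by (simp only: r_def)
        also have "\<dots> < \<epsilon> * \<bar>y - y0\<bar>" using \<open>\<epsilon> > 0\<close> elim by simp
        finally show ?case using elim by (simp add: abs_divide field_simps)
      qed
    qed
    then show ?thesis by (simp add: has_field_derivative_iff)
  qed
  have M_const: "M y = M 0" for y using DERIV_isconst_all[of M y 0] dM by blast
  have U_shift: "U (t + P) = U t + (U P - U 0)" for t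
  proof -
    have F_shift: "F (t + P) = F t + P" for t
    proof -
      have "b (t + P) = b t + 1" using a_shift[of "b t"] ba[of "b t + 1"] by simp
      then show ?thesis by (simp add: F_def f_shift1 a_shift)
    qed
    have "((\<lambda>t. U (t + P) - U t) has_real_derivative 0) (at t)" for t
    proof -
      have "((\<lambda>t. U (t + P)) has_real_derivative u (t + P)) (at t)"
        using DERIV_shift U by blast
      moreover have "u (t + P) = u t" by (simp add: u_def F_shift L1_shift)
      ultimately show ?thesis using U[of t] by (auto intro!: derivative_eq_intros)
    qed
    then have "U (t + P) - U t = U (0 + P) - U 0"
      using DERIV_isconst_all[of "\<lambda>t. U (t + P) - U t" t 0] by blast
    then show ?thesis by simp
  qed
  have U_lip: "\<bar>U s - U t\<bar> \<le> \<kappa> * \<bar>s - t\<bar>" for s t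
  proof -
    have "norm (U s - U t) \<le> \<kappa> * norm (s - t)"
    proof (rule field_differentiable_bound[where S = UNIV and f' = u])
      show "norm (u z) \<le> \<kappa>" for z using bound1[of z "F z"] on_line[of z] by (simp add: u_def strip_iff)
    qed (use U in auto)
    then show ?thesis by simp
  qed
  have "L t y \<le> M 0 + U y - U t" if "(t, y) \<in> strip" for t y
    using le[OF that] M_const[of y] by (simp add: H_def)
  moreover have "L t y = M 0 + U y - U t" if "(t, y) \<in> range c" for t y
    using M_const[of y] that by (simp add: line_iff M_def H_def)
  ultimately show ?thesis using U_shift U_lip by blast
qed

end

section \<open>Periodic orbits of a foliated twist map\<close>

context twist_map
begin

lemma T_pow_cont: "continuous_on strip (T ^^ n)"
proof (induction n)
  case (Suc n)
  have "continuous_on strip (\<lambda>q. T ((T ^^ n) q))"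
    by (rule continuous_on_compose2[OF T_cont Suc]) (use T_pow_strip in auto)
  then show ?case by (simp add: o_def)
qed (simp add: continuous_on_id[unfolded id_def] id_def)

lemma returning_open:
  assumes "open B" "B \<subseteq> strip"
  shows "open (returning B)"
proof -
  have eq: "returning B = (\<Union>n\<in>{1..}. \<Union>m. B \<inter> (strip \<inter> (\<lambda>q. shift m ((T ^^ n) q)) -` B))"
    using assms(2) unfolding returning_def atLeast_def by blast
  have op: "open (strip \<inter> (\<lambda>q. shift m ((T ^^ n) q)) -` B)" for m n
    by (rule continuous_open_preimage[OF _ open_strip assms(1)])
      (rule continuous_on_compose2[OF shift_cont[of UNIV] T_pow_cont], auto)
  show ?thesis unfolding eq by (intro open_UN ballI open_Int[OF assms(1) op])
qed

lemma returning_dense: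
  assumes "open V" "V \<subseteq> B" "B \<subseteq> strip" "V \<noteq> {}"
  shows "returning B \<inter> V \<noteq> {}"
proof -
  have "V \<subseteq> strip" using assms by blast
  then obtain n m q where "n \<ge> 1" "q \<in> V" "shift m ((T ^^ n) q) \<in> V"
    using nonwandering[OF assms(1) _ assms(4)] by blast
  then have "q \<in> returning B" using assms(2) unfolding returning_def by blast
  then show ?thesis using \<open>q \<in> V\<close> by blast
qed

end

text \<open>
  A partition of the strip into invariant lines, with the topological property of a foliation that
  the leaves through an open set form an open set.\<close>

locale invariant_foliation = twist_map +
  fixes leaf :: "real \<times> real \<Rightarrow> (real \<times> real) set"
  assumes leaf_line: "\<And>q. q \<in> strip \<Longrightarrow> \<exists>c. invariant_line c \<and> leaf q = range c"
    and leaf_self: "\<And>q. q \<in> strip \<Longrightarrow> q \<in> leaf q"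
    and leaf_eq: "\<And>q q'. q \<in> strip \<Longrightarrow> q' \<in> leaf q \<Longrightarrow> leaf q' = leaf q"
    and saturation_open: "\<And>V. open V \<Longrightarrow> V \<subseteq> strip \<Longrightarrow> open (\<Union>q\<in>V. leaf q)"
begin

text \<open>
  The union of the leaves that meet \<open>V\<close>.\<close>

definition sat :: "(real \<times> real) set \<Rightarrow> (real \<times> real) set" where
  "sat V = (\<Union>q\<in>V. leaf q)"

lemma leaf_strip: "q \<in> strip \<Longrightarrow> leaf q \<subseteq> strip"
  using leaf_line[of q] by (auto simp: invariant_line_def)

lemma sat_iff: "V \<subseteq> strip \<Longrightarrow> q \<in> sat V \<longleftrightarrow> q \<in> strip \<and> leaf q \<inter> V \<noteq> {}"
proof -
  assume V: "V \<subseteq> strip"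
  show ?thesis
  proof
    assume "q \<in> sat V"
    then obtain p where p: "p \<in> V" "q \<in> leaf p" by (auto simp: sat_def)
    then have "p \<in> strip" using V by blast
    then have "q \<in> strip" "p \<in> leaf q" using p leaf_strip[of p] leaf_eq[of p q] leaf_self[of p] by auto
    then show "q \<in> strip \<and> leaf q \<inter> V \<noteq> {}" using p by blast
  next
    assume q: "q \<in> strip \<and> leaf q \<inter> V \<noteq> {}"
    then obtain p where p: "p \<in> leaf q" "p \<in> V" by blast
    then have "q \<in> leaf p" using q leaf_eq[of q p] leaf_self[of q] by simp
    then show "q \<in> sat V" using p by (auto simp: sat_def)
  qed
qed

lemma sat_open: "open V \<Longrightarrow> V \<subseteq> strip \<Longrightarrow> open (sat V)"
  unfolding sat_def by (rule saturation_open)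

lemma sat_strip: "V \<subseteq> strip \<Longrightarrow> sat V \<subseteq> strip"
  using sat_iff by blast

text \<open>
  For each basic open set \<open>B\<close>, the leaves that meet \<open>returning B\<close>, together with the exterior of
  the leaves through \<open>B\<close>, fill an open dense set: near a leaf that meets \<open>B\<close> there are returning
  points of \<open>B\<close>, and their leaves pass close to any point of the given leaf. By Baire's theorem
  there is a dense set of points that lie in all these sets. The map is nonwandering along the
  leaf of such a point, which is therefore a graph.\<close>

lemma graph_leaves_dense:
  assumes "open N" "N \<inter> strip \<noteq> {}"
  shows "\<exists>q\<in>N \<inter> strip. \<exists>c. invariant_line c \<and> range c = leaf q \<and> strict_mono (\<lambda>\<sigma>. fst (c \<sigma>))"
proof -
  obtain \<B> :: "(real \<times> real) set set" where \<B>: "countable \<B>" "topological_basis \<B>"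
    using ex_countable_basis by blast
  define \<B>' where "\<B>' = {B \<in> \<B>. B \<subseteq> strip}"
  \<comment> \<open>the second set is the exterior of the leaves through \<open>B\<close>\<close>
  define good where "good B = sat (returning B) \<union> interior (- sat B)" for B
  have B_open: "open B" if "B \<in> \<B>'" for B using that \<B>(2) topological_basis_open by (auto simp: \<B>'_def)
  have ret_sub: "returning B \<subseteq> B" for B by (auto simp: returning_def)
  have dense: "UNIV \<subseteq> closure (\<Inter>(good ` \<B>'))"
  proof (rule Baire)
    show "countable (good ` \<B>')" unfolding \<B>'_def using \<B>(1) by auto
    fix G assume "G \<in> good ` \<B>'"
    then obtain B where B: "B \<in> \<B>'" "G = good B" by auto
    have Bs: "B \<subseteq> strip" using B by (auto simp: \<B>'_def)
    have rs: "returning B \<subseteq> strip" using ret_sub[of B] Bs by blast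
    have "open G" unfolding B good_def
      by (intro open_Un sat_open returning_open B_open B Bs rs open_interior)
    moreover have "x \<in> closure G" for x
      unfolding closure_iff_nhds_not_empty
    proof (intro allI impI)
      fix A W assume W: "W \<subseteq> A" "open W" "x \<in> W"
      show "G \<inter> A \<noteq> {}"
      proof (cases "W \<inter> sat B = {}")
        case True
        then have "W \<subseteq> interior (- sat B)" using W by (intro interior_maximal) auto
        then show ?thesis using W by (auto simp: B good_def)
      next
        case False
        define W' where "W' = W \<inter> sat B"
        have W': "open W'" "W' \<subseteq> strip" "W' \<noteq> {}"
          using open_Int[OF W(2) sat_open[OF B_open[OF B(1)] Bs]] False sat_strip[OF Bs]
          unfolding W'_def by blast+
        define V where "V = sat W' \<inter> B"
        have "open V" unfolding V_def using sat_open[OF W'(1,2)] B_open[OF B(1)] by (rule open_Int)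
        moreover have "V \<noteq> {}"
        proof -
          obtain w where w: "w \<in> W'" using W' by blast
          then obtain p where p: "p \<in> leaf w" "p \<in> B" using sat_iff[OF Bs, of w] by (auto simp: W'_def)
          then show ?thesis using w by (auto simp: V_def sat_def)
        qed
        ultimately obtain r where r: "r \<in> returning B" "r \<in> V"
          using returning_dense[of V B] Bs by (auto simp: V_def)
        then obtain w where w: "w \<in> W'" "r \<in> leaf w" by (auto simp: V_def sat_def)
        then have "w \<in> sat (returning B)" using sat_iff[OF rs, of w] r W'(2) by auto
        then show ?thesis using w W by (auto simp: B good_def W'_def)
      qed
    qed
    ultimately show "openin (top_of_set UNIV) G \<and> UNIV \<subseteq> closure G" by auto
  qed simp
  have "open (N \<inter> strip)" using assms open_strip by auto
  then obtain q where q: "q \<in> N \<inter> strip" "q \<in> \<Inter>(good ` \<B>')"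
    using dense assms(2) open_Int_closure_eq_empty[of "N \<inter> strip" "\<Inter>(good ` \<B>')"] by blast
  have qs: "q \<in> strip" using q by simp
  obtain c where c: "invariant_line c" "leaf q = range c" using leaf_line[OF qs] by blast
  have "strict_mono (\<lambda>\<sigma>. fst (c \<sigma>))"
  proof (rule recurrent_line_is_graph[OF c(1)])
    fix V assume V: "open V" "V \<subseteq> strip" "V \<inter> range c \<noteq> {}"
    then obtain p where p: "p \<in> V" "p \<in> range c" by blast
    obtain B where B: "B \<in> \<B>" "p \<in> B" "B \<subseteq> V" using topological_basisE[OF \<B>(2) V(1) p(1)] by blast
    then have B': "B \<in> \<B>'" using V by (auto simp: \<B>'_def)
    have Bs: "B \<subseteq> strip" using B V by blast
    have "q \<in> sat B" using sat_iff[OF Bs, of q] qs p B c(2) by auto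
    then have "q \<notin> interior (- sat B)" using interior_subset by blast
    then have "q \<in> sat (returning B)" using q(2) B' by (auto simp: good_def)
    moreover have "returning B \<subseteq> strip" using ret_sub[of B] Bs by blast
    ultimately have "returning B \<inter> range c \<noteq> {}" using sat_iff[of "returning B" q] c(2) by auto
    then show "\<exists>B. open B \<and> B \<subseteq> V \<and> returning B \<inter> range c \<noteq> {}"
      using B B_open[OF B'] by blast
  qed
  then show ?thesis using q(1) c by metis
qed

text \<open>
  Take a point \<open>q\<close> close to \<open>q0\<close> on a leaf that is a graph. Calibration by this leaf bounds the
  length of the polygon \<open>y\<close> by \<open>n M + j \<Delta>\<close>. The length of the orbit segment of \<open>q\<close> equals the same
  number up to the Lipschitz bound for \<open>U\<close> times the defect \<open>e q\<close>, by which the segment fails to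
  close up. As \<open>q\<close> tends to \<open>q0\<close>, the defect tends to zero.\<close>

theorem periodic_orbits_maximize:
  assumes q0: "q0 \<in> strip" "(T ^^ n) q0 = shift j q0"
    and y: "\<And>i. i < n \<Longrightarrow> (y i, y (Suc i)) \<in> strip" "y n = y 0 + of_int j * P"
  shows "(\<Sum>i<n. L (y i) (y (Suc i))) \<le> (\<Sum>i<n. L (fst ((T ^^ i) q0)) (snd ((T ^^ i) q0)))"
proof (rule field_le_epsilon)
  fix \<epsilon> :: real assume "\<epsilon> > 0"
  define S where "S q = (\<Sum>i<n. L (fst ((T ^^ i) q)) (snd ((T ^^ i) q)))" for q
  define e where "e q = \<bar>fst ((T ^^ n) q) - (fst q + of_int j * P)\<bar>" for q
  have "continuous_on strip (\<lambda>q. S q + \<kappa> * e q)"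
    unfolding S_def e_def
    by (intro continuous_intros continuous_on_compose2[OF cont0' T_pow_cont] continuous_on_fst T_pow_cont)
      (use T_pow_strip in auto)
  then have "isCont (\<lambda>q. S q + \<kappa> * e q) q0" using open_strip q0 by (simp add: continuous_on_eq_continuous_at)
  then have lim: "((\<lambda>q. S q + \<kappa> * e q) \<longlongrightarrow> S q0 + \<kappa> * e q0) (nhds q0)"
    using tendsto_at_iff_tendsto_nhds[of "\<lambda>q. S q + \<kappa> * e q" q0] by (simp only: isCont_def)
  have "e q0 = 0" using q0 by (simp add: e_def shift_def)
  then have "\<forall>\<^sub>F q in nhds q0. S q + \<kappa> * e q < S q0 + \<epsilon>"
    using order_tendstoD(2)[OF lim, of "S q0 + \<epsilon>"] \<open>\<epsilon> > 0\<close> by simp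
  then obtain N where N: "open N" "q0 \<in> N" "\<And>q. q \<in> N \<Longrightarrow> S q + \<kappa> * e q < S q0 + \<epsilon>"
    unfolding eventually_nhds by blast
  obtain q c where q: "q \<in> N" "q \<in> strip" "invariant_line c" "range c = leaf q" "strict_mono (\<lambda>\<sigma>. fst (c \<sigma>))"
    using graph_leaves_dense[OF N(1)] N(2) q0(1) by blast
  obtain M U \<Delta> where cal: "\<And>t y. (t, y) \<in> strip \<Longrightarrow> L t y \<le> M + U y - U t"
      "\<And>t y. (t, y) \<in> range c \<Longrightarrow> L t y = M + U y - U t"
      "\<And>t. U (t + P) = U t + \<Delta>" "\<And>s t. \<bar>U s - U t\<bar> \<le> \<kappa> * \<bar>s - t\<bar>"
    using graph_line_calibrated[OF q(3,5)] by blast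
  have U_int: "U (t + of_int j * P) = U t + of_int j * \<Delta>" for t j
  proof (induction j rule: int_induct[where k = 0])
    case (step1 i)
    then show ?case using cal(3)[of "t + of_int i * P"] by (simp add: algebra_simps)
  next
    case (step2 i)
    then show ?case using cal(3)[of "t + of_int i * P - P"] by (simp add: algebra_simps)
  qed simp
  have "(\<Sum>i<n. L (y i) (y (Suc i))) \<le> (\<Sum>i<n. M + (U (y (Suc i)) - U (y i)))"
    using cal(1) y(1) by (intro sum_mono) (simp add: algebra_simps)
  also have "\<dots> = n * M + (U (y n) - U (y 0))"
    using sum_lessThan_telescope[of "\<lambda>i. U (y i)" n] by (simp add: sum.distrib)
  also have "\<dots> = n * M + of_int j * \<Delta>" using U_int by (simp add: y(2))
  finally have 1: "(\<Sum>i<n. L (y i) (y (Suc i))) \<le> n * M + of_int j * \<Delta>" .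
  have on_c: "(T ^^ i) q \<in> range c" for i
  proof (induction i)
    case 0
    then show ?case using q(4) leaf_self[OF q(2)] by simp
  next
    case (Suc i)
    have "T ` range c = range c" using q(3) by (simp add: invariant_line_def)
    then show ?case using Suc by auto
  qed
  have "S q = (\<Sum>i<n. M + (U (fst ((T ^^ Suc i) q)) - U (fst ((T ^^ i) q))))"
    unfolding S_def
  proof (rule sum.cong)
    fix i
    show "L (fst ((T ^^ i) q)) (snd ((T ^^ i) q)) = M + (U (fst ((T ^^ Suc i) q)) - U (fst ((T ^^ i) q)))"
      using cal(2)[of "fst ((T ^^ i) q)" "snd ((T ^^ i) q)"] on_c[of i] by simp
  qed simp
  also have "\<dots> = n * M + (U (fst ((T ^^ n) q)) - U (fst ((T ^^ 0) q)))"
    using sum_lessThan_telescope[of "\<lambda>i. U (fst ((T ^^ i) q))" n] by (simp only: sum.distrib sum_constant card_lessThan)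
  also have "\<dots> \<ge> n * M + of_int j * \<Delta> - \<kappa> * e q"
    using cal(4)[of "fst ((T ^^ n) q)" "fst q + of_int j * P"] U_int[of "fst q" j] by (simp add: e_def)
  finally have "n * M + of_int j * \<Delta> \<le> S q + \<kappa> * e q" by simp
  then show "(\<Sum>i<n. L (y i) (y (Suc i))) \<le> (\<Sum>i<n. L (fst ((T ^^ i) q0)) (snd ((T ^^ i) q0))) + \<epsilon>"
    using 1 N(3)[OF q(1)] by (simp add: S_def)
qed

end

section \<open>The gauge of a strictly convex table\<close>

definition cross2 :: "plane \<Rightarrow> plane \<Rightarrow> real" where
  "cross2 u v = u $ 1 * v $ 2 - u $ 2 * v $ 1"

lemma cross2_simps [simp]:
  "cross2 (u + v) w = cross2 u w + cross2 v w" "cross2 (u - v) w = cross2 u w - cross2 v w"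
  "cross2 u (v + w) = cross2 u v + cross2 u w" "cross2 u (v - w) = cross2 u v - cross2 u w"
  "cross2 (r *\<^sub>R u) v = r * cross2 u v" "cross2 u (r *\<^sub>R v) = r * cross2 u v"
  "cross2 (- u) v = - cross2 u v" "cross2 u (- v) = - cross2 u v"
  "cross2 u u = 0" "cross2 0 u = 0" "cross2 u 0 = 0"
  by (simp_all add: cross2_def algebra_simps)

lemma cross2_swap: "cross2 u v = - cross2 v u"
  by (simp add: cross2_def)

lemma plane_expand: "cross2 e v \<noteq> 0 \<Longrightarrow> w = (cross2 e w / cross2 e v) *\<^sub>R v - (cross2 v w / cross2 e v) *\<^sub>R e"
proof -
  assume *: "cross2 e v \<noteq> 0"
  have "cross2 e v *\<^sub>R w = cross2 e w *\<^sub>R v - cross2 v w *\<^sub>R e"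
    by (simp add: vec_eq_iff forall_2 cross2_def algebra_simps)
  then have "(1 / cross2 e v) *\<^sub>R (cross2 e v *\<^sub>R w) = (1 / cross2 e v) *\<^sub>R (cross2 e w *\<^sub>R v - cross2 v w *\<^sub>R e)"
    by simp
  then show ?thesis using * by (simp add: scaleR_diff_right)
qed

text \<open>
  The Pluecker relation of four vectors in the plane.\<close>

lemma cross2_pluecker: "cross2 a c * cross2 e v - cross2 a v * cross2 e c = cross2 a e * cross2 c v"
  by (simp add: cross2_def algebra_simps)

lemma cross2_0_parallel:
  assumes "cross2 u v = 0" "u \<noteq> 0"
  shows "\<exists>r. v = r *\<^sub>R u"
proof -
  have n: "u $ 1 \<noteq> 0 \<or> u $ 2 \<noteq> 0" using assms(2) by (simp add: vec_eq_iff forall_2)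
  show ?thesis
  proof (cases "u $ 1 = 0")
    case True
    with n have "u $ 2 \<noteq> 0" by simp
    with assms True show ?thesis
      by (intro exI[of _ "v $ 2 / u $ 2"]) (simp add: vec_eq_iff forall_2 cross2_def)
  next
    case False
    with assms show ?thesis
      by (intro exI[of _ "v $ 1 / u $ 1"]) (simp add: vec_eq_iff forall_2 cross2_def field_simps)
  qed
qed

lemma cross2_inner: "cross2 x e = vector [e $ 2, - e $ 1] \<bullet> x"
  by (simp add: cross2_def inner_vec_def sum_2)

lemma continuous_cross2 [continuous_intros]:
  "continuous_on S f \<Longrightarrow> continuous_on S g \<Longrightarrow> continuous_on S (\<lambda>x. cross2 (f x) (g x))"
  unfolding cross2_def by (intro continuous_intros)

locale convex_table =
  fixes \<Gamma> :: "plane set" and P :: real and \<gamma> :: "real \<Rightarrow> plane"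
  assumes param: "minkowski_param \<Gamma> P \<gamma>"
    and sconvex: "strictly_convex_curve \<Gamma>"
begin

definition \<gamma>' :: "real \<Rightarrow> plane" where "\<gamma>' t = vector_derivative \<gamma> (at t)"
abbreviation "K \<equiv> inside \<Gamma>"
abbreviation "g \<equiv> gauge_fun K"

lemma P_pos: "P > 0" and \<gamma>_shift: "\<gamma> (t + P) = \<gamma> t" and \<gamma>_inj: "inj_on \<gamma> {0..<P}"
  and range_\<gamma>: "range \<gamma> = \<Gamma>"
  using param by (auto simp: minkowski_param_def C2_closed_param_def)

lemma \<gamma>_in [simp]: "\<gamma> t \<in> \<Gamma>"
  using range_\<gamma> by blast

lemma \<gamma>_deriv: "(\<gamma> has_vector_derivative \<gamma>' t) (at t)" and \<gamma>'_nz: "\<gamma>' t \<noteq> 0"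
  and \<gamma>'_cont: "continuous_on UNIV \<gamma>'"
proof -
  have "\<exists>d. (\<forall>t. (\<gamma> has_vector_derivative d t) (at t) \<and> d t \<noteq> 0) \<and> d C1_differentiable_on UNIV"
    using param unfolding minkowski_param_def C2_closed_param_def by blast
  then obtain d where d: "\<And>t. (\<gamma> has_vector_derivative d t) (at t)" "\<And>t. d t \<noteq> 0" "d C1_differentiable_on UNIV"
    by blast
  have "\<gamma>' = d" using vector_derivative_at[OF d(1)] by (auto simp: \<gamma>'_def)
  with d C1_differentiable_imp_continuous_on[OF d(3)]
  show "(\<gamma> has_vector_derivative \<gamma>' t) (at t)" "\<gamma>' t \<noteq> 0" "continuous_on UNIV \<gamma>'" by auto
qed

lemma \<gamma>_cont: "continuous_on S \<gamma>"
  using \<gamma>_deriv by (meson continuous_at_imp_continuous_on has_vector_derivative_continuous)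

lemma \<gamma>_shift_int: "\<gamma> (t + of_int m * P) = \<gamma> t"
proof (induction m rule: int_induct[where k = 0])
  case (step1 i)
  then show ?case using \<gamma>_shift[of "t + of_int i * P"] by (simp add: algebra_simps)
next
  case (step2 i)
  then show ?case using \<gamma>_shift[of "t + of_int i * P - P"] by (simp add: algebra_simps)
qed simp

lemma \<gamma>'_shift: "\<gamma>' (t + of_int m * P) = \<gamma>' t"
proof -
  have "(\<gamma> \<circ> (\<lambda>s. s + of_int m * P) has_vector_derivative 1 *\<^sub>R \<gamma>' (t + of_int m * P)) (at t)"
    by (rule vector_diff_chain_at) (auto intro!: derivative_eq_intros \<gamma>_deriv)
  moreover have "\<gamma> \<circ> (\<lambda>s. s + of_int m * P) = \<gamma>" by (auto simp: \<gamma>_shift_int)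
  ultimately show ?thesis using vector_derivative_unique_at[OF _ \<gamma>_deriv] by simp
qed

lemma reduce_mod: "\<exists>m::int. a \<le> t + of_int m * P \<and> t + of_int m * P < a + P"
proof (intro exI conjI)
  have *: "of_int \<lfloor>(t - a) / P\<rfloor> * P \<le> t - a" "t - a < (of_int \<lfloor>(t - a) / P\<rfloor> + 1) * P"
    using floor_divide_lower[OF P_pos] floor_divide_upper[OF P_pos] by auto
  then show "a \<le> t + of_int (- \<lfloor>(t - a) / P\<rfloor>) * P" "t + of_int (- \<lfloor>(t - a) / P\<rfloor>) * P < a + P"
    by (simp_all add: algebra_simps)
qed

lemma \<gamma>_eq_iff: "\<gamma> s = \<gamma> t \<longleftrightarrow> (\<exists>m::int. s = t + of_int m * P)"
proof
  assume eq: "\<gamma> s = \<gamma> t"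
  obtain m n :: int where mn: "0 \<le> s + of_int m * P" "s + of_int m * P < P" "0 \<le> t + of_int n * P" "t + of_int n * P < P"
    using reduce_mod[of 0 s] reduce_mod[of 0 t] by auto
  have "s + of_int m * P = t + of_int n * P"
    by (rule inj_onD[OF \<gamma>_inj]) (use mn eq \<gamma>_shift_int in auto)
  then have "s = t + of_int (n - m) * P" by (simp add: algebra_simps)
  then show "\<exists>m::int. s = t + of_int m * P" by blast
qed (use \<gamma>_shift_int in auto)

lemma \<gamma>_neq: "t < y \<Longrightarrow> y < t + P \<Longrightarrow> \<gamma> y \<noteq> \<gamma> t"
proof
  assume *: "t < y" "y < t + P" "\<gamma> y = \<gamma> t"
  then obtain m :: int where m: "y = t + of_int m * P" using \<gamma>_eq_iff by blast
  then have "0 < of_int m * P" "of_int m * P < 1 * P" using * by auto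
  then have "(0::real) < of_int m" "of_int m < (1::real)"
    using P_pos by (simp_all add: zero_less_mult_iff)
  then have "0 < m" "m < 1" by simp_all
  then show False by simp
qed

lemma \<Gamma>_image: "\<Gamma> = \<gamma> ` {a..a + P}"
proof
  show "\<Gamma> \<subseteq> \<gamma> ` {a..a + P}"
  proof
    fix x assume "x \<in> \<Gamma>"
    then obtain t where "x = \<gamma> t" using range_\<gamma> by blast
    moreover obtain m :: int where "a \<le> t + of_int m * P" "t + of_int m * P < a + P" using reduce_mod by blast
    ultimately show "x \<in> \<gamma> ` {a..a + P}" using \<gamma>_shift_int[of t m] by (intro image_eqI[of _ _ "t + of_int m * P"]) auto
  qed
qed auto

lemma compact_\<Gamma>: "compact \<Gamma>"
  using \<Gamma>_image[of 0] by (metis compact_continuous_image \<gamma>_cont compact_Icc)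

lemma left_of_tangent: "x \<in> K \<Longrightarrow> cross2 (\<gamma>' t) (x - \<gamma> t) > 0"
  using param by (simp add: minkowski_param_def cross2_def \<gamma>'_def)

lemma gauge_\<gamma>': "g (\<gamma>' t) = 1"
  using param by (simp add: minkowski_param_def \<gamma>'_def)

lemma open_K: "open K"
  using compact_\<Gamma> compact_imp_closed open_inside by blast

text \<open>
  The region lies on one side of each tangent line. So if a point of \<open>\<Gamma>\<close> were interior, then an
  open set beyond its tangent line would consist of points of \<open>\<Gamma>\<close>, but a differentiable curve is
  negligible.\<close>

lemma interior_region: "interior (\<Gamma> \<union> K) = K"
proof
  show "K \<subseteq> interior (\<Gamma> \<union> K)" using open_K by (intro interior_maximal) auto
  show "interior (\<Gamma> \<union> K) \<subseteq> K"
  proof (rule ccontr)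
    assume "\<not> ?thesis"
    then obtain z where z: "z \<in> interior (\<Gamma> \<union> K)" "z \<in> \<Gamma>" using interior_subset by blast
    obtain t where t: "z = \<gamma> t" using z range_\<gamma> by blast
    define W where "W = interior (\<Gamma> \<union> K) \<inter> {x. cross2 (\<gamma>' t) (x - z) < 0}"
    have "open {x. cross2 (\<gamma>' t) (x - z) < 0}" by (intro open_Collect_less continuous_intros)
    then have "open W" unfolding W_def by auto
    have "W \<subseteq> \<Gamma>"
    proof
      fix x assume x: "x \<in> W"
      then have "x \<in> \<Gamma> \<union> K" using interior_subset by (auto simp: W_def)
      then show "x \<in> \<Gamma>" using left_of_tangent[of x t] x t by (auto simp: W_def)
    qed
    moreover have "negligible \<Gamma>"
    proof -
      have "negligible (\<gamma> ` UNIV)"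
      proof (rule negligible_differentiable_image_lowdim)
        show "\<gamma> differentiable_on UNIV"
          using \<gamma>_deriv unfolding differentiable_on_def
          by (meson differentiableI_vector has_vector_derivative_at_within)
      qed simp
      then show ?thesis using range_\<gamma> by simp
    qed
    ultimately have "W = {}" using open_not_negligible[OF \<open>open W\<close>] negligible_subset by blast
    define v where "v = (vector [\<gamma>' t $ 2, - \<gamma>' t $ 1] :: plane)"
    have v: "cross2 (\<gamma>' t) v < 0"
    proof -
      have "\<gamma>' t $ 1 \<noteq> 0 \<or> \<gamma>' t $ 2 \<noteq> 0" using \<gamma>'_nz[of t] by (simp add: vec_eq_iff forall_2)
      then have "(\<gamma>' t $ 1)\<^sup>2 + (\<gamma>' t $ 2)\<^sup>2 > 0" by (simp add: sum_power2_gt_zero_iff)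
      then show ?thesis by (simp add: v_def cross2_def power2_eq_square)
    qed
    obtain e where e: "e > 0" "ball z e \<subseteq> interior (\<Gamma> \<union> K)" using z open_contains_ball open_interior by blast
    define r where "r = e / (2 * (norm v + 1))"
    have r: "r > 0" "norm (r *\<^sub>R v) < e"
    proof -
      show "r > 0" using e by (simp add: r_def add_nonneg_pos)
      have nv: "norm v + 1 > 0" by (simp add: add_nonneg_pos)
      have "norm (r *\<^sub>R v) = e * (norm v / (2 * (norm v + 1)))" using e nv by (simp add: r_def)
      also have "\<dots> < e * 1" using e nv by (intro mult_strict_left_mono) (auto simp: divide_less_eq)
      finally show "norm (r *\<^sub>R v) < e" by simp
    qed
    have "z + r *\<^sub>R v \<in> W" using e r v by (auto simp: W_def dist_norm mult_less_0_iff intro!: subsetD[OF e(2)])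
    then show False using \<open>W = {}\<close> by simp
  qed
qed

lemma segment_inside: "x \<in> \<Gamma> \<union> K \<Longrightarrow> y \<in> \<Gamma> \<union> K \<Longrightarrow> x \<noteq> y \<Longrightarrow> open_segment x y \<subseteq> K"
  using sconvex unfolding strictly_convex_curve_def strictly_convex_def interior_region by blast

end

text \<open>
  With the origin inside, the gauge is finite, positive away from the origin, and its unit sphere
  is \<open>\<Gamma>\<close>.\<close>

locale billiard_table = convex_table +
  assumes zero_inside: "0 \<in> inside \<Gamma>"
begin

lemma \<gamma>_nz: "\<gamma> t \<noteq> 0"
proof
  assume "\<gamma> t = 0"
  then have "0 \<in> \<Gamma>" using \<gamma>_in[of t] by simp
  then show False using zero_inside inside_no_overlap[of \<Gamma>] by blast
qed

lemma scaled_inside: 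
  assumes "x \<in> \<Gamma> \<union> K" "0 \<le> e" "e < 1"
  shows "e *\<^sub>R x \<in> K"
proof (cases "x = 0 \<or> e = 0")
  case True
  then show ?thesis using zero_inside by auto
next
  case False
  then have "e *\<^sub>R x \<in> open_segment 0 x" using assms by (auto simp: in_segment)
  then show ?thesis using segment_inside[of 0 x] assms zero_inside False by auto
qed

text \<open>
  The ray through \<open>v\<close> leaves the bounded set \<open>K\<close> at a point of its frontier.\<close>

lemma polar: "v \<noteq> 0 \<Longrightarrow> \<exists>r t. r > 0 \<and> v = r *\<^sub>R \<gamma> t"
proof -
  assume "v \<noteq> 0"
  have "bounded K" using compact_\<Gamma> compact_imp_bounded bounded_inside by blast
  then obtain d where d: "d > 0" "0 + d *\<^sub>R v \<in> frontier K"
    using ray_to_frontier[of K 0 v] zero_inside open_K \<open>v \<noteq> 0\<close> by (metis interior_open)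
  then have "d *\<^sub>R v \<in> \<Gamma>" using frontier_inside_subset[OF compact_imp_closed[OF compact_\<Gamma>]] by auto
  then obtain t where "d *\<^sub>R v = \<gamma> t" using range_\<gamma> by blast
  moreover have "v = (1 / d) *\<^sub>R (d *\<^sub>R v)" using d by simp
  ultimately have "v = (1 / d) *\<^sub>R \<gamma> t" by simp
  then show ?thesis using d by (intro exI[of _ "1 / d"] exI[of _ t]) auto
qed

lemma gauge_polar:
  assumes "r > 0"
  shows "g (r *\<^sub>R \<gamma> t) = r"
proof -
  have "{\<rho>. 0 < \<rho> \<and> r *\<^sub>R \<gamma> t \<in> (\<lambda>y. \<rho> *\<^sub>R y) ` K} = {r<..}"
  proof (intro set_eqI iffI)
    fix \<rho> assume "\<rho> \<in> {r<..}"
    then have \<rho>: "\<rho> > r" by simp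
    have "(r / \<rho>) *\<^sub>R \<gamma> t \<in> K" using \<rho> assms by (intro scaled_inside) auto
    then show "\<rho> \<in> {\<rho>. 0 < \<rho> \<and> r *\<^sub>R \<gamma> t \<in> (\<lambda>y. \<rho> *\<^sub>R y) ` K}"
      using \<rho> assms by (auto intro!: image_eqI[of _ _ "(r / \<rho>) *\<^sub>R \<gamma> t"])
  next
    fix \<rho> assume "\<rho> \<in> {\<rho>. 0 < \<rho> \<and> r *\<^sub>R \<gamma> t \<in> (\<lambda>y. \<rho> *\<^sub>R y) ` K}"
    then obtain y where y: "\<rho> > 0" "y \<in> K" "r *\<^sub>R \<gamma> t = \<rho> *\<^sub>R y" by auto
    show "\<rho> \<in> {r<..}"
    proof (rule ccontr)
      assume "\<rho> \<notin> {r<..}"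
      then have \<rho>: "\<rho> \<le> r" by simp
      have "\<gamma> t = (1 / r) *\<^sub>R (r *\<^sub>R \<gamma> t)" using assms by simp
      then have eq: "\<gamma> t = (\<rho> / r) *\<^sub>R y" using y by simp
      have "\<gamma> t \<in> K"
      proof (cases "\<rho> = r")
        case True
        then show ?thesis using eq y assms by simp
      next
        case False
        then show ?thesis using eq scaled_inside[of y "\<rho> / r"] y assms \<rho> by simp
      qed
      then show False using \<gamma>_in inside_no_overlap[of \<Gamma>] by blast
    qed
  qed
  then show ?thesis by (simp add: gauge_fun_def)
qed

lemma gauge_\<gamma> [simp]: "g (\<gamma> t) = 1"
  using gauge_polar[of 1 t] by simp

definition width :: "real \<Rightarrow> real" where "width t = cross2 (\<gamma> t) (\<gamma>' t)"

lemma width_pos: "width t > 0"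
  using left_of_tangent[OF zero_inside, of t] cross2_swap[of "\<gamma> t" "\<gamma>' t"] by (simp add: width_def)

text \<open>
  The outer normal of \<open>\<Gamma>\<close> at \<open>\<gamma> t\<close>, scaled such that the tangent line is given by the equation
  \<open>nv t \<bullet> x = 1\<close>.\<close>

definition nv :: "real \<Rightarrow> plane" where
  "nv t = (1 / width t) *\<^sub>R vector [\<gamma>' t $ 2, - \<gamma>' t $ 1]"

lemma nv_inner: "nv t \<bullet> x = cross2 x (\<gamma>' t) / width t"
  by (simp add: nv_def cross2_inner)

lemma nv_\<gamma> [simp]: "nv t \<bullet> \<gamma> t = 1"
  using width_pos[of t] by (simp add: nv_inner width_def[symmetric])

lemma nv_\<gamma>' [simp]: "nv t \<bullet> \<gamma>' t = 0"
  by (simp add: nv_inner)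

lemma nv_less_K: "x \<in> K \<Longrightarrow> nv t \<bullet> x < 1"
proof -
  assume "x \<in> K"
  then have "cross2 x (\<gamma>' t) < width t"
    using left_of_tangent[of x t] cross2_swap[of "\<gamma>' t" x] cross2_swap[of "\<gamma>' t" "\<gamma> t"] by (simp add: width_def)
  then show ?thesis using width_pos[of t] by (simp add: nv_inner)
qed

lemma nv_less: "\<gamma> s \<noteq> \<gamma> t \<Longrightarrow> nv t \<bullet> \<gamma> s < 1"
proof -
  assume "\<gamma> s \<noteq> \<gamma> t"
  then have "midpoint (\<gamma> s) (\<gamma> t) \<in> K" using segment_inside[of "\<gamma> s" "\<gamma> t"] by auto
  then show ?thesis using nv_less_K[of "midpoint (\<gamma> s) (\<gamma> t)" t] by (simp add: midpoint_def inner_add_right)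
qed

lemma nv_shift: "nv (t + of_int m * P) = nv t"
  by (simp add: nv_def width_def \<gamma>'_shift \<gamma>_shift_int)

lemma nv_cont: "continuous_on UNIV nv"
proof -
  have "continuous_on UNIV width" unfolding width_def by (intro continuous_intros \<gamma>_cont \<gamma>'_cont)
  moreover have "continuous_on UNIV (\<lambda>t. vector [\<gamma>' t $ 2, - \<gamma>' t $ 1] :: plane)"
  proof -
    have "(\<lambda>t. vector [\<gamma>' t $ 2, - \<gamma>' t $ 1] :: plane) = (\<lambda>t. \<chi> i. if i = 1 then \<gamma>' t $ 2 else - \<gamma>' t $ 1)"
      by (auto simp: vec_eq_iff forall_2)
    moreover have "continuous_on UNIV (\<lambda>t. (\<chi> i. if i = 1 then \<gamma>' t $ 2 else - \<gamma>' t $ 1) :: plane)"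
    proof (rule continuous_on_vec_lambda)
      show "continuous_on UNIV (\<lambda>t. if i = 1 then \<gamma>' t $ 2 else - \<gamma>' t $ 1)" for i :: 2
        by (cases "i = 1") (auto intro!: continuous_intros \<gamma>'_cont)
    qed
    ultimately show ?thesis by (simp only:)
  qed
  ultimately show ?thesis unfolding nv_def using width_pos by (intro continuous_intros) (auto simp: less_le)
qed

text \<open>
  The normal at the point of \<open>\<Gamma>\<close> on the ray through \<open>v\<close>. It is the gradient of the gauge
  (\<open>gauge_deriv\<close>); the choice of the parameter does not matter since \<open>nv\<close> has period \<open>P\<close>.\<close>

definition N :: "plane \<Rightarrow> plane" where
  "N v = nv (SOME t. \<exists>r>0. v = r *\<^sub>R \<gamma> t)"

lemma N_polar:
  assumes "r > 0"
  shows "N (r *\<^sub>R \<gamma> t) = nv t"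
proof -
  define s where "s = (SOME s. \<exists>\<rho>>0. r *\<^sub>R \<gamma> t = \<rho> *\<^sub>R \<gamma> s)"
  have "\<exists>\<rho>>0. r *\<^sub>R \<gamma> t = \<rho> *\<^sub>R \<gamma> s" unfolding s_def by (rule someI[of _ t]) (use assms in auto)
  then obtain \<rho> where \<rho>: "\<rho> > 0" "r *\<^sub>R \<gamma> t = \<rho> *\<^sub>R \<gamma> s" by blast
  then have "\<rho> = r" using gauge_polar[OF assms, of t] gauge_polar[OF \<rho>(1), of s] by simp
  then have "\<gamma> s = \<gamma> t" using \<rho> assms by simp
  then obtain m :: int where "s = t + of_int m * P" using \<gamma>_eq_iff by blast
  then show ?thesis unfolding N_def s_def[symmetric] by (simp add: nv_shift)
qed

lemma N_self: "v \<noteq> 0 \<Longrightarrow> N v \<bullet> v = g v"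
  using polar[of v] by (auto simp: N_polar gauge_polar)

lemma N_scale: "r > 0 \<Longrightarrow> N (r *\<^sub>R v) = N v"
proof (cases "v = 0")
  case False
  assume "r > 0"
  obtain \<rho> t where "\<rho> > 0" "v = \<rho> *\<^sub>R \<gamma> t" using polar[OF False] by blast
  then show ?thesis using N_polar[of "r * \<rho>" t] N_polar[of \<rho> t] \<open>r > 0\<close> by simp
qed simp

lemma gauge_pos: "v \<noteq> 0 \<Longrightarrow> g v > 0"
  using polar[of v] by (auto simp: gauge_polar)

text \<open>
  The strict form of the supporting hyperplane inequality: a tangent line touches a strictly
  convex curve in one point.\<close>

lemma N_less:
  assumes "v \<noteq> 0" "w \<noteq> 0" "\<And>r. r > 0 \<Longrightarrow> w \<noteq> r *\<^sub>R v"
  shows "N v \<bullet> w < g w"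
proof -
  obtain r t where v: "r > 0" "v = r *\<^sub>R \<gamma> t" using polar[OF assms(1)] by blast
  obtain \<rho> s where w: "\<rho> > 0" "w = \<rho> *\<^sub>R \<gamma> s" using polar[OF assms(2)] by blast
  have "\<gamma> s \<noteq> \<gamma> t"
  proof
    assume "\<gamma> s = \<gamma> t"
    then have "w = (\<rho> / r) *\<^sub>R v" using v w by simp
    then show False using assms(3)[of "\<rho> / r"] v w by simp
  qed
  then have "\<rho> * (nv t \<bullet> \<gamma> s) < \<rho> * 1" using nv_less w by (intro mult_strict_left_mono) auto
  then show ?thesis using v w by (simp add: N_polar gauge_polar)
qed

lemma gauge_0 [simp]: "g 0 = 0"
proof -
  have "{\<rho>. 0 < \<rho> \<and> (0::plane) \<in> (\<lambda>y. \<rho> *\<^sub>R y) ` K} = {0<..}"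
    using zero_inside by (auto intro!: image_eqI[of _ _ 0])
  then show ?thesis by (simp add: gauge_fun_def)
qed

lemma gauge_scale: "r > 0 \<Longrightarrow> g (r *\<^sub>R v) = r * g v"
proof (cases "v = 0")
  case False
  assume "r > 0"
  obtain \<rho> t where "\<rho> > 0" "v = \<rho> *\<^sub>R \<gamma> t" using polar[OF False] by blast
  then show ?thesis using gauge_polar[of "r * \<rho>" t] gauge_polar[of \<rho> t] \<open>r > 0\<close> by simp
qed simp

lemma N_le: "v \<noteq> 0 \<Longrightarrow> N v \<bullet> w \<le> g w"
proof (cases "w = 0 \<or> (\<exists>r>0. w = r *\<^sub>R v)")
  case True
  assume "v \<noteq> 0"
  with True show ?thesis by (auto simp: N_self gauge_scale)
next
  case False
  assume "v \<noteq> 0"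
  then show ?thesis using N_less[of v w] False by force
qed

lemma nv_bounded: "\<exists>C>0. \<forall>t. norm (nv t) \<le> C"
proof -
  have "bounded (nv ` {0..P})" by (intro compact_imp_bounded compact_continuous_image continuous_on_subset[OF nv_cont]) auto
  then obtain C where C: "C > 0" "\<And>t. t \<in> {0..P} \<Longrightarrow> norm (nv t) \<le> C" unfolding bounded_pos by blast
  have "norm (nv t) \<le> C" for t
  proof -
    obtain m :: int where "0 \<le> t + of_int m * P" "t + of_int m * P < 0 + P" using reduce_mod by blast
    then show ?thesis using C(2)[of "t + of_int m * P"] nv_shift by simp
  qed
  then show ?thesis using C by blast
qed

lemma gauge_lipschitz: "\<exists>C>0. \<forall>v w. \<bar>g v - g w\<bar> \<le> C * norm (v - w)"
proof -
  obtain C where C: "C > 0" "\<And>t. norm (nv t) \<le> C" using nv_bounded by blast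
  have *: "g v - g w \<le> C * norm (v - w)" if nz: "v \<noteq> 0" for v w
  proof -
    obtain r t where v: "r > 0" "v = r *\<^sub>R \<gamma> t" using polar[OF nz] by blast
    have "g v = N v \<bullet> w + N v \<bullet> (v - w)" using N_self[OF nz] by (simp add: inner_diff_right)
    also have "\<dots> \<le> g w + norm (N v) * norm (v - w)"
      using N_le[OF nz, of w] norm_cauchy_schwarz[of "N v" "v - w"] by linarith
    also have "\<dots> \<le> g w + C * norm (v - w)" using C v by (auto simp: N_polar intro!: mult_right_mono)
    finally show ?thesis by simp
  qed
  have gn: "g v \<ge> 0" for v using gauge_pos[of v] by (cases "v = 0") auto
  have **: "g v - g w \<le> C * norm (v - w)" for v w
  proof (cases "v = 0")
    case True
    moreover have "0 \<le> C * norm (v - w)" using C(1) by simp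
    moreover have "g v = 0" using True by simp
    ultimately show ?thesis using gn[of w] by linarith
  qed (rule *)
  have "\<bar>g v - g w\<bar> \<le> C * norm (v - w)" for v w
    using **[of v w] **[of w v] by (simp add: norm_minus_commute abs_le_iff)
  then show ?thesis using C by blast
qed

lemma gauge_cont: "continuous_on S g"
proof -
  obtain C where C: "C > 0" "\<And>v w. \<bar>g v - g w\<bar> \<le> C * norm (v - w)" using gauge_lipschitz by blast
  show ?thesis
  proof (rule continuous_on_subset[of UNIV], rule lipschitz_on_continuous_on)
    show "C-lipschitz_on UNIV g" using C by (intro lipschitz_onI) (auto simp: dist_norm)
  qed simp
qed

text \<open>
  On \<open>\<Gamma>\<close>, \<open>N\<close> is continuous because its graph is the compact image of \<open>t \<mapsto> (\<gamma> t, nv t)\<close>; elsewhere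
  it is homogeneous of degree zero.\<close>

lemma N_cont: "continuous_on (- {0}) N"
proof -
  have 1: "continuous_on \<Gamma> N"
  proof (rule continuous_from_closed_graph)
    show "compact (nv ` {0..P})" by (intro compact_continuous_image continuous_on_subset[OF nv_cont]) auto
    have img: "(\<lambda>x. Pair x (N x)) ` \<Gamma> = (\<lambda>t. (\<gamma> t, nv t)) ` {0..P}"
      using \<Gamma>_image[of 0] N_polar[of 1] by (force simp: image_image)
    show "N \<in> \<Gamma> \<rightarrow> nv ` {0..P}" using \<Gamma>_image[of 0] N_polar[of 1] by force
    have "compact ((\<lambda>t. (\<gamma> t, nv t)) ` {0..P})"
      by (intro compact_continuous_image continuous_on_Pair \<gamma>_cont continuous_on_subset[OF nv_cont]) auto
    then show "closed ((\<lambda>x. Pair x (N x)) ` \<Gamma>)" unfolding img by (rule compact_imp_closed)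
  qed
  have "continuous_on (- {0}) (\<lambda>v. N ((1 / g v) *\<^sub>R v))"
  proof (rule continuous_on_compose2[OF 1])
    show "continuous_on (- {0}) (\<lambda>v. (1 / g v) *\<^sub>R v)"
      using gauge_pos by (intro continuous_intros gauge_cont) force
    show "(\<lambda>v. (1 / g v) *\<^sub>R v) ` (- {0}) \<subseteq> \<Gamma>" using polar by (force simp: gauge_polar)
  qed
  then show ?thesis
    by (rule continuous_on_eq) (use N_scale gauge_pos in auto)
qed

lemma N_isCont:
  assumes "v \<noteq> 0"
  shows "isCont N v"
proof -
  have "open (- {0 :: plane})" by auto
  from continuous_on_eq_continuous_at[OF this, of N] show ?thesis using N_cont assms by auto
qed

text \<open>
  The supporting hyperplane inequality at \<open>v\<close> bounds the increment of the gauge from below by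
  \<open>N v \<bullet> (y - v)\<close>, and at \<open>y\<close> it bounds it from above by \<open>N y \<bullet> (y - v)\<close>. The two bounds differ
  little by the continuity of \<open>N\<close>.\<close>

lemma gauge_deriv:
  assumes "v \<noteq> 0"
  shows "(g has_derivative (\<lambda>w. N v \<bullet> w)) (at v)"
  unfolding has_derivative_at_alt
proof (intro conjI allI impI)
  show "bounded_linear ((\<bullet>) (N v))" by (rule bounded_linear_inner_right)
  fix e :: real assume "e > 0"
  have "isCont N v" by (rule N_isCont[OF assms])
  then obtain d where d: "d > 0" "\<And>y. dist y v < d \<Longrightarrow> dist (N y) (N v) < e"
    using \<open>e > 0\<close> unfolding continuous_at_eps_delta by blast
  show "\<exists>d>0. \<forall>y. norm (y - v) < d \<longrightarrow> norm (g y - g v - N v \<bullet> (y - v)) \<le> e * norm (y - v)"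
  proof (intro exI[of _ "min d (norm v)"] conjI allI impI)
    show "min d (norm v) > 0" using d assms by simp
    fix y assume y: "norm (y - v) < min d (norm v)"
    then have "y \<noteq> 0" by auto
    have lo: "g v + N v \<bullet> (y - v) \<le> g y" using N_le[OF assms, of y] N_self[OF assms] by (simp add: inner_diff_right)
    have "g y = N y \<bullet> v + N y \<bullet> (y - v)" using N_self[OF \<open>y \<noteq> 0\<close>] by (simp add: inner_diff_right)
    also have "\<dots> \<le> g v + N y \<bullet> (y - v)" using N_le[OF \<open>y \<noteq> 0\<close>, of v] by simp
    finally have "g y - g v - N v \<bullet> (y - v) \<le> (N y - N v) \<bullet> (y - v)" by (simp add: inner_diff_left)
    also have "\<dots> \<le> norm (N y - N v) * norm (y - v)" by (rule norm_cauchy_schwarz)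
    also have "\<dots> \<le> e * norm (y - v)" using d(2)[of y] y by (intro mult_right_mono) (auto simp: dist_norm)
    finally show "norm (g y - g v - N v \<bullet> (y - v)) \<le> e * norm (y - v)" using lo by simp
  qed
qed

text \<open>
  The gradient of a convex function is monotone, and here strictly so: if \<open>v\<close> is turned away from
  \<open>e\<close>, then the derivative of the gauge in the direction \<open>e\<close> decreases.\<close>

lemma N_rotate:
  assumes "cross2 e v \<noteq> 0" "\<alpha> > 0" "\<beta> > 0" "w = \<alpha> *\<^sub>R v - \<beta> *\<^sub>R e"
  shows "N w \<bullet> e < N v \<bullet> e"
proof -
  define w' where "w' = v - (\<beta> / \<alpha>) *\<^sub>R e"
  have w: "w = \<alpha> *\<^sub>R w'" using assms by (simp add: w'_def scaleR_diff_right)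
  have cr: "cross2 v w' \<noteq> 0" using assms cross2_swap[of v e] by (simp add: w'_def)
  have "v \<noteq> 0" "w' \<noteq> 0" using cr by auto
  have "N v \<bullet> w' < g w'" using cr by (intro N_less \<open>v \<noteq> 0\<close> \<open>w' \<noteq> 0\<close>) auto
  moreover have "N w \<bullet> w' = g w'" using N_self[OF \<open>w' \<noteq> 0\<close>] N_scale assms(2) w by simp
  moreover have "N w \<bullet> v \<le> N v \<bullet> v" using N_le[of w' v] \<open>w' \<noteq> 0\<close> N_self[OF \<open>v \<noteq> 0\<close>] N_scale assms(2) w by simp
  ultimately have "(\<beta> / \<alpha>) * (N w \<bullet> e) < (\<beta> / \<alpha>) * (N v \<bullet> e)" by (simp add: w'_def inner_diff_right)
  moreover have "\<beta> / \<alpha> > 0" using assms(2,3) by simp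
  ultimately show ?thesis using mult_less_cancel_left_pos by blast
qed

end

section \<open>Chords and the reflection law\<close>

context billiard_table
begin

lemma chord_left: "t < y \<Longrightarrow> y < t + P \<Longrightarrow> cross2 (\<gamma>' t) (\<gamma> y - \<gamma> t) > 0"
proof -
  assume "t < y" "y < t + P"
  then have "cross2 (\<gamma> y) (\<gamma>' t) < width t"
    using nv_less[OF \<gamma>_neq, of t y] width_pos[of t] by (simp add: nv_inner)
  then show ?thesis
    using cross2_swap[of "\<gamma>' t" "\<gamma> y"] cross2_swap[of "\<gamma>' t" "\<gamma> t"] by (simp add: width_def)
qed

lemma chord_right:
  assumes "t < y" "y < t + P"
  shows "cross2 (\<gamma>' y) (\<gamma> y - \<gamma> t) < 0"
  using chord_left[of y "t + P"] assms by (simp add: \<gamma>_shift)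

text \<open>
  Relative to the tangent \<open>e\<close> at \<open>\<gamma> t\<close>, the slope \<open>\<rho> s\<close> of the chord from \<open>\<gamma> t\<close> to \<open>\<gamma> s\<close> increases
  with \<open>s\<close>: by the Pluecker relation the sign of its derivative is the one that \<open>chord_right\<close>
  gives.\<close>

lemma positively_oriented:
  assumes "t < y" "y < z" "z < t + P"
  shows "cross2 (\<gamma> y - \<gamma> t) (\<gamma> z - \<gamma> t) > 0"
proof -
  define e where "e = \<gamma>' t"
  \<comment> \<open>the left normal of \<open>e\<close>; only \<open>cross2 a e < 0\<close> matters\<close>
  define a where "a = (vector [- e $ 2, e $ 1] :: plane)"
  define v where "v s = \<gamma> s - \<gamma> t" for s
  have ev: "cross2 e (v s) > 0" if "t < s" "s < t + P" for s
    using chord_left that by (simp add: e_def v_def)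
  have ae: "cross2 a e < 0"
  proof -
    have "e $ 1 \<noteq> 0 \<or> e $ 2 \<noteq> 0" using \<gamma>'_nz[of t] by (simp add: e_def vec_eq_iff forall_2)
    then have "(e $ 1)\<^sup>2 + (e $ 2)\<^sup>2 > 0" by (simp add: sum_power2_gt_zero_iff)
    then show ?thesis by (simp add: a_def cross2_def power2_eq_square)
  qed
  have vd: "(v has_vector_derivative \<gamma>' s) (at s)" for s
    unfolding v_def by (auto intro!: derivative_eq_intros \<gamma>_deriv)
  have cd: "((\<lambda>s. cross2 b (v s)) has_real_derivative cross2 b (\<gamma>' s)) (at s)" for b s
  proof -
    have bl: "bounded_linear (cross2 b)"
      unfolding cross2_def by (intro bounded_linear_intros bounded_linear_vec_nth)
    show ?thesis using bounded_linear.has_vector_derivative[OF bl vd[of s]]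
      by (simp add: has_real_derivative_iff_has_vector_derivative)
  qed
  define \<rho> where "\<rho> s = cross2 a (v s) / cross2 e (v s)" for s
  have "\<rho> y < \<rho> z"
  proof (rule DERIV_pos_imp_increasing[OF \<open>y < z\<close>])
    fix s assume "y \<le> s" "s \<le> z"
    then have s: "t < s" "s < t + P" using assms by auto
    have "(\<rho> has_real_derivative
        (cross2 a (\<gamma>' s) * cross2 e (v s) - cross2 a (v s) * cross2 e (\<gamma>' s)) / (cross2 e (v s) * cross2 e (v s))) (at s)"
      unfolding \<rho>_def using ev[OF s] by (intro DERIV_divide cd) auto
    moreover have "cross2 a (\<gamma>' s) * cross2 e (v s) - cross2 a (v s) * cross2 e (\<gamma>' s) > 0"
      unfolding cross2_pluecker using ae chord_right[OF s] by (simp add: v_def mult_neg_neg)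
    ultimately show "\<exists>d. (\<rho> has_real_derivative d) (at s) \<and> d > 0" using ev[OF s] by force
  qed
  then have "cross2 a (v y) * cross2 e (v z) < cross2 a (v z) * cross2 e (v y)"
    using ev[of y] ev[of z] assms by (simp add: \<rho>_def field_simps)
  then have "cross2 a e * cross2 (v z) (v y) > 0"
    using cross2_pluecker[of a "v z" e "v y"] by simp
  then have "cross2 (v z) (v y) < 0" using ae by (simp add: zero_less_mult_iff)
  then show ?thesis using cross2_swap[of "v y" "v z"] by (simp add: v_def)
qed

text \<open>
  The generating function and, by \<open>gauge_chord_deriv1\<close> and \<open>gauge_chord_deriv2\<close>, its two partial
  derivatives.\<close>

definition L :: "real \<Rightarrow> real \<Rightarrow> real" where "L t y = g (\<gamma> y - \<gamma> t)"
definition L1 :: "real \<Rightarrow> real \<Rightarrow> real" where "L1 t y = - (N (\<gamma> y - \<gamma> t) \<bullet> \<gamma>' t)"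
definition L2 :: "real \<Rightarrow> real \<Rightarrow> real" where "L2 t y = N (\<gamma> y - \<gamma> t) \<bullet> \<gamma>' y"

lemma gauge_chain:
  assumes "(v has_vector_derivative w) (at t)" "v t \<noteq> 0"
  shows "((\<lambda>\<tau>. g (v \<tau>)) has_real_derivative N (v t) \<bullet> w) (at t)"
proof -
  have "((g \<circ> v) has_derivative ((\<lambda>w. N (v t) \<bullet> w) \<circ> (\<lambda>x. x *\<^sub>R w))) (at t)"
    using assms by (intro diff_chain_at gauge_deriv) (simp_all add: has_vector_derivative_def)
  moreover have "(\<lambda>w. N (v t) \<bullet> w) \<circ> (\<lambda>x. x *\<^sub>R w) = (*) (N (v t) \<bullet> w)" by (auto simp: fun_eq_iff)
  ultimately show ?thesis by (simp only: has_field_derivative_def) (simp only: o_def)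
qed

lemma gauge_chord_deriv2:
  assumes "\<gamma> y \<noteq> \<gamma> t"
  shows "((\<lambda>\<tau>. g (\<gamma> \<tau> - \<gamma> t)) has_real_derivative L2 t y) (at y)"
  unfolding L2_def by (rule gauge_chain) (use assms in \<open>auto intro!: derivative_eq_intros \<gamma>_deriv\<close>)

lemma gauge_chord_deriv1:
  assumes "\<gamma> y \<noteq> \<gamma> t"
  shows "((\<lambda>\<tau>. g (\<gamma> y - \<gamma> \<tau>)) has_real_derivative L1 t y) (at t)"
proof -
  have "((\<lambda>\<tau>. g (\<gamma> y - \<gamma> \<tau>)) has_real_derivative N (\<gamma> y - \<gamma> t) \<bullet> (- \<gamma>' t)) (at t)"
    by (rule gauge_chain) (use assms in \<open>auto intro!: derivative_eq_intros \<gamma>_deriv\<close>)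
  then show ?thesis by (simp add: L1_def)
qed

lemma L1_shift_int: "L1 (t + of_int m * P) (y + of_int n * P) = L1 t y"
  and L2_shift_int: "L2 (t + of_int m * P) (y + of_int n * P) = L2 t y"
  by (simp_all add: L1_def L2_def \<gamma>_shift_int \<gamma>'_shift)

lemma chord_cont: "continuous_on {(t, y). t < y \<and> y < t + P} (\<lambda>q. N (\<gamma> (snd q) - \<gamma> (fst q)))"
  by (rule continuous_on_compose2[OF N_cont])
    (use \<gamma>_neq in \<open>auto intro!: continuous_intros continuous_on_compose2[OF \<gamma>_cont[of UNIV]]\<close>)

text \<open>
  As the end point of the chord moves on, the chord turns away from the tangent at its starting
  point.\<close>

lemma L1_mono:
  assumes "t < y" "y < z" "z < t + P"
  shows "L1 t y < L1 t z"
proof -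
  define e where "e = \<gamma>' t"
  define v where "v = \<gamma> y - \<gamma> t"
  define w where "w = \<gamma> z - \<gamma> t"
  have ev: "cross2 e v > 0" "cross2 e w > 0" "cross2 v w > 0"
    using chord_left[of t] positively_oriented assms by (simp_all add: e_def v_def w_def)
  have "N w \<bullet> e < N v \<bullet> e"
    by (rule N_rotate[OF _ _ _ plane_expand]) (use ev in auto)
  then show ?thesis by (simp add: L1_def e_def v_def w_def)
qed

lemma L2_mono:
  assumes "y < t + P" "t < s" "s < y"
  shows "L2 t y < L2 s y"
proof -
  define e where "e = \<gamma>' y"
  define v where "v = \<gamma> y - \<gamma> s"
  define w where "w = \<gamma> y - \<gamma> t"
  have ev: "cross2 e v < 0" "cross2 e w < 0"
    using chord_right[of s y] chord_right[of t y] assms by (simp_all add: e_def v_def w_def)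
  define a where "a = \<gamma> s - \<gamma> t"
  have "cross2 a w > 0" using positively_oriented assms unfolding a_def w_def by blast
  moreover have "v = w - a" by (simp add: v_def w_def a_def)
  ultimately have "cross2 v w < 0" by simp
  then have "N w \<bullet> e < N v \<bullet> e"
    using ev by (intro N_rotate[OF _ _ _ plane_expand]) (auto intro: divide_neg_neg)
  then show ?thesis by (simp add: L2_def e_def v_def w_def)
qed

text \<open>
  The gradient of the gauge is homogeneous of degree zero, so that its value on a chord is its
  value on a difference quotient, and difference quotients converge to the tangent vector.\<close>

lemma N_tangent_limits:
  shows "((\<lambda>z. N (\<gamma> z - \<gamma> y)) \<longlongrightarrow> N (\<gamma>' y)) (at_right y)"
    and "((\<lambda>z. N (\<gamma> z - \<gamma> y)) \<longlongrightarrow> N (- \<gamma>' y)) (at_left y)"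
proof -
  define w where "w z = (1 / (z - y)) *\<^sub>R (\<gamma> z - \<gamma> y)" for z
  have lim: "(w \<longlongrightarrow> \<gamma>' y) (at y within S)" for S
  proof -
    have "((\<lambda>z. (1 / norm (z - y)) *\<^sub>R (\<gamma> z - (\<gamma> y + (z - y) *\<^sub>R \<gamma>' y))) \<longlongrightarrow> 0) (at y within S)"
      using has_vector_derivative_at_within[OF \<gamma>_deriv, of y S]
      by (simp add: has_vector_derivative_def has_derivative_within)
    then have "((\<lambda>z. norm ((1 / norm (z - y)) *\<^sub>R (\<gamma> z - (\<gamma> y + (z - y) *\<^sub>R \<gamma>' y)))) \<longlongrightarrow> 0) (at y within S)"
      by (rule tendsto_norm_zero)
    then have "((\<lambda>z. norm (w z - \<gamma>' y)) \<longlongrightarrow> 0) (at y within S)"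
    proof (rule Lim_transform_eventually)
      have "norm ((1 / norm (z - y)) *\<^sub>R (\<gamma> z - (\<gamma> y + (z - y) *\<^sub>R \<gamma>' y))) = norm (w z - \<gamma>' y)" if "z \<noteq> y" for z
      proof -
        have "w z - \<gamma>' y = (1 / (z - y)) *\<^sub>R (\<gamma> z - (\<gamma> y + (z - y) *\<^sub>R \<gamma>' y))"
          using that by (simp add: w_def scaleR_diff_right scaleR_add_right)
        then show ?thesis by simp
      qed
      then show "\<forall>\<^sub>F z in at y within S. norm ((1 / norm (z - y)) *\<^sub>R (\<gamma> z - (\<gamma> y + (z - y) *\<^sub>R \<gamma>' y))) = norm (w z - \<gamma>' y)"
        by (auto simp: eventually_at_filter)
    qed
    then show ?thesis using Lim_null tendsto_norm_zero_iff by blast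
  qed
  have lp: "((\<lambda>z. N (w z)) \<longlongrightarrow> N (\<gamma>' y)) (at y within S)" for S
    by (rule isCont_tendsto_compose[OF N_isCont[OF \<gamma>'_nz] lim])
  have lm: "((\<lambda>z. N (- w z)) \<longlongrightarrow> N (- \<gamma>' y)) (at y within S)" for S
    by (rule isCont_tendsto_compose[OF N_isCont]) (use \<gamma>'_nz in \<open>auto intro!: tendsto_minus lim\<close>)
  have right: "N (w z) = N (\<gamma> z - \<gamma> y)" if "z > y" for z
    using that N_scale[of "1 / (z - y)" "\<gamma> z - \<gamma> y"] by (simp add: w_def)
  have left: "N (- w z) = N (\<gamma> z - \<gamma> y)" if "z < y" for z
  proof -
    have "- w z = (- (1 / (z - y))) *\<^sub>R (\<gamma> z - \<gamma> y)" unfolding w_def by (rule scaleR_minus_left[symmetric])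
    moreover have "- (1 / (z - y)) > 0" using that by simp
    ultimately show ?thesis using N_scale by metis
  qed
  show "((\<lambda>z. N (\<gamma> z - \<gamma> y)) \<longlongrightarrow> N (\<gamma>' y)) (at_right y)"
    by (rule Lim_transform_eventually[OF lp]) (use right in \<open>auto simp: eventually_at_filter\<close>)
  show "((\<lambda>z. N (\<gamma> z - \<gamma> y)) \<longlongrightarrow> N (- \<gamma>' y)) (at_left y)"
    by (rule Lim_transform_eventually[OF lm]) (use left in \<open>auto simp: eventually_at_filter\<close>)
qed

lemma value_between_end_limits:
  fixes h :: "real \<Rightarrow> real"
  assumes ab: "a < b" and cont: "continuous_on {a<..<b} h"
    and lo: "(h \<longlongrightarrow> l) (at_right a)" and hi: "(h \<longlongrightarrow> u) (at_left b)"
    and c: "l < c \<and> c < u \<or> u < c \<and> c < l"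
  shows "\<exists>z. a < z \<and> z < b \<and> h z = c"
proof -
  have r: "\<forall>\<^sub>F z in at_right a. z \<in> {a<..<b}" using ab by (intro eventually_at_right_real)
  have l: "\<forall>\<^sub>F z in at_left b. z \<in> {a<..<b}" using ab by (intro eventually_at_left_real)
  have ivt: "\<exists>z. a < z \<and> z < b \<and> h z = c" if "p \<in> {a<..<b}" "q \<in> {a<..<b}" "h p < c" "c < h q" for p q
  proof -
    have "connected (h ` {a<..<b})" using cont by (intro connected_continuous_image) auto
    moreover have "h p \<in> h ` {a<..<b}" "h q \<in> h ` {a<..<b}" using that(1,2) by blast+
    ultimately have "c \<in> h ` {a<..<b}" using that(3,4) connectedD_interval[of "h ` {a<..<b}" "h p" "h q" c] by simp
    then show ?thesis by auto
  qed
  show ?thesis using c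
  proof
    assume c: "l < c \<and> c < u"
    obtain p where p: "p \<in> {a<..<b}" "h p < c"
      using eventually_happens[OF eventually_conj[OF r order_tendstoD(2)[OF lo, of c]]] c by (auto simp: trivial_limit_at_right_real)
    obtain q where q: "q \<in> {a<..<b}" "c < h q"
      using eventually_happens[OF eventually_conj[OF l order_tendstoD(1)[OF hi, of c]]] c by (auto simp: trivial_limit_at_left_real)
    show ?thesis using ivt p q by blast
  next
    assume c: "u < c \<and> c < l"
    obtain p where p: "p \<in> {a<..<b}" "c < h p"
      using eventually_happens[OF eventually_conj[OF r order_tendstoD(1)[OF lo, of c]]] c by (auto simp: trivial_limit_at_right_real)
    obtain q where q: "q \<in> {a<..<b}" "h q < c"
      using eventually_happens[OF eventually_conj[OF l order_tendstoD(2)[OF hi, of c]]] c by (auto simp: trivial_limit_at_left_real)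
    show ?thesis using ivt p q by blast
  qed
qed

lemma N_tangent_range:
  assumes "cross2 (\<gamma>' y) v \<noteq> 0"
  shows "- g (- \<gamma>' y) < N v \<bullet> \<gamma>' y" "N v \<bullet> \<gamma>' y < 1"
proof -
  have "v \<noteq> 0" using assms by auto
  have "N v \<bullet> \<gamma>' y < g (\<gamma>' y)"
    by (rule N_less) (use assms \<gamma>'_nz \<open>v \<noteq> 0\<close> in auto)
  then show "N v \<bullet> \<gamma>' y < 1" by (simp add: gauge_\<gamma>')
  have "- \<gamma>' y \<noteq> r *\<^sub>R v" if "r > 0" for r
  proof
    assume *: "- \<gamma>' y = r *\<^sub>R v"
    have "cross2 (\<gamma>' y) (r *\<^sub>R v) = 0" unfolding *[symmetric] by simp
    then show False using assms that by simp
  qed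
  then have "N v \<bullet> (- \<gamma>' y) < g (- \<gamma>' y)" using \<gamma>'_nz \<open>v \<noteq> 0\<close> by (intro N_less) auto
  then show "- g (- \<gamma>' y) < N v \<bullet> \<gamma>' y" by simp
qed

text \<open>
  As \<open>z\<close> runs from \<open>y\<close> to \<open>y + P\<close>, the derivative of the gauge of the chord in the direction
  \<open>\<gamma>' y\<close> runs from \<open>g (\<gamma>' y)\<close> to \<open>- g (- \<gamma>' y)\<close>, the extreme values that it can have; the incoming
  chord has a value strictly between them.\<close>

lemma reflect_forward:
  assumes "t < y" "y < t + P"
  shows "\<exists>z. y < z \<and> z < y + P \<and> L1 y z = - L2 t y"
proof -
  have "\<exists>z. y < z \<and> z < y + P \<and> N (\<gamma> z - \<gamma> y) \<bullet> \<gamma>' y = L2 t y"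
  proof (rule value_between_end_limits)
    show "y < y + P" using P_pos by simp
    show "continuous_on {y<..<y + P} (\<lambda>z. N (\<gamma> z - \<gamma> y) \<bullet> \<gamma>' y)"
      by (intro continuous_intros continuous_on_compose2[OF N_cont]) (use \<gamma>_neq in \<open>auto intro!: continuous_intros \<gamma>_cont\<close>)
    show "((\<lambda>z. N (\<gamma> z - \<gamma> y) \<bullet> \<gamma>' y) \<longlongrightarrow> N (\<gamma>' y) \<bullet> \<gamma>' y) (at_right y)"
      by (intro tendsto_intros N_tangent_limits)
    show "((\<lambda>z. N (\<gamma> z - \<gamma> y) \<bullet> \<gamma>' y) \<longlongrightarrow> N (- \<gamma>' y) \<bullet> \<gamma>' y) (at_left (y + P))"
      using N_tangent_limits(2)[of "y + P"] \<gamma>'_shift[of y 1] by (auto intro!: tendsto_intros simp: \<gamma>_shift)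
    have "N (\<gamma>' y) \<bullet> \<gamma>' y = 1" using N_self[OF \<gamma>'_nz] gauge_\<gamma>' by simp
    moreover have "N (- \<gamma>' y) \<bullet> \<gamma>' y = - g (- \<gamma>' y)" using N_self[of "- \<gamma>' y"] \<gamma>'_nz by simp
    ultimately show "N (\<gamma>' y) \<bullet> \<gamma>' y < L2 t y \<and> L2 t y < N (- \<gamma>' y) \<bullet> \<gamma>' y \<or>
        N (- \<gamma>' y) \<bullet> \<gamma>' y < L2 t y \<and> L2 t y < N (\<gamma>' y) \<bullet> \<gamma>' y"
      using N_tangent_range[of y "\<gamma> y - \<gamma> t"] chord_right[OF assms] by (simp add: L2_def)
  qed
  then show ?thesis by (simp add: L1_def)
qed

theorem twist: "\<exists>\<kappa>. twist_map P \<kappa> L L1 L2"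
proof -
  obtain C where C: "C > 0" "\<And>t. norm (nv t) \<le> C" using nv_bounded by blast
  have "bounded (\<gamma>' ` {0..P})" by (intro compact_imp_bounded compact_continuous_image continuous_on_subset[OF \<gamma>'_cont]) auto
  then obtain D where D: "D > 0" "\<And>t. t \<in> {0..P} \<Longrightarrow> norm (\<gamma>' t) \<le> D" unfolding bounded_pos by blast
  have D': "norm (\<gamma>' t) \<le> D" for t
  proof -
    obtain m :: int where "0 \<le> t + of_int m * P" "t + of_int m * P < 0 + P" using reduce_mod by blast
    then show ?thesis using D(2)[of "t + of_int m * P"] \<gamma>'_shift by simp
  qed
  have NC: "norm (N v) \<le> C" if nz: "v \<noteq> 0" for v
    using polar[OF nz] C(2) by (auto simp: N_polar)
  have "twist_map P (C * D) L L1 L2"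
  proof
    show "P > 0" by (rule P_pos)
    show "((\<lambda>\<tau>. L \<tau> y) has_real_derivative L1 t y) (at t)" if "t < y" "y < t + P" for t y
      unfolding L_def using \<gamma>_neq[OF that] by (rule gauge_chord_deriv1)
    show "(L t has_real_derivative L2 t y) (at y)" if "t < y" "y < t + P" for t y
      unfolding L_def[abs_def] using \<gamma>_neq[OF that] by (rule gauge_chord_deriv2)
    show "continuous_on {(t, y). t < y \<and> y < t + P} (\<lambda>(t, y). L t y)"
      unfolding L_def case_prod_unfold
      by (intro continuous_on_compose2[OF gauge_cont[of UNIV]] continuous_intros continuous_on_compose2[OF \<gamma>_cont[of UNIV]]) auto
    show "continuous_on {(t, y). t < y \<and> y < t + P} (\<lambda>(t, y). L1 t y)"
      unfolding L1_def case_prod_unfold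
      using chord_cont by (intro continuous_intros continuous_on_compose2[OF \<gamma>'_cont]) (auto simp: case_prod_unfold)
    show "continuous_on {(t, y). t < y \<and> y < t + P} (\<lambda>(t, y). L2 t y)"
      unfolding L2_def case_prod_unfold
      using chord_cont by (intro continuous_intros continuous_on_compose2[OF \<gamma>'_cont]) (auto simp: case_prod_unfold)
    show "L1 (t + P) (y + P) = L1 t y" "L2 (t + P) (y + P) = L2 t y" for t y
      using L1_shift_int[of t 1 y 1] L2_shift_int[of t 1 y 1] by simp_all
    show "\<bar>L1 t y\<bar> \<le> C * D" if "t < y" "y < t + P" for t y
    proof -
      have "\<bar>L1 t y\<bar> \<le> norm (N (\<gamma> y - \<gamma> t)) * norm (\<gamma>' t)"
        by (simp add: L1_def Cauchy_Schwarz_ineq2)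
      also have "\<dots> \<le> C * D" using NC[of "\<gamma> y - \<gamma> t"] D' \<gamma>_neq[OF that] C(1) by (intro mult_mono) auto
      finally show ?thesis .
    qed
  qed (fact L1_mono L2_mono reflect_forward)+
  then show ?thesis by blast
qed

end

section \<open>The billiard map on the universal cover of the cylinder\<close>

lemma periodic_extension_continuous:
  fixes p :: "real \<Rightarrow> 'a::topological_space"
  assumes "continuous_on {0..1} p" "p 0 = p 1"
  shows "continuous_on UNIV (\<lambda>\<sigma>. p (frac \<sigma>))"
proof -
  have piece: "continuous_on {of_int n..of_int n + 1} (\<lambda>\<sigma>. p (frac \<sigma>))" for n :: int
  proof -
    have "continuous_on {of_int n..of_int n + 1} (\<lambda>\<sigma>. p (\<sigma> - of_int n))"
      by (rule continuous_on_compose2[OF assms(1)]) (auto intro!: continuous_intros)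
    then show ?thesis
    proof (rule continuous_on_eq)
      fix \<sigma> :: real assume \<sigma>: "\<sigma> \<in> {of_int n..of_int n + 1}"
      show "p (\<sigma> - of_int n) = p (frac \<sigma>)"
      proof (cases "\<sigma> = of_int n + 1")
        case True
        then have "\<sigma> = of_int (n + 1)" by simp
        then have "frac \<sigma> = 0" by (simp only: frac_of_int)
        then show ?thesis using True assms(2) by simp
      next
        case False
        then have "\<lfloor>\<sigma>\<rfloor> = n" using \<sigma> by (intro floor_unique) auto
        then show ?thesis by (simp add: frac_def)
      qed
    qed
  qed
  have two: "continuous_on {of_int n - 1..of_int n + 1} (\<lambda>\<sigma>. p (frac \<sigma>))" for n :: int
  proof -
    have "continuous_on ({of_int n - 1..of_int n} \<union> {of_int n..of_int n + 1}) (\<lambda>\<sigma>. p (frac \<sigma>))"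
      using piece[of "n - 1"] piece[of n] by (intro continuous_on_closed_Un) auto
    moreover have "{of_int n - 1..of_int n} \<union> {of_int n..of_int n + 1} = {of_int n - 1..of_int n + (1::real)}" by auto
    ultimately show ?thesis by simp
  qed
  show ?thesis
  proof (rule continuous_at_imp_continuous_on, rule ballI)
    fix \<sigma> :: real
    define n where "n = \<lfloor>\<sigma> + 1 / 2\<rfloor>"
    have "\<sigma> \<in> {of_int n - 1<..<of_int n + 1}" unfolding n_def by simp linarith
    moreover have "continuous_on {of_int n - 1<..<of_int n + 1} (\<lambda>\<sigma>. p (frac \<sigma>))"
      by (rule continuous_on_subset[OF two[of n]]) auto
    ultimately show "isCont (\<lambda>\<sigma>. p (frac \<sigma>)) \<sigma>"
      by (simp add: continuous_on_eq_continuous_at)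
  qed
qed

text \<open>
  Used to see that deck transformations along a continuous path do not jump.\<close>

lemma integer_multiple_constant:
  fixes h :: "real \<Rightarrow> real"
  assumes "connected S" "continuous_on S h" "\<And>\<sigma>. \<sigma> \<in> S \<Longrightarrow> \<exists>m::int. h \<sigma> = of_int m * P" "P > 0" "x \<in> S" "y \<in> S"
  shows "h x = h y"
proof -
  have "h constant_on S"
  proof (rule continuous_discrete_range_constant[OF assms(1,2)])
    fix x assume x: "x \<in> S"
    show "\<exists>e>0. \<forall>y. y \<in> S \<and> h y \<noteq> h x \<longrightarrow> e \<le> norm (h y - h x)"
    proof (intro exI[of _ P] conjI allI impI)
      fix y assume y: "y \<in> S \<and> h y \<noteq> h x"
      obtain m n :: int where mn: "h x = of_int m * P" "h y = of_int n * P" using assms(3) x y by blast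
      then have "n \<noteq> m" using y by auto
      then have "\<bar>of_int (n - m)\<bar> * P \<ge> 1 * P" using \<open>P > 0\<close> by (intro mult_right_mono) auto
      moreover have "h y - h x = of_int (n - m) * P" using mn by (simp add: algebra_simps)
      ultimately show "P \<le> norm (h y - h x)" using \<open>P > 0\<close> by (simp add: abs_mult)
    qed (rule \<open>P > 0\<close>)
  qed
  then show ?thesis using assms by (auto simp: constant_on_def)
qed

context billiard_table
begin

text \<open>
  Identifies \<open>\<Gamma>\<close> with the unit circle, by which lifts of curves in \<open>\<Gamma>\<close> are continuous logarithms.\<close>

definition circle_coord :: "real \<Rightarrow> complex" where
  "circle_coord t = exp (\<i> * of_real (2 * pi * t / P))"

lemma circle_coord_eq_iff: "circle_coord s = circle_coord t \<longleftrightarrow> \<gamma> s = \<gamma> t"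
proof -
  have "circle_coord s = circle_coord t \<longleftrightarrow> (\<exists>n::int. \<i> * of_real (2 * pi * s / P) = \<i> * of_real (2 * pi * t / P) + of_int (2 * n) * of_real pi * \<i>)"
    by (simp add: circle_coord_def exp_eq)
  also have "\<dots> \<longleftrightarrow> (\<exists>n::int. s = t + of_int n * P)"
  proof -
    have "\<i> * of_real (2 * pi * s / P) = \<i> * of_real (2 * pi * t / P) + of_int (2 * n) * of_real pi * \<i> \<longleftrightarrow> s = t + of_int n * P" for n :: int
    proof -
      have "\<i> * of_real (2 * pi * s / P) = \<i> * of_real (2 * pi * t / P) + of_int (2 * n) * of_real pi * \<i>
          \<longleftrightarrow> 2 * pi * s / P = 2 * pi * t / P + of_int (2 * n) * pi"
        by (simp add: complex_eq_iff)
      also have "\<dots> \<longleftrightarrow> 2 * pi * s = 2 * pi * (t + of_int n * P)" using P_pos by (simp add: field_simps)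
      also have "\<dots> \<longleftrightarrow> s = t + of_int n * P" by (simp only: mult_cancel_left) simp
      finally show ?thesis .
    qed
    then show ?thesis by simp
  qed
  finally show ?thesis by (simp add: \<gamma>_eq_iff)
qed

text \<open>
  The inverse \<open>e\<close> of the parametrization, as a map from \<open>\<Gamma>\<close> to the unit circle, is continuous by
  the compactness of its graph. A continuous logarithm of \<open>e \<circ> q\<close> is the lift.\<close>

lemma curve_lift:
  assumes q: "continuous_on UNIV q" "\<And>\<sigma>. q \<sigma> \<in> \<Gamma>"
  shows "\<exists>a::real \<Rightarrow> real. continuous_on UNIV a \<and> (\<forall>\<sigma>. \<gamma> (a \<sigma>) = q \<sigma>)"
proof -
  define e where "e x = circle_coord (SOME t. \<gamma> t = x)" for x
  have e: "e (\<gamma> t) = circle_coord t" for t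
  proof -
    have "\<gamma> (SOME s. \<gamma> s = \<gamma> t) = \<gamma> t" by (rule someI[of _ t]) simp
    then show ?thesis by (simp add: e_def circle_coord_eq_iff)
  qed
  have cc: "continuous_on S circle_coord" for S
    unfolding circle_coord_def using P_pos by (intro continuous_intros) auto
  have "continuous_on \<Gamma> e"
  proof (rule continuous_from_closed_graph)
    show "compact (circle_coord ` {0..0 + P})" by (intro compact_continuous_image cc) auto
    show "e \<in> \<Gamma> \<rightarrow> circle_coord ` {0..0 + P}" using \<Gamma>_image[of 0] e by force
    have img: "(\<lambda>x. Pair x (e x)) ` \<Gamma> = (\<lambda>t. (\<gamma> t, circle_coord t)) ` {0..0 + P}"
      using \<Gamma>_image[of 0] e by (force simp: image_image)
    have "compact ((\<lambda>t. (\<gamma> t, circle_coord t)) ` {0..0 + P})"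
      by (intro compact_continuous_image continuous_on_Pair \<gamma>_cont cc) auto
    then show "closed ((\<lambda>x. Pair x (e x)) ` \<Gamma>)" unfolding img by (rule compact_imp_closed)
  qed
  then have eq: "continuous_on UNIV (\<lambda>\<sigma>. e (q \<sigma>))"
    by (rule continuous_on_compose2[OF _ q(1)]) (use q(2) in auto)
  have enz: "e (q \<sigma>) \<noteq> 0" for \<sigma> by (simp add: e_def circle_coord_def)
  obtain l where l: "continuous_on UNIV l" "\<And>\<sigma>. e (q \<sigma>) = exp (l \<sigma>)"
    using continuous_logarithm_on_contractible[OF eq] enz by (metis UNIV_I convex_UNIV convex_imp_contractible)
  define a where "a \<sigma> = P * Im (l \<sigma>) / (2 * pi)" for \<sigma>
  have "\<gamma> (a \<sigma>) = q \<sigma>" for \<sigma>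
  proof -
    obtain t where t: "q \<sigma> = \<gamma> t" using q(2) range_\<gamma> by blast
    have "exp (l \<sigma>) = circle_coord t" using l(2)[of \<sigma>] t e[of t] by simp
    then have "norm (exp (l \<sigma>)) = 1" by (simp add: circle_coord_def)
    then have "Re (l \<sigma>) = 0" by simp
    then have "l \<sigma> = \<i> * of_real (2 * pi * a \<sigma> / P)" using P_pos by (simp add: complex_eq_iff a_def)
    then have "circle_coord (a \<sigma>) = circle_coord t" using \<open>exp (l \<sigma>) = circle_coord t\<close> by (simp add: circle_coord_def)
    then show ?thesis using t circle_coord_eq_iff by simp
  qed
  moreover have "continuous_on UNIV a" unfolding a_def by (intro continuous_intros l(1)) auto
  ultimately show ?thesis by blast
qed

text \<open>
  A bound for \<open>L1\<close>, fixed so that the table determines one twist map.\<close>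

definition \<kappa> :: real where "\<kappa> = (SOME \<kappa>. twist_map P \<kappa> L L1 L2)"

sublocale tw: twist_map P \<kappa> L L1 L2
  unfolding \<kappa>_def using twist by (rule someI_ex)

definition proj :: "real \<times> real \<Rightarrow> plane \<times> plane" where "proj = map_prod \<gamma> \<gamma>"

lemma proj_Pair [simp]: "proj (t, y) = (\<gamma> t, \<gamma> y)"
  by (simp add: proj_def)

lemma proj_cont: "continuous_on S proj"
proof -
  have "proj = (\<lambda>q. (\<gamma> (fst q), \<gamma> (snd q)))" by (auto simp: proj_def)
  then show ?thesis by (simp add: continuous_on_Pair continuous_on_compose2[OF \<gamma>_cont[of UNIV]] continuous_on_fst continuous_on_snd)
qed

lemma proj_shift [simp]: "proj (tw.shift m q) = proj q"
  by (cases q) (simp add: tw.shift_def \<gamma>_shift_int)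

lemma proj_strip: "q \<in> tw.strip \<Longrightarrow> proj q \<in> phase_cylinder \<Gamma>"
  using \<gamma>_neq by (cases q) (force simp: phase_cylinder_def tw.strip_iff)

lemma strip_lift: "z \<in> phase_cylinder \<Gamma> \<Longrightarrow> \<exists>q\<in>tw.strip. proj q = z"
proof -
  assume z: "z \<in> phase_cylinder \<Gamma>"
  obtain t y where ty: "z = (\<gamma> t, \<gamma> y)" "\<gamma> t \<noteq> \<gamma> y" using z range_\<gamma> by (force simp: phase_cylinder_def)
  obtain m :: int where m: "t \<le> y + of_int m * P" "y + of_int m * P < t + P" using reduce_mod by blast
  have "t \<noteq> y + of_int m * P" using ty \<gamma>_shift_int[of y m] by metis
  then have "(t, y + of_int m * P) \<in> tw.strip" using m by (simp add: tw.strip_iff)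
  then show ?thesis using ty \<gamma>_shift_int by (intro bexI[of _ "(t, y + of_int m * P)"]) auto
qed

lemma proj_eq_strip:
  assumes "q \<in> tw.strip" "q' \<in> tw.strip" "proj q = proj q'"
  shows "\<exists>m. q = tw.shift m q'"
proof -
  obtain t y where q: "q = (t, y)" by (cases q)
  obtain t' y' where q': "q' = (t', y')" by (cases q')
  obtain m n :: int where mn: "t = t' + of_int m * P" "y = y' + of_int n * P"
    using assms(3) \<gamma>_eq_iff q q' by auto
  have "of_int m * P < of_int (n + 1) * P" "of_int n * P < of_int (m + 1) * P"
    using assms(1,2) mn by (auto simp: q q' tw.strip_iff algebra_simps)
  then have "m < n + 1" "n < m + 1" using P_pos by (simp_all only: mult_less_cancel_right_pos of_int_less_iff)
  then show ?thesis using mn q q' by (intro exI[of _ m]) (simp add: tw.shift_def)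
qed

text \<open>
  The parameters of consecutive points are determined up to multiples of \<open>P\<close>, which do not change
  the partial derivatives of the generating function. So the definition reduces to the law
  \<open>L1 y z = - L2 t y\<close>.\<close>

lemma consecutive_iff:
  assumes "(t, y) \<in> tw.strip"
  shows "consecutive K \<gamma> (\<gamma> t) (\<gamma> y) Z \<longleftrightarrow> Z = \<gamma> (snd (tw.T (t, y)))"
proof -
  obtain z where z: "tw.T (t, y) = (y, z)" "(y, z) \<in> tw.strip" "L1 y z = - L2 t y"
    using tw.T_ex[OF assms refl] by blast
  have ne: "\<gamma> y \<noteq> \<gamma> t" "\<gamma> z \<noteq> \<gamma> y" using \<gamma>_neq assms z by (auto simp: tw.strip_iff)
  show ?thesis
  proof
    assume "Z = \<gamma> (snd (tw.T (t, y)))"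
    then have Z: "Z = \<gamma> z" using z by simp
    have "((\<lambda>\<tau>. gen_fun K \<gamma> t \<tau>) has_real_derivative L2 t y) (at y)"
      unfolding gen_fun_def by (rule gauge_chord_deriv2[OF ne(1)])
    moreover have "((\<lambda>\<tau>. gen_fun K \<gamma> \<tau> z) has_real_derivative - L2 t y) (at y)"
      using gauge_chord_deriv1[OF ne(2)] z(3) by (simp add: gen_fun_def)
    ultimately show "consecutive K \<gamma> (\<gamma> t) (\<gamma> y) Z" unfolding consecutive_def Z using ne by metis
  next
    assume "consecutive K \<gamma> (\<gamma> t) (\<gamma> y) Z"
    then obtain t0 t1 t2 s where s: "\<gamma> y \<noteq> Z" "\<gamma> t = \<gamma> t0" "\<gamma> y = \<gamma> t1" "Z = \<gamma> t2"
      "((\<lambda>\<tau>. gen_fun K \<gamma> t0 \<tau>) has_real_derivative s) (at t1)"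
      "((\<lambda>\<tau>. gen_fun K \<gamma> \<tau> t2) has_real_derivative - s) (at t1)"
      unfolding consecutive_def by blast
    obtain m0 m1 :: int where m: "t = t0 + of_int m0 * P" "y = t1 + of_int m1 * P" using s \<gamma>_eq_iff by metis
    have "\<gamma> t1 \<noteq> \<gamma> t0" using ne(1) unfolding s(2,3) .
    then have s1: "s = L2 t0 t1"
      by (rule DERIV_unique[OF s(5)[unfolded gen_fun_def] gauge_chord_deriv2])
    have "\<gamma> t2 \<noteq> \<gamma> t1" using s(1) unfolding s(3,4) by (rule not_sym)
    then have s2: "- s = L1 t1 t2"
      by (rule DERIV_unique[OF s(6)[unfolded gen_fun_def] gauge_chord_deriv1])
    have law: "L1 y t2 = - L2 t y" using L1_shift_int[of t1 m1 t2 0] L2_shift_int[of t0 m0 t1 m1] s1 s2 unfolding m by simp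
    obtain k :: int where k: "y \<le> t2 + of_int k * P" "t2 + of_int k * P < y + P" using reduce_mod by blast
    have "y \<noteq> t2 + of_int k * P" using s(1,4) \<gamma>_shift_int[of t2 k] by metis
    moreover have "L1 y (t2 + of_int k * P) = - L2 t y" using law L1_shift_int[of y 0 t2 k] by simp
    ultimately have "tw.T (t, y) = (y, t2 + of_int k * P)" using k by (intro tw.T_eqI) auto
    then show "Z = \<gamma> (snd (tw.T (t, y)))" using s(4) \<gamma>_shift_int by simp
  qed
qed

lemma billiard_map_proj: "q \<in> tw.strip \<Longrightarrow> billiard_map K \<gamma> (proj q) = proj (tw.T q)"
proof -
  assume q: "q \<in> tw.strip"
  obtain t y where ty: "q = (t, y)" by (cases q)
  have "(THE Z. consecutive K \<gamma> (\<gamma> t) (\<gamma> y) Z) = \<gamma> (snd (tw.T (t, y)))"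
    using consecutive_iff q ty by simp
  then show ?thesis using tw.fst_T[of "(t, y)"] unfolding ty billiard_map_def
    by (cases "tw.T (t, y)") simp
qed

end

section \<open>Lifting the invariant curves\<close>

context billiard_table
begin

lemma shift_eq_iff: "tw.shift m q = tw.shift n q \<longleftrightarrow> m = n"
  using P_pos by (simp add: tw.shift_def)

lemma strip_winding:
  fixes c :: "real \<Rightarrow> real \<times> real"
  assumes ab: "continuous_on UNIV c" "\<And>\<sigma>. c \<sigma> \<in> tw.strip" "\<And>\<sigma>. proj (c (\<sigma> + 1)) = proj (c \<sigma>)"
  shows "\<exists>w. \<forall>\<sigma>. c (\<sigma> + 1) = tw.shift w (c \<sigma>)"
proof -
  have ex: "\<exists>m. c (\<sigma> + 1) = tw.shift m (c \<sigma>)" for \<sigma> using proj_eq_strip ab(2,3) by blast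
  then obtain w where w: "c (0 + 1) = tw.shift w (c 0)" by blast
  have "fst (c (\<sigma> + 1)) - fst (c \<sigma>) = of_int w * P" for \<sigma>
  proof -
    have c1: "continuous_on UNIV (\<lambda>\<sigma>. c (\<sigma> + 1))"
      by (rule continuous_on_compose2[OF ab(1)]) (auto intro!: continuous_intros)
    have "fst (c (\<sigma> + 1)) - fst (c \<sigma>) = fst (c (0 + 1)) - fst (c 0)"
    proof (rule integer_multiple_constant[of UNIV "\<lambda>\<sigma>. fst (c (\<sigma> + 1)) - fst (c \<sigma>)" P \<sigma> 0])
      show "continuous_on UNIV (\<lambda>\<sigma>. fst (c (\<sigma> + 1)) - fst (c \<sigma>))" using c1 ab(1) by (intro continuous_intros)
      show "\<exists>m::int. fst (c (\<sigma> + 1)) - fst (c \<sigma>) = of_int m * P" for \<sigma>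
      proof -
        obtain m where "c (\<sigma> + 1) = tw.shift m (c \<sigma>)" using ex by blast
        then have "fst (c (\<sigma> + 1)) - fst (c \<sigma>) = of_int m * P" by (simp add: tw.shift_def)
        then show ?thesis by blast
      qed
    qed (use P_pos in auto)
    then show ?thesis using w by (simp add: tw.shift_def)
  qed
  then have fst: "fst (c (\<sigma> + 1)) - fst (c \<sigma>) = of_int w * P" for \<sigma> .
  have "c (\<sigma> + 1) = tw.shift w (c \<sigma>)" for \<sigma>
  proof -
    obtain m where m: "c (\<sigma> + 1) = tw.shift m (c \<sigma>)" using ex by blast
    then have "of_int m * P = of_int w * P" using fst[of \<sigma>] by (simp add: tw.shift_def)
    then have "m = w" using P_pos by simp
    then show ?thesis using m by simp
  qed
  then show ?thesis by blast
qed

text \<open>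
  The difference of the two lifts is never a multiple of \<open>P\<close>, and so it stays between two
  consecutive multiples.\<close>

lemma strip_pair:
  assumes a: "continuous_on UNIV a" and b: "continuous_on UNIV b" and ne: "\<And>\<sigma>::real. \<gamma> (a \<sigma>) \<noteq> \<gamma> (b \<sigma>)"
  shows "\<exists>m::int. \<forall>\<sigma>. (a \<sigma>, b \<sigma> + of_int m * P) \<in> tw.strip"
proof -
  obtain m :: int where m: "a 0 \<le> b 0 + of_int m * P" "b 0 + of_int m * P < a 0 + P" using reduce_mod by blast
  define d where "d \<sigma> = b \<sigma> + of_int m * P - a \<sigma>" for \<sigma>
  have dc: "continuous_on UNIV d" unfolding d_def by (intro continuous_intros a b)
  have dn: "d \<sigma> \<noteq> of_int k * P" for \<sigma> and k :: int
  proof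
    assume "d \<sigma> = of_int k * P"
    then have "b \<sigma> = a \<sigma> + of_int (k - m) * P" by (simp add: d_def algebra_simps)
    then show False using ne[of \<sigma>] \<gamma>_shift_int by metis
  qed
  have conn: "connected (range d)" using dc by (rule connected_continuous_image) simp
  have d0: "0 < d 0" "d 0 < P" using m dn[of 0 0] by (auto simp: d_def less_le)
  have dr: "0 < d \<sigma> \<and> d \<sigma> < P" for \<sigma>
  proof (rule ccontr)
    assume "\<not> ?thesis"
    then consider "d \<sigma> \<le> 0" | "P \<le> d \<sigma>" by linarith
    then show False
    proof cases
      case 1
      then have "0 \<in> range d" using d0 connectedD_interval[OF conn, of "d \<sigma>" "d 0" 0] by simp
      then show False using dn[of _ 0] by auto
    next
      case 2
      then have "P \<in> range d" using d0 connectedD_interval[OF conn, of "d 0" "d \<sigma>" P] by simp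
      then show False using dn[of _ 1] by auto
    qed
  qed
  have "(a \<sigma>, b \<sigma> + of_int m * P) \<in> tw.strip" for \<sigma> using dr[of \<sigma>] by (auto simp: d_def tw.strip_iff)
  then show ?thesis by blast
qed

lemma cylinder_loop_lift:
  assumes p: "path p" "pathfinish p = pathstart p" "path_image p \<subseteq> phase_cylinder \<Gamma>"
  shows "\<exists>c. continuous_on UNIV c \<and> (\<forall>\<sigma>. c \<sigma> \<in> tw.strip) \<and> (\<forall>\<sigma>. proj (c \<sigma>) = p (frac \<sigma>))"
proof -
  define q where "q \<sigma> = p (frac \<sigma>)" for \<sigma>
  have qc: "continuous_on UNIV q"
    unfolding q_def using p by (intro periodic_extension_continuous) (auto simp: path_def pathfinish_def pathstart_def)
  have qz: "q \<sigma> \<in> phase_cylinder \<Gamma>" for \<sigma>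
  proof -
    have "frac \<sigma> \<in> {0..1}" using frac_lt_1[of \<sigma>] by simp
    then show ?thesis using p(3) unfolding q_def path_image_def by blast
  qed
  have q1: "continuous_on UNIV (\<lambda>\<sigma>. fst (q \<sigma>))" "\<And>\<sigma>. fst (q \<sigma>) \<in> \<Gamma>"
    and q2: "continuous_on UNIV (\<lambda>\<sigma>. snd (q \<sigma>))" "\<And>\<sigma>. snd (q \<sigma>) \<in> \<Gamma>"
    using qc qz by (auto intro!: continuous_intros simp: phase_cylinder_def case_prod_unfold)
  obtain a where a: "continuous_on UNIV a" "\<And>\<sigma>. \<gamma> (a \<sigma>) = fst (q \<sigma>)" using curve_lift[OF q1] by blast
  obtain b where b: "continuous_on UNIV b" "\<And>\<sigma>. \<gamma> (b \<sigma>) = snd (q \<sigma>)" using curve_lift[OF q2] by blast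
  have ne: "\<gamma> (a \<sigma>) \<noteq> \<gamma> (b \<sigma>)" for \<sigma> using qz[of \<sigma>] a(2) b(2) by (auto simp: phase_cylinder_def case_prod_unfold)
  obtain m :: int where m: "\<And>\<sigma>. (a \<sigma>, b \<sigma> + of_int m * P) \<in> tw.strip"
    using strip_pair[OF a(1) b(1) ne] by blast
  define c where "c \<sigma> = (a \<sigma>, b \<sigma> + of_int m * P)" for \<sigma>
  have "continuous_on UNIV c" unfolding c_def by (intro continuous_intros a b)
  moreover have "c \<sigma> \<in> tw.strip" for \<sigma> using m by (simp add: c_def)
  moreover have "proj (c \<sigma>) = p (frac \<sigma>)" for \<sigma>
    using a(2)[of \<sigma>] b(2)[of \<sigma>] by (simp add: c_def \<gamma>_shift_int q_def)
  ultimately show ?thesis by blast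
qed

lemma convex_strip: "convex tw.strip"
proof -
  have "tw.strip = {q. (-1, 1) \<bullet> q > 0} \<inter> {q. (-1, 1) \<bullet> q < P}" by (auto simp: tw.strip_def)
  then show ?thesis by (simp add: convex_Int convex_halfspace_gt convex_halfspace_lt)
qed

text \<open>
  The strip is convex, and the contraction projects to the cylinder.\<close>

lemma unwound_loop_contractible:
  assumes c: "continuous_on UNIV c" "\<And>\<sigma>. c \<sigma> \<in> tw.strip" "c 1 = c 0"
    and p: "\<And>\<sigma>. \<sigma> \<in> {0..1} \<Longrightarrow> proj (c \<sigma>) = p \<sigma>"
  shows "\<exists>a. homotopic_loops (phase_cylinder \<Gamma>) p (\<lambda>_. a)"
proof -
  have "homotopic_loops tw.strip c (\<lambda>_. c 0)"
  proof (rule homotopic_loops_linear)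
    show "path c" using continuous_on_subset[OF c(1)] by (auto simp: path_def)
    show "path (\<lambda>_. c 0)" by (auto simp: path_def)
    show "closed_segment (c t) (c 0) \<subseteq> tw.strip" for t using convex_strip c(2) by (simp add: closed_segment_subset)
  qed (use c in \<open>auto simp: pathfinish_def pathstart_def\<close>)
  then have h: "homotopic_loops (phase_cylinder \<Gamma>) (proj \<circ> c) (proj \<circ> (\<lambda>_. c 0))"
    by (rule homotopic_loops_continuous_image) (use proj_cont proj_strip in auto)
  have "homotopic_loops (phase_cylinder \<Gamma>) (proj \<circ> c) p"
  proof (rule homotopic_loops_eq)
    have "continuous_on UNIV (proj \<circ> c)" using c(1) by (intro continuous_on_compose proj_cont)
    then show "path (proj \<circ> c)" using continuous_on_subset by (auto simp: path_def)
    show "path_image (proj \<circ> c) \<subseteq> phase_cylinder \<Gamma>" 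
      unfolding path_image_def using proj_strip[OF c(2)] by (intro image_subsetI) simp
  qed (use c p in \<open>auto simp: pathfinish_def pathstart_def\<close>)
  then have "homotopic_loops (phase_cylinder \<Gamma>) p (proj \<circ> c)" by (rule homotopic_loops_sym)
  then have "homotopic_loops (phase_cylinder \<Gamma>) p (proj \<circ> (\<lambda>_. c 0))" using h by (rule homotopic_loops_trans)
  then show ?thesis unfolding o_def by (rule exI)
qed

text \<open>
  The cylinder embeds into the punctured plane, with the relative parameter distance \<open>\<rho>\<close> of the
  end points of the chord as modulus and the position of the starting point as argument. The image
  of the loop is a simple closed curve with winding number \<open>w\<close> about the origin.\<close>

lemma simple_loop_winding:
  assumes p: "simple_path p" "pathfinish p = pathstart p"
    and c: "continuous_on UNIV c" "\<And>\<sigma>. c \<sigma> \<in> tw.strip" "\<And>\<sigma>. c (\<sigma> + 1) = tw.shift w (c \<sigma>)"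
    and pc: "\<And>\<sigma>. \<sigma> \<in> {0..1} \<Longrightarrow> proj (c \<sigma>) = p \<sigma>"
  shows "w \<in> {-1, 0, 1}"
proof -
  define \<rho> where "\<rho> \<sigma> = (snd (c \<sigma>) - fst (c \<sigma>)) / P" for \<sigma>
  define l where "l \<sigma> = of_real (ln (\<rho> \<sigma>)) + \<i> * of_real (2 * pi * fst (c \<sigma>) / P)" for \<sigma>
  define z where "z \<sigma> = exp (l \<sigma>)" for \<sigma>
  have \<rho>_pos: "\<rho> \<sigma> > 0" for \<sigma> using c(2)[of \<sigma>] P_pos by (cases "c \<sigma>") (simp add: \<rho>_def tw.strip_iff)
  have \<rho>c: "continuous_on UNIV \<rho>" unfolding \<rho>_def using P_pos by (intro continuous_intros c(1)) auto
  have "\<rho> \<sigma> \<noteq> 0" for \<sigma> using \<rho>_pos[of \<sigma>] by simp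
  then have lc: "continuous_on UNIV l" unfolding l_def
    using P_pos by (intro continuous_intros \<rho>c c(1)) auto
  have z_eq: "z \<sigma> = of_real (\<rho> \<sigma>) * circle_coord (fst (c \<sigma>))" for \<sigma>
    using \<rho>_pos[of \<sigma>] by (simp add: z_def l_def exp_add circle_coord_def exp_of_real)
  have inj: "p \<sigma> = p \<tau>" if "z \<sigma> = z \<tau>" "\<sigma> \<in> {0..1}" "\<tau> \<in> {0..1}" for \<sigma> \<tau>
  proof -
    have "norm (z \<sigma>) = \<rho> \<sigma>" for \<sigma> using \<rho>_pos[of \<sigma>] by (simp add: z_eq norm_mult circle_coord_def)
    then have \<rho>: "\<rho> \<sigma> = \<rho> \<tau>" using that by metis
    then have "circle_coord (fst (c \<sigma>)) = circle_coord (fst (c \<tau>))" using that(1) \<rho>_pos[of \<tau>] by (simp add: z_eq)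
    then have g: "\<gamma> (fst (c \<sigma>)) = \<gamma> (fst (c \<tau>))" by (simp add: circle_coord_eq_iff)
    then obtain m :: int where m: "fst (c \<sigma>) = fst (c \<tau>) + of_int m * P" using \<gamma>_eq_iff by blast
    then have "snd (c \<sigma>) = snd (c \<tau>) + of_int m * P" using \<rho> P_pos by (simp add: \<rho>_def)
    then have "proj (c \<sigma>) = proj (c \<tau>)" using g \<gamma>_shift_int by (simp add: proj_def map_prod_def case_prod_unfold)
    then show ?thesis using pc that by simp
  qed
  have lw: "l 1 - l 0 = 2 * of_real pi * \<i> * of_int w"
  proof -
    have "c 1 = tw.shift w (c 0)" using c(3)[of 0] by simp
    then show ?thesis using P_pos by (simp add: l_def \<rho>_def tw.shift_def complex_eq_iff field_simps)
  qed
  have z1: "z 1 = z 0"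
  proof -
    have "z 1 = exp (l 0 + 2 * of_real pi * \<i> * of_int w)" using lw by (simp add: z_def algebra_simps)
    also have "\<dots> = z 0" by (simp add: z_def exp_add exp_integer_2pi mult.commute mult.left_commute)
    finally show ?thesis .
  qed
  have "simple_path z"
    unfolding simple_path_def
  proof
    show "path z" unfolding path_def z_def using continuous_on_subset[OF lc] by (intro continuous_intros) auto
    show "loop_free z" using p(1) inj unfolding simple_path_def loop_free_def by metis
  qed
  moreover have loop: "pathfinish z = pathstart z" using z1 by (simp add: pathfinish_def pathstart_def)
  moreover have nz: "0 \<notin> path_image z" by (auto simp: path_image_def z_def)
  ultimately have wn: "winding_number z 0 \<in> {-1, 0, 1}" by (rule simple_closed_path_winding_number_cases)
  obtain q where q: "path q" "pathfinish q - pathstart q = 2 * of_real pi * \<i> * winding_number z 0"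
      "\<And>t. t \<in> {0..1} \<Longrightarrow> z t = 0 + exp (q t)"
    using winding_number_as_continuous_log[of z 0] \<open>simple_path z\<close> nz simple_path_imp_path by blast
  have "Im (q 0 - l 0) = Im (q 1 - l 1)"
  proof (rule integer_multiple_constant[of "{0..1}" "\<lambda>t. Im (q t - l t)" "2 * pi" 0 1])
    show "continuous_on {0..1} (\<lambda>t. Im (q t - l t))"
      using q(1) continuous_on_subset[OF lc] by (intro continuous_intros) (auto simp: path_def)
    fix t :: real assume "t \<in> {0..1}"
    then have "exp (q t) = exp (l t)" using q(3) by (simp add: z_def)
    then obtain n :: int where "q t = l t + of_real (of_int (2 * n) * pi) * \<i>" using exp_eq by blast
    then show "\<exists>m::int. Im (q t - l t) = of_int m * (2 * pi)" by (intro exI[of _ n]) simp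
  qed auto
  then have "Im (q 1 - q 0) = Im (l 1 - l 0)" by simp
  moreover have "q 1 - q 0 = 2 * of_real pi * \<i> * winding_number z 0"
    using q(2) by (simp add: pathfinish_def pathstart_def)
  ultimately have "Im (2 * of_real pi * \<i> * winding_number z 0) = Im (2 * of_real pi * \<i> * of_int w)"
    using lw by (simp only:)
  then have "2 * pi * Re (winding_number z 0) = 2 * pi * of_int w" by simp
  then have "Re (winding_number z 0) = of_int w" by simp
  then show ?thesis using wn by auto
qed

text \<open>
  The parametrization of the curve lifts to the strip, and after one turn the lift is translated
  by some multiple \<open>w\<close> of the period. As the curve is not contractible, \<open>w \<noteq> 0\<close>; as it is simple,
  \<open>w = 1\<close> or \<open>w = -1\<close>.\<close>

theorem invariant_curve_lift:
  assumes C: "rotational_invariant_curve (phase_cylinder \<Gamma>) (billiard_map K \<gamma>) C"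
  shows "\<exists>c. tw.invariant_line c \<and> range c = {q \<in> tw.strip. proj q \<in> C}"
proof -
  obtain p where p: "simple_path p" "pathfinish p = pathstart p" "path_image p = C" "C \<subseteq> phase_cylinder \<Gamma>"
      "\<And>a. \<not> homotopic_loops (phase_cylinder \<Gamma>) p (\<lambda>_. a)" and inv: "billiard_map K \<gamma> ` C = C"
    using C unfolding rotational_invariant_curve_def by blast
  obtain c where c: "continuous_on UNIV c" "\<And>\<sigma>. c \<sigma> \<in> tw.strip" "\<And>\<sigma>. proj (c \<sigma>) = p (frac \<sigma>)"
    using cylinder_loop_lift[of p] p simple_path_imp_path by blast
  have p10: "p 1 = p 0" using p(2) by (simp add: pathfinish_def pathstart_def)
  have c01: "proj (c \<sigma>) = p \<sigma>" if "\<sigma> \<in> {0..1}" for \<sigma>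
  proof (cases "\<sigma> = 1")
    case True
    then show ?thesis using c(3)[of 1] p10 by (simp add: frac_def)
  next
    case False
    then have "frac \<sigma> = \<sigma>" using that by (simp add: frac_eq)
    then show ?thesis using c(3)[of \<sigma>] by simp
  qed
  have "proj (c (\<sigma> + 1)) = proj (c \<sigma>)" for \<sigma> using c(3) frac_1_eq[of \<sigma>] by simp
  then obtain w where w: "\<And>\<sigma>. c (\<sigma> + 1) = tw.shift w (c \<sigma>)" using strip_winding[OF c(1,2)] by blast
  have "w \<noteq> 0"
  proof
    assume "w = 0"
    then have "c 1 = c 0" using w[of 0] by simp
    then show False using unwound_loop_contractible[OF c(1,2) _ c01] p(5) by blast
  qed
  then have w1: "w = 1 \<or> w = -1" using simple_loop_winding[OF p(1,2) c(1,2) w c01] by auto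
  obtain d :: "real \<Rightarrow> real \<times> real" where d: "continuous_on UNIV d" "\<And>\<sigma>. d \<sigma> \<in> tw.strip" "\<And>\<sigma>. d (\<sigma> + 1) = tw.shift 1 (d \<sigma>)"
    and d_inj: "\<And>\<sigma> \<tau>. proj (d \<sigma>) = proj (d \<tau>) \<Longrightarrow> \<exists>k::int. \<sigma> = \<tau> + of_int k"
    and d_range: "(\<lambda>\<sigma>. proj (d \<sigma>)) ` UNIV = C"
  proof -
    have ci: "\<exists>k::int. \<sigma> = \<tau> + of_int k" if "proj (c \<sigma>) = proj (c \<tau>)" for \<sigma> \<tau>
    proof -
      have "p (frac \<sigma>) = p (frac \<tau>)" using c(3) that by metis
      then have "frac \<sigma> = frac \<tau>"
        using p(1) frac_lt_1[of \<sigma>] frac_lt_1[of \<tau>] frac_ge_0[of \<sigma>] frac_ge_0[of \<tau>]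
        unfolding simple_path_def loop_free_def by (metis atLeastAtMost_iff less_eq_real_def less_irrefl)
      then show ?thesis by (intro exI[of _ "\<lfloor>\<sigma>\<rfloor> - \<lfloor>\<tau>\<rfloor>"]) (simp add: frac_def)
    qed
    have cr: "(\<lambda>\<sigma>. proj (c \<sigma>)) ` UNIV = C"
    proof
      show "(\<lambda>\<sigma>. proj (c \<sigma>)) ` UNIV \<subseteq> C"
      proof (rule image_subsetI)
        fix \<sigma> :: real
        have "frac \<sigma> \<in> {0..1}" using frac_lt_1[of \<sigma>] by simp
        then show "proj (c \<sigma>) \<in> C" unfolding c(3) p(3)[symmetric] path_image_def by (rule imageI)
      qed
      show "C \<subseteq> (\<lambda>\<sigma>. proj (c \<sigma>)) ` UNIV"
      proof
        fix x assume "x \<in> C"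
        then obtain s where "s \<in> {0..1}" "x = p s" unfolding p(3)[symmetric] path_image_def by blast
        then show "x \<in> (\<lambda>\<sigma>. proj (c \<sigma>)) ` UNIV" using c01[of s] by (metis rangeI)
      qed
    qed
    from w1 show ?thesis
    proof
      assume "w = 1"
      then show ?thesis using that[of c] c w ci cr by simp
    next
      \<comment> \<open>reverse the orientation\<close>
      assume wm: "w = - 1"
      define d where "d \<sigma> = c (- \<sigma>)" for \<sigma> :: real
      show ?thesis
      proof (rule that[of d])
        show "continuous_on UNIV d" unfolding d_def
          by (rule continuous_on_compose2[OF c(1)]) (auto intro!: continuous_intros)
        show "d \<sigma> \<in> tw.strip" for \<sigma> using c(2) by (simp add: d_def)
        show "d (\<sigma> + 1) = tw.shift 1 (d \<sigma>)" for \<sigma>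
        proof -
          have "c (- \<sigma>) = tw.shift (- 1) (c (- \<sigma> - 1))" using w[of "- \<sigma> - 1"] wm by simp
          then show ?thesis by (simp add: d_def)
        qed
        show "\<exists>k::int. \<sigma> = \<tau> + of_int k" if eq: "proj (d \<sigma>) = proj (d \<tau>)" for \<sigma> \<tau>
        proof -
          obtain k :: int where "- \<sigma> = - \<tau> + of_int k" using ci[OF eq[unfolded d_def]] by blast
          then show ?thesis by (intro exI[of _ "- k"]) simp
        qed
        have "(\<lambda>\<sigma>. proj (d \<sigma>)) ` UNIV = (\<lambda>\<sigma>. proj (c \<sigma>)) ` range uminus"
          unfolding d_def by (simp only: image_image)
        then show "(\<lambda>\<sigma>. proj (d \<sigma>)) ` UNIV = C" using cr by (simp add: surj_uminus)
      qed
    qed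
  qed
  have dk: "d (\<sigma> + of_int k) = tw.shift k (d \<sigma>)" for \<sigma> k
  proof (induction k rule: int_induct[where k = 0])
    case (step1 i)
    then show ?case using d(3)[of "\<sigma> + of_int i"] by (simp add: algebra_simps)
  next
    case (step2 i)
    have "tw.shift (- 1) (d (\<sigma> + of_int i)) = d (\<sigma> + of_int i - 1)"
      using d(3)[of "\<sigma> + of_int i - 1"] by simp
    then show ?case using step2 by (simp add: algebra_simps)
  qed simp
  have range_d: "range d = {q \<in> tw.strip. proj q \<in> C}"
  proof
    show "range d \<subseteq> {q \<in> tw.strip. proj q \<in> C}" using d(2) d_range by auto
    show "{q \<in> tw.strip. proj q \<in> C} \<subseteq> range d"
    proof
      fix q assume "q \<in> {q \<in> tw.strip. proj q \<in> C}"
      then obtain \<sigma> where q: "q \<in> tw.strip" "proj q = proj (d \<sigma>)" using d_range by auto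
      then obtain m where "q = tw.shift m (d \<sigma>)" using proj_eq_strip d(2) by blast
      then show "q \<in> range d" using dk by (metis rangeI)
    qed
  qed
  have "inj d"
  proof (rule injI)
    fix \<sigma> \<tau> assume eq: "d \<sigma> = d \<tau>"
    then obtain k :: int where k: "\<sigma> = \<tau> + of_int k" using d_inj by metis
    have "tw.shift k (d \<tau>) = tw.shift 0 (d \<tau>)" using dk[of \<tau> k] eq k by simp
    then have "k = 0" unfolding shift_eq_iff .
    then show "\<sigma> = \<tau>" using k by simp
  qed
  moreover have "tw.T ` range d = range d"
  proof
    show "tw.T ` range d \<subseteq> range d"
    proof
      fix r assume "r \<in> tw.T ` range d"
      then obtain q where q: "r = tw.T q" "q \<in> tw.strip" "proj q \<in> C" using range_d by auto
      then have "proj r \<in> C" using billiard_map_proj inv by (metis imageI)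
      then show "r \<in> range d" using q tw.T_strip range_d by auto
    qed
    show "range d \<subseteq> tw.T ` range d"
    proof
      fix q assume q: "q \<in> range d"
      then have qs: "q \<in> tw.strip" "proj q \<in> C" using range_d by auto
      then obtain x where x: "x \<in> C" "billiard_map K \<gamma> x = proj q" using inv by (metis imageE)
      obtain r where r: "r \<in> tw.strip" "proj r = x" using strip_lift x p(4) by blast
      have "proj q = proj (tw.T r)" using billiard_map_proj[OF r(1)] unfolding r(2) x(2) .
      then obtain m where m: "q = tw.shift m (tw.T r)" using proj_eq_strip qs tw.T_strip r by blast
      then have "q = tw.T (tw.shift m r)" using tw.T_shift r by simp
      moreover have "tw.shift m r \<in> range d" using range_d r x by simp
      ultimately show "q \<in> tw.T ` range d" by blast
    qed
  qed
  ultimately have "tw.invariant_line d" using d(1,2,3) unfolding tw.invariant_line_def by auto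
  then show ?thesis using range_d by blast
qed

end

section \<open>The foliation of the cover\<close>

locale integrable_table = billiard_table +
  assumes integrable: "totally_integrable_on \<Gamma> \<gamma> (phase_cylinder \<Gamma>)"
begin

text \<open>
  One foliation as in the hypothesis of integrability, fixed so that its leaves are functions of
  the table.\<close>

definition \<F> :: "(plane \<times> plane) set set" where
  "\<F> = (SOME \<F>. C1_foliation \<gamma> (phase_cylinder \<Gamma>) \<F> \<and>
     (\<forall>C\<in>\<F>. rotational_invariant_curve (phase_cylinder \<Gamma>) (billiard_map K \<gamma>) C))"

lemma foliation: "C1_foliation \<gamma> (phase_cylinder \<Gamma>) \<F>"
  and leaves_invariant: "\<And>C. C \<in> \<F> \<Longrightarrow> rotational_invariant_curve (phase_cylinder \<Gamma>) (billiard_map K \<gamma>) C"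
proof -
  have "\<exists>\<F>. C1_foliation \<gamma> (phase_cylinder \<Gamma>) \<F> \<and>
     (\<forall>C\<in>\<F>. rotational_invariant_curve (phase_cylinder \<Gamma>) (billiard_map K \<gamma>) C)"
    using integrable unfolding totally_integrable_on_def by blast
  from someI_ex[OF this] show "C1_foliation \<gamma> (phase_cylinder \<Gamma>) \<F>"
    "\<And>C. C \<in> \<F> \<Longrightarrow> rotational_invariant_curve (phase_cylinder \<Gamma>) (billiard_map K \<gamma>) C"
    unfolding \<F>_def by blast+
qed

lemma leaves_cover: "\<Union>\<F> = phase_cylinder \<Gamma>"
  and leaves_disjoint: "C \<in> \<F> \<Longrightarrow> C' \<in> \<F> \<Longrightarrow> x \<in> C \<Longrightarrow> x \<in> C' \<Longrightarrow> C = C'"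
  using foliation by (auto simp: C1_foliation_def partition_on_def disjoint_def)

text \<open>
  The preimage in the strip of the curve through the projection of \<open>q\<close>; as the curve winds once
  around the cylinder, the preimage is connected.\<close>

definition leaf :: "real \<times> real \<Rightarrow> (real \<times> real) set" where
  "leaf q = {r \<in> tw.strip. \<exists>C\<in>\<F>. proj q \<in> C \<and> proj r \<in> C}"

lemma leaf_eq_curve: "C \<in> \<F> \<Longrightarrow> proj q \<in> C \<Longrightarrow> leaf q = {r \<in> tw.strip. proj r \<in> C}"
  unfolding leaf_def using leaves_disjoint by blast

lemma curve_ex: "q \<in> tw.strip \<Longrightarrow> \<exists>C\<in>\<F>. proj q \<in> C"
  using proj_strip leaves_cover by blast

lemma leaf_same:
  assumes "q' \<in> leaf q"
  shows "leaf q' = leaf q"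
proof -
  obtain C where C: "C \<in> \<F>" "proj q \<in> C" "proj q' \<in> C" using assms unfolding leaf_def by blast
  show ?thesis unfolding leaf_eq_curve[OF C(1,2)] leaf_eq_curve[OF C(1,3)] ..
qed

lemma leaf_refl: "q \<in> tw.strip \<Longrightarrow> q \<in> leaf q"
  using curve_ex[of q] unfolding leaf_def by blast

lemma foliated_chart:
  assumes "q \<in> tw.strip"
  obtains V \<phi> \<psi> where "open V" "q \<in> V" "homeomorphism V ({0<..<1::real} \<times> {0<..<1::real}) \<phi> \<psi>"
    "\<forall>C\<in>\<F>. \<forall>D\<in>components {q \<in> V. proj q \<in> C}. \<exists>h\<in>{0<..<1}. \<phi> ` D = {0<..<1} \<times> {h}"
proof -
  have "map_prod \<gamma> \<gamma> q \<in> phase_cylinder \<Gamma>" using proj_strip[OF assms] by (simp add: proj_def)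
  then have "\<exists>V \<phi> \<psi>. open V \<and> q \<in> V \<and> map_prod \<gamma> \<gamma> ` V \<subseteq> phase_cylinder \<Gamma> \<and>
          homeomorphism V ({0<..<1} \<times> {0<..<1}) \<phi> \<psi> \<and>
          C1_map_on V \<phi> \<and> C1_map_on ({0<..<1::real} \<times> {0<..<1::real}) \<psi> \<and>
          (\<forall>C\<in>\<F>. \<forall>D\<in>components {q\<in>V. map_prod \<gamma> \<gamma> q \<in> C}.
             \<exists>h\<in>{0<..<1}. \<phi> ` D = {0<..<1} \<times> {h})"
    using foliation unfolding C1_foliation_def by blast
  then obtain V \<phi> \<psi> where "open V" "q \<in> V" "map_prod \<gamma> \<gamma> ` V \<subseteq> phase_cylinder \<Gamma>"
     "homeomorphism V ({0<..<1::real} \<times> {0<..<1::real}) \<phi> \<psi>"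
     "\<forall>C\<in>\<F>. \<forall>D\<in>components {q\<in>V. map_prod \<gamma> \<gamma> q \<in> C}. \<exists>h\<in>{0<..<1}. \<phi> ` D = {0<..<1} \<times> {h}"
    by (elim exE conjE)
  then show ?thesis by (intro that[of V \<phi> \<psi>]) (simp_all add: proj_def)
qed

lemma connected_subset_of_component:
  assumes "connected J" "J \<subseteq> S" "J \<noteq> {}"
  shows "\<exists>D\<in>components S. J \<subseteq> D"
proof -
  obtain x where "x \<in> J" using assms by blast
  then have "J \<subseteq> connected_component_set S x" using assms by (intro connected_component_maximal) auto
  moreover have "connected_component_set S x \<in> components S" using \<open>x \<in> J\<close> assms by (auto simp: components_def)
  ultimately show ?thesis by blast
qed

text \<open>
  In a foliated chart let \<open>(u, h)\<close> be the coordinates of \<open>p\<close>. A point \<open>r\<close> near \<open>q\<close> has height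
  close to \<open>h\<close>, and the plaque of \<open>r\<close> is the full horizontal segment at that height. It contains a
  point above \<open>u\<close> close to \<open>p\<close>, which belongs to \<open>S\<close>, and hence \<open>r\<close> belongs to the saturated set
  \<open>S\<close>.\<close>

lemma saturated_along_plaque:
  assumes S: "\<And>q r. q \<in> S \<Longrightarrow> r \<in> leaf q \<Longrightarrow> r \<in> S" "S \<subseteq> tw.strip"
    and V: "open V" and hom: "homeomorphism V ({0<..<1::real} \<times> {0<..<1::real}) \<phi> \<psi>"
    and plaques: "\<And>C D. C \<in> \<F> \<Longrightarrow> D \<in> components {q \<in> V. proj q \<in> C} \<Longrightarrow> \<exists>h\<in>{0<..<1}. \<phi> ` D = {0<..<1} \<times> {h}"
    and C: "C \<in> \<F>" and J: "connected J" "J \<subseteq> {q \<in> V. proj q \<in> C}"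
    and p: "p \<in> J" "p \<in> interior S" and q: "q \<in> J" "q \<in> tw.strip"
  shows "q \<in> interior S"
proof -
  have \<phi>c: "continuous_on V \<phi>" and \<psi>c: "continuous_on ({0<..<1} \<times> {0<..<1}) \<psi>"
    and \<phi>V: "\<And>r. r \<in> V \<Longrightarrow> \<phi> r \<in> {0<..<1} \<times> {0<..<1}" and \<psi>\<phi>: "\<And>r. r \<in> V \<Longrightarrow> \<psi> (\<phi> r) = r"
    and \<phi>\<psi>: "\<And>s. s \<in> {0<..<1} \<times> {0<..<1} \<Longrightarrow> \<phi> (\<psi> s) = s"
    and \<psi>V: "\<And>s. s \<in> {0<..<1} \<times> {0<..<1} \<Longrightarrow> \<psi> s \<in> V"
    using hom unfolding homeomorphism_def by blast+
  obtain D where D: "D \<in> components {q \<in> V. proj q \<in> C}" "J \<subseteq> D" using connected_subset_of_component[OF J] p by blast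
  obtain h where h: "\<phi> ` D = {0<..<1} \<times> {h}" using plaques[OF C D(1)] by blast
  have pV: "p \<in> V" and qV: "q \<in> V" using J p q by auto
  define u where "u = fst (\<phi> p)"
  have \<phi>p: "\<phi> p = (u, h)" and \<phi>q: "snd (\<phi> q) = h"
  proof -
    have "\<phi> p \<in> {0<..<1} \<times> {h}" "\<phi> q \<in> {0<..<1} \<times> {h}" using D p q unfolding h[symmetric] by auto
    then show "\<phi> p = (u, h)" "snd (\<phi> q) = h" by (auto simp: u_def prod_eq_iff mem_Times_iff)
  qed
  have u: "u \<in> {0<..<1}" using \<phi>V[OF pV] \<phi>p by simp
  define W where "W = (V \<inter> tw.strip) \<inter> (\<lambda>r. \<psi> (u, snd (\<phi> r))) -` interior S"
  have us: "(u, snd (\<phi> r)) \<in> {0<..<1} \<times> {0<..<1}" if "r \<in> V" for r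
    using \<phi>V[OF that] u by (cases "\<phi> r") simp
  have "open W" unfolding W_def
  proof (rule continuous_open_preimage)
    show "open (V \<inter> tw.strip)" using V tw.open_strip by blast
    have "continuous_on V (\<lambda>r. \<psi> (u, snd (\<phi> r)))"
      by (rule continuous_on_compose2[OF \<psi>c]) (use us \<phi>c in \<open>auto intro!: continuous_intros\<close>)
    then show "continuous_on (V \<inter> tw.strip) (\<lambda>r. \<psi> (u, snd (\<phi> r)))" by (rule continuous_on_subset) auto
  qed auto
  moreover have "q \<in> W" using qV q p \<phi>q \<psi>\<phi>[OF pV] by (simp add: W_def \<phi>p)
  moreover have "W \<subseteq> S"
  proof
    fix r assume r: "r \<in> W"
    define r' where "r' = \<psi> (u, snd (\<phi> r))"
    have rV: "r \<in> V" and rs: "r \<in> tw.strip" and r'S: "r' \<in> S"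
      using r interior_subset by (auto simp: W_def r'_def)
    have r's: "r' \<in> tw.strip" using r'S S(2) by blast
    obtain C' where C': "C' \<in> \<F>" "proj r \<in> C'" using curve_ex[OF rs] by blast
    define D' where "D' = connected_component_set {q \<in> V. proj q \<in> C'} r"
    have rm: "r \<in> {q \<in> V. proj q \<in> C'}" using rV C' by simp
    have D': "D' \<in> components {q \<in> V. proj q \<in> C'}" unfolding D'_def components_def using rm by blast
    have "r \<in> D'" unfolding D'_def using rm by simp
    obtain h' where h': "\<phi> ` D' = {0<..<1} \<times> {h'}" using plaques[OF C'(1) D'] by blast
    have "\<phi> r \<in> \<phi> ` D'" using \<open>r \<in> D'\<close> by blast
    then have "\<phi> r \<in> {0<..<1} \<times> {h'}" unfolding h' .
    then have "(u, snd (\<phi> r)) \<in> \<phi> ` D'" unfolding h' using u by (simp add: mem_Times_iff)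
    then obtain d where d: "d \<in> D'" "(u, snd (\<phi> r)) = \<phi> d" by blast
    have dm: "d \<in> V" "proj d \<in> C'" using d(1) in_components_subset[OF D'] by auto
    then have "r' = d" using d(2) \<psi>\<phi>[of d] by (simp add: r'_def)
    then have "r \<in> leaf r'" using dm C' rs unfolding leaf_def by blast
    then show "r \<in> S" using S(1) r'S by blast
  qed
  ultimately show ?thesis using interior_maximal by blast
qed

text \<open>
  The parameters of a leaf at which it runs in the interior of the saturation form an open and
  closed set, since each plaque either lies in the interior or misses it.\<close>

lemma leaf_saturation_open:
  assumes "open V0" "V0 \<subseteq> tw.strip"
  shows "open (\<Union>q\<in>V0. leaf q)"
proof -
  define S where "S = (\<Union>q\<in>V0. leaf q)"
  have S_strip: "S \<subseteq> tw.strip" by (auto simp: S_def leaf_def)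
  have S_sat: "r \<in> S" if "q \<in> S" "r \<in> leaf q" for q r
  proof -
    obtain q0 where q0: "q0 \<in> V0" "q \<in> leaf q0" using \<open>q \<in> S\<close> by (auto simp: S_def)
    then have "r \<in> leaf q0" using leaf_same[OF q0(2)] \<open>r \<in> leaf q\<close> by simp
    then show ?thesis using q0(1) unfolding S_def by blast
  qed
  have "V0 \<subseteq> S" unfolding S_def using leaf_refl assms(2) by blast
  then have V0_int: "V0 \<subseteq> interior S" using assms(1) by (rule interior_maximal)
  have "r \<in> interior S" if rS: "r \<in> S" for r
  proof -
    obtain q0 C where q0: "q0 \<in> V0" "C \<in> \<F>" "proj q0 \<in> C" "proj r \<in> C" "r \<in> tw.strip"
      using rS unfolding S_def leaf_def by blast
    obtain c where c: "tw.invariant_line c" "range c = {q \<in> tw.strip. proj q \<in> C}"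
      using invariant_curve_lift[OF leaves_invariant[OF q0(2)]] by blast
    have cc: "continuous_on UNIV c" using c by (simp add: tw.invariant_line_def)
    have cs: "c \<sigma> \<in> tw.strip" "proj (c \<sigma>) \<in> C" for \<sigma> using c(2) by blast+
    define G where "G = {\<sigma>. c \<sigma> \<in> interior S}"
    have local: "\<exists>e>0. \<forall>\<tau> \<tau>'. \<bar>\<tau> - \<sigma>\<bar> < e \<and> \<bar>\<tau>' - \<sigma>\<bar> < e \<and> \<tau> \<in> G \<longrightarrow> \<tau>' \<in> G" for \<sigma>
    proof -
      obtain V \<phi> \<psi> where V: "open V" "c \<sigma> \<in> V" "homeomorphism V ({0<..<1::real} \<times> {0<..<1::real}) \<phi> \<psi>"
        "\<forall>C\<in>\<F>. \<forall>D\<in>components {q \<in> V. proj q \<in> C}. \<exists>h\<in>{0<..<1}. \<phi> ` D = {0<..<1} \<times> {h}"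
        by (rule foliated_chart[OF cs(1)[of \<sigma>]])
      have "open (c -` V)" using cc V(1) by (simp add: continuous_on_open_vimage)
      then obtain e where e: "e > 0" "ball \<sigma> e \<subseteq> c -` V" using V(2) open_contains_ball by blast
      show ?thesis
      proof (intro exI[of _ e] conjI allI impI e(1))
        fix \<tau> \<tau>' assume t: "\<bar>\<tau> - \<sigma>\<bar> < e \<and> \<bar>\<tau>' - \<sigma>\<bar> < e \<and> \<tau> \<in> G"
        then have tb: "\<tau> \<in> ball \<sigma> e" "\<tau>' \<in> ball \<sigma> e" by (auto simp: dist_real_def)
        have "c \<tau>' \<in> interior S"
        proof (rule saturated_along_plaque[where J = "c ` ball \<sigma> e" and p = "c \<tau>",
              OF S_sat S_strip V(1,3) V(4)[rule_format] q0(2)])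
          show "connected (c ` ball \<sigma> e)"
            by (intro connected_continuous_image continuous_on_subset[OF cc]) auto
          show "c ` ball \<sigma> e \<subseteq> {q \<in> V. proj q \<in> C}" using e(2) cs by auto
        qed (use t tb cs in \<open>auto simp: G_def\<close>)
        then show "\<tau>' \<in> G" by (simp add: G_def)
      qed
    qed
    have "open G"
      unfolding open_contains_ball
    proof (intro ballI)
      fix \<sigma> assume "\<sigma> \<in> G"
      then obtain e where "e > 0" "\<forall>\<tau>'. \<bar>\<tau>' - \<sigma>\<bar> < e \<longrightarrow> \<tau>' \<in> G" using local[of \<sigma>] by (metis abs_zero diff_self)
      then show "\<exists>e>0. ball \<sigma> e \<subseteq> G"
        by (intro exI[of _ e]) (auto simp: dist_real_def abs_minus_commute)
    qed
    moreover have "open (- G)"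
      unfolding open_contains_ball
    proof (intro ballI)
      fix \<sigma> assume "\<sigma> \<in> - G"
      then obtain e where "e > 0" "\<forall>\<tau>. \<bar>\<tau> - \<sigma>\<bar> < e \<longrightarrow> \<tau> \<notin> G" using local[of \<sigma>] by (metis abs_zero diff_self ComplD)
      then show "\<exists>e>0. ball \<sigma> e \<subseteq> - G"
        by (intro exI[of _ e]) (auto simp: dist_real_def abs_minus_commute)
    qed
    moreover have "G \<noteq> {}"
    proof -
      have "q0 \<in> range c" using c(2) q0 assms(2) by auto
      then show ?thesis using V0_int q0(1) by (auto simp: G_def)
    qed
    ultimately have "G = UNIV" using connectedD[OF connected_UNIV, of G "- G"] by auto
    moreover have "r \<in> range c" using c(2) q0 by auto
    ultimately show ?thesis by (auto simp: G_def)
  qed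
  then have "S \<subseteq> interior S" by blast
  then have "interior S = S" using interior_subset by blast
  then have "open S" using open_interior[of S] by simp
  then show ?thesis by (simp only: S_def)
qed

sublocale fol: invariant_foliation P \<kappa> L L1 L2 leaf
proof
  show "\<exists>c. tw.invariant_line c \<and> leaf q = range c" if "q \<in> tw.strip" for q
  proof -
    obtain C where C: "C \<in> \<F>" "proj q \<in> C" using curve_ex[OF \<open>q \<in> tw.strip\<close>] by blast
    show ?thesis using invariant_curve_lift[OF leaves_invariant[OF C(1)]] unfolding leaf_eq_curve[OF C] by blast
  qed
  show "q \<in> leaf q" if "q \<in> tw.strip" for q using that by (rule leaf_refl)
  show "leaf q' = leaf q" if "q \<in> tw.strip" "q' \<in> leaf q" for q q' using that(2) by (rule leaf_same)
qed (rule leaf_saturation_open)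

end

section \<open>Chords between a point and its image under a symmetry\<close>

context billiard_table
begin

context
  fixes B :: "plane \<Rightarrow> plane"
  assumes lin: "linear B" and B\<Gamma>: "\<And>x. x \<in> \<Gamma> \<Longrightarrow> B x \<in> \<Gamma>" and B_inj: "inj B"
begin

lemma B_nz: "v \<noteq> 0 \<Longrightarrow> B v \<noteq> 0"
  using B_inj lin by (metis injD linear_0)

lemma gauge_B: "g (B v) = g v"
proof (cases "v = 0")
  case True
  then show ?thesis using linear_0[OF lin] by simp
next
  case False
  obtain r t where rt: "r > 0" "v = r *\<^sub>R \<gamma> t" using polar[OF False] by blast
  obtain s where "B (\<gamma> t) = \<gamma> s" using B\<Gamma>[of "\<gamma> t"] range_\<gamma> by (metis \<gamma>_in rangeE)
  then have "B v = r *\<^sub>R \<gamma> s" using rt linear_cmul[OF lin] by simp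
  then show ?thesis using rt gauge_polar by simp
qed

text \<open>
  Differentiate \<open>g \<circ> B = g\<close>.\<close>

lemma N_B:
  assumes "v \<noteq> 0"
  shows "N (B v) \<bullet> B w = N v \<bullet> w"
proof -
  have bl: "bounded_linear B" using lin by (simp add: linear_conv_bounded_linear)
  have "((g \<circ> B) has_derivative ((\<lambda>w. N (B v) \<bullet> w) \<circ> B)) (at v)"
    using bounded_linear_imp_has_derivative[OF bl] gauge_deriv[OF B_nz[OF assms]] by (rule diff_chain_at)
  moreover have "g \<circ> B = g" by (auto simp: gauge_B)
  ultimately have d: "(g has_derivative ((\<lambda>w. N (B v) \<bullet> w) \<circ> B)) (at v)" by (simp only:)
  show ?thesis using fun_cong[OF has_derivative_unique[OF d gauge_deriv[OF assms]], of w] by simp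
qed

lemma tangent_B:
  assumes "\<gamma> s = B (\<gamma> t)"
  shows "\<exists>r. r \<noteq> 0 \<and> B (\<gamma>' t) = r *\<^sub>R \<gamma>' s"
proof -
  have "nv s \<bullet> B (\<gamma>' t) = N (B (\<gamma> t)) \<bullet> B (\<gamma>' t)" using N_polar[of 1 s] assms by simp
  also have "\<dots> = N (\<gamma> t) \<bullet> \<gamma>' t" using N_B[OF \<gamma>_nz] .
  also have "\<dots> = 0" using N_polar[of 1 t] by simp
  finally have "cross2 (B (\<gamma>' t)) (\<gamma>' s) = 0" using width_pos[of s] by (simp add: nv_inner)
  then have "cross2 (\<gamma>' s) (B (\<gamma>' t)) = 0" using cross2_swap[of "\<gamma>' s"] by simp
  then obtain r where r: "B (\<gamma>' t) = r *\<^sub>R \<gamma>' s" using cross2_0_parallel \<gamma>'_nz by blast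
  then have "r \<noteq> 0" using B_nz[OF \<gamma>'_nz[of t]] by auto
  then show ?thesis using r by blast
qed

text \<open>
  At a minimum the derivative \<open>N v \<bullet> (B (\<gamma>' t) - \<gamma>' t)\<close> vanishes, where \<open>v = \<gamma> s - \<gamma> t\<close>. By the
  invariance of the gauge, \<open>N v \<bullet> \<gamma>' t = N (B v) \<bullet> B (\<gamma>' t)\<close>, so that \<open>N v\<close> and \<open>N (B v)\<close> agree on
  \<open>B (\<gamma>' t)\<close>, which is tangent at \<open>\<gamma> s\<close>. This is the reflection law for the chords \<open>v\<close> and \<open>B v\<close>.\<close>

lemma critical_chord_reflects:
  assumes st: "\<gamma> s = B (\<gamma> t)" and us: "\<gamma> u = B (\<gamma> s)" and strip: "(t, s) \<in> tw.strip" "(s, u) \<in> tw.strip"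
    and crit: "\<And>\<tau>. g (B (\<gamma> t) - \<gamma> t) \<le> g (B (\<gamma> \<tau>) - \<gamma> \<tau>)"
  shows "tw.T (t, s) = (s, u)"
proof -
  have bl: "bounded_linear B" using lin by (simp add: linear_conv_bounded_linear)
  define v where "v = B (\<gamma> t) - \<gamma> t"
  have v: "v \<noteq> 0" using \<gamma>_neq[of t s] strip(1) st by (simp add: v_def tw.strip_iff)
  have "((\<lambda>\<tau>. g (B (\<gamma> \<tau>) - \<gamma> \<tau>)) has_real_derivative N v \<bullet> (B (\<gamma>' t) - \<gamma>' t)) (at t)"
    unfolding v_def
  proof (rule gauge_chain)
    show "((\<lambda>\<tau>. B (\<gamma> \<tau>) - \<gamma> \<tau>) has_vector_derivative (B (\<gamma>' t) - \<gamma>' t)) (at t)"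
      by (intro has_vector_derivative_diff bounded_linear.has_vector_derivative[OF bl] \<gamma>_deriv)
  qed (use v in \<open>simp add: v_def\<close>)
  then have "N v \<bullet> (B (\<gamma>' t) - \<gamma>' t) = 0"
    by (rule DERIV_local_min[where d = 1]) (use crit in auto)
  then have 1: "N v \<bullet> B (\<gamma>' t) = N v \<bullet> \<gamma>' t" by (simp add: inner_diff_right)
  have 2: "N (B v) \<bullet> B (\<gamma>' t) = N v \<bullet> \<gamma>' t" using N_B[OF v] .
  obtain r where r: "r \<noteq> 0" "B (\<gamma>' t) = r *\<^sub>R \<gamma>' s" using tangent_B[OF st] by blast
  have "r * (N v \<bullet> \<gamma>' s) = r * (N (B v) \<bullet> \<gamma>' s)" using 1 2 unfolding r(2) by simp
  then have "N v \<bullet> \<gamma>' s = N (B v) \<bullet> \<gamma>' s" using r(1) by simp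
  moreover have "B v = \<gamma> u - \<gamma> s" using us st linear_diff[OF lin] by (simp add: v_def)
  ultimately have "L1 s u = - L2 t s" using st by (simp add: L1_def L2_def v_def)
  then show ?thesis using strip(2) by (intro tw.T_eqI) (auto simp: tw.strip_iff)
qed

end

end

context integrable_table
begin

text \<open>
  Lift \<open>B\<close> to the map \<open>s\<close> of the parameters. Its orbit from a minimum \<open>t0\<close> of
  \<open>h t = g (B (\<gamma> t) - \<gamma> t)\<close> is a billiard orbit of length \<open>n * h t0\<close>, and it maximizes the length
  among the closed polygons with the same winding, to which the orbit of \<open>s\<close> from any other \<open>t\<close>
  belongs; that one has length \<open>n * h t\<close>. So the minimum of \<open>h\<close> is its maximum.\<close>

theorem symmetric_chords_constant:
  fixes B :: "plane \<Rightarrow> plane"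
  assumes lin: "linear B" and B\<Gamma>: "\<And>x. x \<in> \<Gamma> \<Longrightarrow> B x \<in> \<Gamma>" and Bn: "B ^^ n = id" "n \<ge> 1"
    and nofix: "\<And>x. x \<in> \<Gamma> \<Longrightarrow> B x \<noteq> x"
  shows "\<exists>c>0. \<forall>x\<in>\<Gamma>. g (B x - x) = c"
proof -
  have B_inj: "inj B"
  proof (rule injI)
    fix x y assume "B x = B y"
    moreover obtain k where k: "n = Suc k" using Bn(2) by (cases n) auto
    have "(B ^^ n) z = (B ^^ k) (B z)" for z by (simp add: k funpow_swap1)
    ultimately have "(B ^^ n) x = (B ^^ n) y" by simp
    then show "x = y" using Bn by simp
  qed
  note B = lin B\<Gamma> B_inj
  have Bc: "continuous_on UNIV B" using lin by (rule linear_continuous_on[OF linear_conv_bounded_linear[THEN iffD1]])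
  have "continuous_on UNIV (\<lambda>t. B (\<gamma> t))" by (rule continuous_on_compose2[OF Bc \<gamma>_cont]) simp
  then obtain s0 where s0: "continuous_on UNIV s0" "\<And>t. \<gamma> (s0 t) = B (\<gamma> t)"
    using curve_lift[of "\<lambda>t. B (\<gamma> t)"] B\<Gamma> by auto
  have "\<gamma> t \<noteq> \<gamma> (s0 t)" for t using s0(2)[of t] nofix[OF \<gamma>_in[of t]] by simp
  then obtain m where m: "\<And>t. (t, s0 t + of_int m * P) \<in> tw.strip"
    using strip_pair[OF continuous_on_id s0(1)] by (auto simp: id_def)
  define s where "s t = s0 t + of_int m * P" for t
  have s_cont: "continuous_on UNIV s" unfolding s_def by (intro continuous_intros s0)
  have s_strip: "(t, s t) \<in> tw.strip" for t using m by (simp add: s_def)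
  have s_\<gamma>: "\<gamma> (s t) = B (\<gamma> t)" for t using s0 by (simp add: s_def \<gamma>_shift_int)
  have sn_\<gamma>: "\<gamma> ((s ^^ i) t) = (B ^^ i) (\<gamma> t)" for i t by (induction i) (simp_all add: s_\<gamma>)
  have sn_cont: "continuous_on UNIV (s ^^ i)" for i
  proof (induction i)
    case (Suc i)
    then show ?case using continuous_on_compose2[OF s_cont Suc] by (simp add: o_def)
  qed (simp add: id_def)
  define h where "h t = g (B (\<gamma> t) - \<gamma> t)" for t
  have h_s: "h (s t) = h t" for t
  proof -
    have "h (s t) = g (B (B (\<gamma> t) - \<gamma> t))" using linear_diff[OF lin] by (simp add: h_def s_\<gamma>)
    then show ?thesis using gauge_B[OF B] by (simp add: h_def)
  qed
  have h_sn: "h ((s ^^ i) t) = h t" for i t by (induction i) (simp_all add: h_s)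
  have L_h: "L t (s t) = h t" for t by (simp add: L_def h_def s_\<gamma>)
  have h_cont: "continuous_on UNIV h" unfolding h_def
    by (intro continuous_on_compose2[OF gauge_cont[of UNIV]] continuous_intros continuous_on_compose2[OF Bc] \<gamma>_cont) auto
  have h_per: "h (t + of_int k * P) = h t" for t and k :: int by (simp add: h_def \<gamma>_shift_int)
  obtain t0 where t0: "\<And>t. h t0 \<le> h t"
  proof -
    have "\<exists>x\<in>{0..P}. \<forall>y\<in>{0..P}. h x \<le> h y"
      by (rule continuous_attains_inf) (use P_pos in \<open>auto intro: continuous_on_subset[OF h_cont]\<close>)
    then obtain t0 where t0: "t0 \<in> {0..P}" "\<And>t. t \<in> {0..P} \<Longrightarrow> h t0 \<le> h t" by blast
    have "h t0 \<le> h t" for t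
    proof -
      obtain k :: int where "0 \<le> t + of_int k * P" "t + of_int k * P < 0 + P" using reduce_mod by blast
      then show ?thesis using t0(2)[of "t + of_int k * P"] h_per by simp
    qed
    then show ?thesis using that by blast
  qed
  \<comment> \<open>\<open>h\<close> is constant along the orbits of \<open>s\<close>, so that all chords of the orbit are minima\<close>
  have T_s: "tw.T (t, s t) = (s t, s (s t))" if ht: "h t = h t0" for t
  proof (rule critical_chord_reflects[OF B])
    show "g (B (\<gamma> t) - \<gamma> t) \<le> g (B (\<gamma> \<tau>) - \<gamma> \<tau>)" for \<tau> using t0[of \<tau>] ht by (simp add: h_def)
  qed (simp_all add: s_\<gamma> s_strip)
  have orbit: "(tw.T ^^ i) (t0, s t0) = ((s ^^ i) t0, s ((s ^^ i) t0))" for i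
    by (induction i) (simp_all add: T_s h_sn)
  obtain j :: int where j: "\<And>t. (s ^^ n) t = t + of_int j * P"
  proof -
    have mult: "\<exists>k::int. (s ^^ n) t - t = of_int k * P" for t
    proof -
      have "\<gamma> ((s ^^ n) t) = \<gamma> t" by (simp add: sn_\<gamma> Bn)
      then obtain k :: int where "(s ^^ n) t = t + of_int k * P" using \<gamma>_eq_iff by blast
      then show ?thesis by (intro exI[of _ k]) simp
    qed
    obtain j :: int where j: "(s ^^ n) 0 - 0 = of_int j * P" using mult by blast
    have const: "(s ^^ n) t - t = (s ^^ n) 0 - 0" for t
      by (rule integer_multiple_constant[of UNIV "\<lambda>t. (s ^^ n) t - t" P t 0])
        (use mult P_pos in \<open>auto intro!: continuous_intros sn_cont\<close>)
    have "(s ^^ n) t = t + of_int j * P" for t using const[of t] j by linarith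
    then show ?thesis using that by blast
  qed
  have per: "(tw.T ^^ n) (t0, s t0) = tw.shift j (t0, s t0)"
  proof -
    obtain k where k: "((s ^^ n) t0, s ((s ^^ n) t0)) = tw.shift k (t0, s t0)"
      using proj_eq_strip[of "((s ^^ n) t0, s ((s ^^ n) t0))" "(t0, s t0)"] s_strip sn_\<gamma>[of n t0] s_\<gamma> Bn by auto
    then have "(s ^^ n) t0 = t0 + of_int k * P" by (simp add: tw.shift_def)
    then have "k = j" using j[of t0] P_pos by simp
    then show ?thesis using k orbit by simp
  qed
  have "h t \<le> h t0" for t
  proof -
    have "(\<Sum>i<n. L ((s ^^ i) t) ((s ^^ Suc i) t))
        \<le> (\<Sum>i<n. L (fst ((tw.T ^^ i) (t0, s t0))) (snd ((tw.T ^^ i) (t0, s t0))))"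
      by (rule fol.periodic_orbits_maximize[OF s_strip per]) (simp_all add: s_strip j)
    then have "real n * h t \<le> real n * h t0" by (simp add: orbit L_h h_sn)
    then show ?thesis using Bn(2) by simp
  qed
  then have "h t = h t0" for t using t0 by (simp add: order_antisym)
  moreover have "h t0 > 0" unfolding h_def using nofix[OF \<gamma>_in[of t0]] by (intro gauge_pos) simp
  moreover have "g (B x - x) = h t0" if "x \<in> \<Gamma>" for x
  proof -
    obtain t where "x = \<gamma> t" using \<open>x \<in> \<Gamma>\<close> range_\<gamma> by blast
    then show ?thesis using calculation(1)[of t] by (simp add: h_def)
  qed
  ultimately show ?thesis by blast
qed

end

section \<open>Linear maps of finite order\<close>

text \<open>
  The inner product of the conjugate radii at \<open>t\<close> changes its sign when \<open>t\<close> increases by \<open>\<pi> / 2\<close>.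
  So some pair of conjugate radii is orthogonal, and these are the half axes.\<close>

lemma is_ellipse_range:
  fixes p q :: plane
  assumes indep: "\<And>a b. a *\<^sub>R p + b *\<^sub>R q = 0 \<Longrightarrow> a = 0 \<and> b = 0"
  shows "is_ellipse (range (\<lambda>\<theta>. cos \<theta> *\<^sub>R p + sin \<theta> *\<^sub>R q))"
proof -
  define p' where "p' t = cos t *\<^sub>R p + sin t *\<^sub>R q" for t
  define q' where "q' t = (- sin t) *\<^sub>R p + cos t *\<^sub>R q" for t
  define F where "F t = p' t \<bullet> q' t" for t
  have "continuous_on {0..pi / 2} F" unfolding F_def p'_def q'_def by (intro continuous_intros)
  moreover have F0: "F 0 = p \<bullet> q" and F1: "F (pi / 2) = - (p \<bullet> q)"
    by (simp_all add: F_def p'_def q'_def inner_commute)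
  ultimately obtain t where t: "F t = 0"
    using IVT'[of F 0 0 "pi / 2"] IVT2'[of F "pi / 2" 0 0] by (cases "p \<bullet> q \<le> 0") auto
  have nz: "p' t \<noteq> 0" "q' t \<noteq> 0"
  proof -
    have "cos t \<noteq> 0 \<or> sin t \<noteq> 0" using sin_zero_norm_cos_one[of t] by auto
    moreover have "cos t = 0 \<and> sin t = 0" if "p' t = 0"
      using indep[of "cos t" "sin t"] that unfolding p'_def .
    moreover have "- sin t = 0 \<and> cos t = 0" if "q' t = 0"
      using indep[of "- sin t" "cos t"] that unfolding q'_def .
    ultimately show "p' t \<noteq> 0" "q' t \<noteq> 0" by fastforce+
  qed
  have rot: "cos (t + s) *\<^sub>R p + sin (t + s) *\<^sub>R q = cos s *\<^sub>R p' t + sin s *\<^sub>R q' t" for s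
    by (simp add: p'_def q'_def cos_add sin_add algebra_simps)
  define u where "u = (1 / norm (p' t)) *\<^sub>R p' t"
  define v where "v = (1 / norm (q' t)) *\<^sub>R q' t"
  have "range (\<lambda>\<theta>. cos \<theta> *\<^sub>R p + sin \<theta> *\<^sub>R q) = range (\<lambda>s. cos s *\<^sub>R p' t + sin s *\<^sub>R q' t)"
  proof -
    have "range (\<lambda>\<theta>. cos \<theta> *\<^sub>R p + sin \<theta> *\<^sub>R q) = (\<lambda>\<theta>. cos \<theta> *\<^sub>R p + sin \<theta> *\<^sub>R q) ` range (\<lambda>s. t + s)"
      by simp
    then show ?thesis by (simp only: image_image rot)
  qed
  also have "\<dots> = range (\<lambda>\<theta>. 0 + (norm (p' t) * cos \<theta>) *\<^sub>R u + (norm (q' t) * sin \<theta>) *\<^sub>R v)"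
    using nz by (simp add: u_def v_def)
  finally have "range (\<lambda>\<theta>. cos \<theta> *\<^sub>R p + sin \<theta> *\<^sub>R q)
      = range (\<lambda>\<theta>. 0 + (norm (p' t) * cos \<theta>) *\<^sub>R u + (norm (q' t) * sin \<theta>) *\<^sub>R v)" .
  moreover have "norm u = 1" "norm v = 1" "u \<bullet> v = 0" "norm (p' t) > 0" "norm (q' t) > 0"
    using nz t by (simp_all add: u_def v_def F_def)
  ultimately show ?thesis unfolding is_ellipse_def by blast
qed

text \<open>
  The Cholesky decomposition of the form in the standard basis.\<close>

lemma pos_definite_form_is_squared_norm:
  fixes Q :: "plane \<Rightarrow> plane \<Rightarrow> real"
  assumes "\<And>x. linear (Q x)" "\<And>x y. Q x y = Q y x" "\<And>x. x \<noteq> 0 \<Longrightarrow> Q x x > 0"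
  shows "\<exists>E::plane \<Rightarrow> complex. linear E \<and> bij E \<and> (\<forall>x. (norm (E x))\<^sup>2 = Q x x)"
proof -
  define e1 where "e1 = (axis 1 1 :: plane)"
  define e2 where "e2 = (axis 2 1 :: plane)"
  have ex: "x = x $ 1 *\<^sub>R e1 + x $ 2 *\<^sub>R e2" for x
    by (simp add: e1_def e2_def vec_eq_iff forall_2 axis_def)
  have lin2: "Q z (a *\<^sub>R e1 + b *\<^sub>R e2) = a * Q z e1 + b * Q z e2" for z a b
    using linear_add[OF assms(1)] linear_cmul[OF assms(1)] by simp
  have Qe: "Q (a *\<^sub>R e1 + b *\<^sub>R e2) (a *\<^sub>R e1 + b *\<^sub>R e2) = a\<^sup>2 * Q e1 e1 + 2 * a * b * Q e1 e2 + b\<^sup>2 * Q e2 e2" for a b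
  proof -
    have "Q (a *\<^sub>R e1 + b *\<^sub>R e2) (a *\<^sub>R e1 + b *\<^sub>R e2)
        = a * Q e1 (a *\<^sub>R e1 + b *\<^sub>R e2) + b * Q e2 (a *\<^sub>R e1 + b *\<^sub>R e2)"
      unfolding lin2[of "a *\<^sub>R e1 + b *\<^sub>R e2"] using assms(2)[of "a *\<^sub>R e1 + b *\<^sub>R e2"] by simp
    also have "\<dots> = a\<^sup>2 * Q e1 e1 + 2 * a * b * Q e1 e2 + b\<^sup>2 * Q e2 e2"
      unfolding lin2 using assms(2)[of e2 e1] by (simp add: algebra_simps power2_eq_square)
    finally show ?thesis .
  qed
  have "e1 \<noteq> 0" by (simp add: e1_def axis_eq_0_iff)
  then have q11: "Q e1 e1 > 0" by (rule assms(3))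
  have "Q e1 e2 *\<^sub>R e1 + (- Q e1 e1) *\<^sub>R e2 \<noteq> 0"
  proof
    assume "Q e1 e2 *\<^sub>R e1 + (- Q e1 e1) *\<^sub>R e2 = 0"
    then have "(Q e1 e2 *\<^sub>R e1 + (- Q e1 e1) *\<^sub>R e2) $ 2 = 0" by simp
    then show False using q11 by (simp add: e1_def e2_def axis_def)
  qed
  from assms(3)[OF this] have "Q e1 e1 * (Q e1 e1 * Q e2 e2 - (Q e1 e2)\<^sup>2) > 0"
    unfolding Qe by (simp add: algebra_simps power2_eq_square)
  then have disc: "Q e1 e1 * Q e2 e2 - (Q e1 e2)\<^sup>2 > 0" using q11 by (simp add: zero_less_mult_iff)
  define \<alpha> where "\<alpha> = sqrt (Q e1 e1)"
  define \<beta> where "\<beta> = Q e1 e2 / \<alpha>"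
  define \<delta> where "\<delta> = sqrt (Q e2 e2 - \<beta>\<^sup>2)"
  have \<alpha>: "\<alpha> > 0" "\<alpha>\<^sup>2 = Q e1 e1" using q11 by (simp_all add: \<alpha>_def)
  have \<beta>: "\<alpha> * \<beta> = Q e1 e2" using \<alpha> by (simp add: \<beta>_def)
  have "Q e2 e2 - \<beta>\<^sup>2 > 0"
  proof -
    have "\<alpha>\<^sup>2 * (Q e2 e2 - \<beta>\<^sup>2) > 0"
      using disc unfolding \<alpha>(2)[symmetric] \<beta>[symmetric] by (simp add: algebra_simps power_mult_distrib)
    then show ?thesis using \<alpha> q11 by (auto simp: zero_less_mult_iff)
  qed
  then have \<delta>: "\<delta> > 0" "\<delta>\<^sup>2 = Q e2 e2 - \<beta>\<^sup>2" by (simp_all add: \<delta>_def)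
  define E where "E x = Complex (\<alpha> * x $ 1 + \<beta> * x $ 2) (\<delta> * x $ 2)" for x :: plane
  have "linear E" by (rule linearI) (simp_all add: E_def complex_eq_iff algebra_simps)
  moreover have "bij E"
  proof (rule bijI')
    fix x y show "(E x = E y) = (x = y)"
      using \<alpha> \<delta> by (auto simp: E_def vec_eq_iff forall_2)
  next
    fix z :: complex
    have "E (vector [(Re z - \<beta> * (Im z / \<delta>)) / \<alpha>, Im z / \<delta>]) = z"
      using \<alpha> \<delta> by (simp add: E_def complex_eq_iff)
    then show "\<exists>x. z = E x" by metis
  qed
  moreover have "(norm (E x))\<^sup>2 = Q x x" for x
  proof -
    have "(norm (E x))\<^sup>2 = \<alpha>\<^sup>2 * (x $ 1)\<^sup>2 + 2 * (\<alpha> * \<beta>) * x $ 1 * x $ 2 + (\<beta>\<^sup>2 + \<delta>\<^sup>2) * (x $ 2)\<^sup>2"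
      unfolding cmod_power2 E_def complex.sel by (simp add: algebra_simps power2_eq_square)
    also have "\<dots> = (x $ 1)\<^sup>2 * Q e1 e1 + 2 * x $ 1 * x $ 2 * Q e1 e2 + (x $ 2)\<^sup>2 * Q e2 e2"
      using \<alpha> \<beta> \<delta> by (simp add: algebra_simps)
    also have "\<dots> = Q x x" using Qe[of "x $ 1" "x $ 2"] by (simp flip: ex)
    finally show ?thesis .
  qed
  ultimately show ?thesis by blast
qed

text \<open>
  The images of \<open>1\<close> and \<open>\<i>\<close> are orthonormal, as one sees from the norms of the images of \<open>1\<close>, \<open>\<i>\<close>
  and \<open>1 + \<i>\<close>.\<close>

lemma linear_isometry_complex:
  assumes lin: "linear R" and iso: "\<And>z::complex. norm (R z) = norm z"
  shows "(\<exists>w. norm w = 1 \<and> (\<forall>z. R z = w * z)) \<or> (\<exists>w. norm w = 1 \<and> (\<forall>z. R z = w * cnj z))"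
proof -
  define w where "w = R 1"
  define t where "t = R \<i>"
  have w: "norm w = 1" and t: "norm t = 1" using iso[of 1] iso[of \<i>] by (simp_all add: w_def t_def)
  have Rz: "R z = of_real (Re z) * w + of_real (Im z) * t" for z
  proof -
    have "z = Re z *\<^sub>R 1 + Im z *\<^sub>R \<i>" by (simp add: complex_eq_iff)
    then have "R z = R (Re z *\<^sub>R 1 + Im z *\<^sub>R \<i>)" by simp
    also have "\<dots> = Re z *\<^sub>R w + Im z *\<^sub>R t" using linear_add[OF lin] linear_cmul[OF lin] by (simp add: w_def t_def)
    finally show ?thesis by (simp add: scaleR_conv_of_real)
  qed
  have "norm (w + t) = norm (1 + \<i>)" using iso[of "1 + \<i>"] Rz[of "1 + \<i>"] by simp
  then have "(norm (w + t))\<^sup>2 = 2" by (simp add: cmod_def)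
  then have "(Re w + Re t)\<^sup>2 + (Im w + Im t)\<^sup>2 = 2" unfolding cmod_power2 by simp
  moreover have "(Re w)\<^sup>2 + (Im w)\<^sup>2 = 1" "(Re t)\<^sup>2 + (Im t)\<^sup>2 = 1" using w t by (simp_all add: cmod_def)
  ultimately have orth: "Re w * Re t + Im w * Im t = 0"
    by (simp add: power2_eq_square algebra_simps)
  define s where "s = t * cnj w"
  have "Re s = 0" using orth by (simp add: s_def algebra_simps)
  moreover have "norm s = 1" using w t by (simp add: s_def norm_mult)
  ultimately have "Im s = 1 \<or> Im s = -1" by (auto simp: cmod_def abs_if split: if_splits)
  then have "s = \<i> \<or> s = - \<i>" using \<open>Re s = 0\<close> by (auto simp: complex_eq_iff)
  moreover have "t = s * w"
  proof -
    have "cnj w * w = 1" using w by (metis complex_norm_square mult.commute of_real_1 power_one)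
    then show ?thesis by (simp add: s_def mult.assoc)
  qed
  ultimately have "t = \<i> * w \<or> t = - \<i> * w" by auto
  then show ?thesis
  proof
    assume "t = \<i> * w"
    then have "R z = w * z" for z using Rz[of z] by (simp add: complex_eq_iff algebra_simps)
    then show ?thesis using w by blast
  next
    assume "t = - \<i> * w"
    then have "R z = w * cnj z" for z using Rz[of z] by (simp add: complex_eq_iff algebra_simps)
    then show ?thesis using w by blast
  qed
qed

text \<open>
  The average of the inner product over the powers of \<open>A\<close> is invariant, and so \<open>A\<close> is an isometry
  in suitable coordinates. It is not a reflection because reflections have order two.\<close>

lemma finite_order_conjugate_rotation:
  fixes A :: "plane \<Rightarrow> plane"
  assumes lin: "linear A" and ord: "has_order A k" and k: "k \<ge> 3"
  shows "\<exists>(E :: plane \<Rightarrow> complex) w. linear E \<and> bij E \<and> (\<forall>x. E (A x) = w * E x) \<and> w ^ k = 1 \<and> (\<forall>j. 0 < j \<and> j < k \<longrightarrow> w ^ j \<noteq> 1)"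
proof -
  have Ak: "A ^^ k = id" and min: "\<And>j. 0 < j \<Longrightarrow> j < k \<Longrightarrow> A ^^ j \<noteq> id" using ord by (auto simp: has_order_def)
  have linp: "linear (A ^^ i)" for i
  proof (induction i)
    case (Suc i)
    then show ?case using linear_compose[OF Suc lin] by (simp add: o_def)
  qed (simp add: linear_id[unfolded id_def] id_def)
  define Q where "Q x y = (\<Sum>i<k. (A ^^ i) x \<bullet> (A ^^ i) y)" for x y
  have Q_lin: "linear (Q x)" for x
    unfolding Q_def
    by (rule linearI) (simp_all add: linear_add[OF linp] linear_cmul[OF linp] inner_add_right sum.distrib sum_distrib_left)
  have Q_sym: "Q x y = Q y x" for x y by (simp add: Q_def inner_commute)
  have Q_pos: "Q x x > 0" if "x \<noteq> 0" for x
  proof -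
    have "(\<Sum>i\<in>{0}. (A ^^ i) x \<bullet> (A ^^ i) x) \<le> Q x x" unfolding Q_def using k by (intro sum_mono2) auto
    then show ?thesis using that by simp (metis inner_gt_zero_iff order_less_le_trans)
  qed
  have Q_A: "Q (A x) (A x) = Q x x" for x
  proof -
    have "Q (A x) (A x) = (\<Sum>i<k. (A ^^ Suc i) x \<bullet> (A ^^ Suc i) x)" by (simp add: Q_def funpow_swap1)
    also have "\<dots> = Q x x + (A ^^ k) x \<bullet> (A ^^ k) x - (A ^^ 0) x \<bullet> (A ^^ 0) x"
      unfolding Q_def using sum.lessThan_Suc_shift[of "\<lambda>i. (A ^^ i) x \<bullet> (A ^^ i) x" k]
        sum.lessThan_Suc[of "\<lambda>i. (A ^^ i) x \<bullet> (A ^^ i) x" k] by simp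
    finally show ?thesis by (simp add: Ak)
  qed
  obtain E :: "plane \<Rightarrow> complex" where E: "linear E" "bij E" "\<And>x. (norm (E x))\<^sup>2 = Q x x"
    using pos_definite_form_is_squared_norm[OF Q_lin Q_sym Q_pos] by blast
  have Ei: "E (inv E z) = z" "inv E (E x) = x" for z x
    using E(2) by (simp_all add: bij_is_surj surj_f_inv_f bij_is_inj)
  have lin_inv: "linear (inv E)"
    by (rule linearI) (metis Ei linear_add[OF E(1)], metis Ei linear_cmul[OF E(1)])
  define R where "R z = E (A (inv E z))" for z
  have "linear R" unfolding R_def
    using linear_compose[OF linear_compose[OF lin_inv lin] E(1)] by (simp add: o_def)
  moreover have "norm (R z) = norm z" for z
  proof -
    have "(norm (R z))\<^sup>2 = (norm z)\<^sup>2" unfolding R_def E(3) Q_A using E(3)[of "inv E z"] Ei by simp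
    then show ?thesis by (simp add: power2_eq_iff_nonneg)
  qed
  ultimately consider w where "norm w = 1" "\<And>z. R z = w * z" | w where "norm w = 1" "\<And>z. R z = w * cnj z"
    using linear_isometry_complex[of R] by blast
  then show ?thesis
  proof cases
    case 1
    have EA: "E (A x) = w * E x" for x using 1(2)[of "E x"] Ei by (simp add: R_def)
    have EAj: "E ((A ^^ j) x) = w ^ j * E x" for j x by (induction j) (simp_all add: EA)
    have eq: "A ^^ j = id \<longleftrightarrow> w ^ j = 1" for j
    proof
      assume "A ^^ j = id"
      then have "E (inv E 1) = w ^ j * E (inv E 1)" using EAj[of j "inv E 1"] by simp
      then show "w ^ j = 1" by (simp add: Ei)
    next
      assume "w ^ j = 1"
      then have "E ((A ^^ j) x) = E x" for x by (simp add: EAj)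
      then show "A ^^ j = id" using E(2) by (auto simp: bij_def inj_def fun_eq_iff)
    qed
    show ?thesis using E(1,2) EA eq Ak min by (intro exI[of _ E] exI[of _ w]) auto
  next
    case 2
    have EA: "E (A x) = w * cnj (E x)" for x using 2(2)[of "E x"] Ei by (simp add: R_def)
    have "w * cnj w = 1" using 2(1) by (metis complex_norm_square of_real_1 power_one)
    then have "E (A (A x)) = E x" for x by (simp add: EA)
    then have "A ^^ 2 = id" using E(2) by (auto simp: bij_def inj_def fun_eq_iff numeral_2_eq_2)
    then show ?thesis using min[of 2] k by simp
  qed
qed

section \<open>From one rotational symmetry to all\<close>

text \<open>
  The orbit of a point under the rotation has centroid zero, so that zero belongs to the closed
  convex region. If it were on \<open>\<Gamma>\<close>, then the orbit of another point of \<open>\<Gamma>\<close> would lie strictly on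
  one side of the tangent line at zero, and so would its centroid.\<close>

lemma (in convex_table) zero_inside_of_rotation:
  assumes E: "linear E" "bij (E :: plane \<Rightarrow> complex)" and EA: "\<And>x. E (A x) = w * E x"
    and A\<Gamma>: "\<And>x. x \<in> \<Gamma> \<Longrightarrow> A x \<in> \<Gamma>" and w: "w ^ k = 1" "w \<noteq> 1" and k: "k > 0"
  shows "0 \<in> inside \<Gamma>"
proof -
  have E_inj: "E x = E y \<Longrightarrow> x = y" for x y using E(2) by (simp add: bij_def inj_def)
  have EAi: "E ((A ^^ i) x) = w ^ i * E x" for i x by (induction i) (simp_all add: EA)
  have Ai\<Gamma>: "(A ^^ i) x \<in> \<Gamma>" if "x \<in> \<Gamma>" for i x using that A\<Gamma> by (induction i) simp_all
  have sum0: "(\<Sum>i<k. (A ^^ i) x) = 0" for x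
  proof (rule E_inj)
    have "E (\<Sum>i<k. (A ^^ i) x) = (\<Sum>i<k. w ^ i) * E x"
      by (simp add: linear_sum[OF E(1)] EAi sum_distrib_right)
    also have "(\<Sum>i<k. w ^ i) = 0" using geometric_sum[OF w(2), of k] w(1) by simp
    finally show "E (\<Sum>i<k. (A ^^ i) x) = E 0" using linear_0[OF E(1)] by simp
  qed
  have conv: "convex (\<Gamma> \<union> K)"
    unfolding convex_contains_open_segment
  proof (intro ballI)
    fix x y assume "x \<in> \<Gamma> \<union> K" "y \<in> \<Gamma> \<union> K"
    then show "open_segment x y \<subseteq> \<Gamma> \<union> K" using segment_inside[of x y] by (cases "x = y") auto
  qed
  have "(\<Sum>i<k. (1 / real k) *\<^sub>R (A ^^ i) (\<gamma> 0)) \<in> \<Gamma> \<union> K"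
    using Ai\<Gamma>[OF \<gamma>_in] k by (intro convex_sum[OF _ conv]) auto
  then have mem: "0 \<in> \<Gamma> \<union> K" using sum0[of "\<gamma> 0"] by (simp flip: scaleR_sum_right)
  have "0 \<notin> \<Gamma>"
  proof
    assume "0 \<in> \<Gamma>"
    then obtain t where t: "\<gamma> t = 0" using range_\<gamma> by (metis rangeE)
    have pos: "cross2 (\<gamma>' t) x > 0" if "x \<in> \<Gamma>" "x \<noteq> 0" for x
    proof -
      have "(1 / 2) *\<^sub>R x \<in> open_segment 0 x" using that by (auto simp: in_segment intro!: exI[of _ "1 / 2"])
      then have "(1 / 2) *\<^sub>R x \<in> K" using segment_inside[of 0 x] \<open>0 \<in> \<Gamma>\<close> that by auto
      then show ?thesis using left_of_tangent[of "(1 / 2) *\<^sub>R x" t] t by simp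
    qed
    have "\<gamma> (t + P / 2) \<noteq> \<gamma> t" using \<gamma>_neq[of t "t + P / 2"] P_pos by simp
    then obtain s where s: "\<gamma> s \<noteq> 0" using t by metis
    have lin: "linear (cross2 (\<gamma>' t))" by (rule linearI) simp_all
    have "(\<Sum>i<k. cross2 (\<gamma>' t) ((A ^^ i) (\<gamma> s))) = 0"
      using linear_sum[OF lin, of "\<lambda>i. (A ^^ i) (\<gamma> s)" "{..<k}"] sum0[of "\<gamma> s"] by simp
    moreover have "cross2 (\<gamma>' t) ((A ^^ i) (\<gamma> s)) > 0" for i
    proof (rule pos)
      have "w \<noteq> 0" using w(1) k by (cases "w = 0") (auto simp: power_0_left)
      moreover have "E (\<gamma> s) \<noteq> 0" using s E_inj[of "\<gamma> s" 0] linear_0[OF E(1)] by auto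
      ultimately have "E ((A ^^ i) (\<gamma> s)) \<noteq> 0" by (simp add: EAi)
      then show "(A ^^ i) (\<gamma> s) \<noteq> 0" using linear_0[OF E(1)] by auto
    qed (rule Ai\<Gamma>[OF \<gamma>_in])
    then have "(\<Sum>i<k. cross2 (\<gamma>' t) ((A ^^ i) (\<gamma> s))) > 0" using k by (intro sum_pos) auto
    ultimately show False by simp
  qed
  then show ?thesis using mem by blast
qed

context integrable_table
begin

context
  fixes E :: "plane \<Rightarrow> complex"
  assumes E_lin: "linear E" and E_bij: "bij E"
begin

lemma E_inj: "E x = E y \<Longrightarrow> x = y"
  using E_bij by (simp add: bij_def inj_def)

lemma E_ex: "\<exists>x. E x = z"
  using E_bij by (metis bij_pointE)

lemma E_scale: "E (r *\<^sub>R x) = of_real r * E x"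
  using linear_cmul[OF E_lin] by (simp add: scaleR_conv_of_real)

lemma E_0_iff: "E x = 0 \<longleftrightarrow> x = 0"
  using E_inj[of x 0] linear_0[OF E_lin] by auto

text \<open>
  Multiplication by \<open>c\<close>, in the coordinates \<open>E\<close>, maps \<open>\<Gamma>\<close> into itself.\<close>

definition curve_rot :: "complex \<Rightarrow> bool" where
  "curve_rot c \<longleftrightarrow> (\<forall>x\<in>\<Gamma>. \<exists>y\<in>\<Gamma>. E y = c * E x)"

lemma curve_rotE:
  assumes "curve_rot c" "x \<in> \<Gamma>"
  obtains y where "y \<in> \<Gamma>" "E y = c * E x"
  using assms unfolding curve_rot_def by blast

lemma curve_rot_mult: "curve_rot c \<Longrightarrow> curve_rot d \<Longrightarrow> curve_rot (c * d)"
  unfolding curve_rot_def by (metis mult.assoc)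

lemma curve_rot_1: "curve_rot 1"
  unfolding curve_rot_def by auto

lemma curve_rot_power: "curve_rot c \<Longrightarrow> curve_rot (c ^ n)"
  by (induction n) (auto intro: curve_rot_mult curve_rot_1)

lemma \<Gamma>_nz: "x \<in> \<Gamma> \<Longrightarrow> x \<noteq> 0"
  using range_\<gamma> \<gamma>_nz by auto

lemma gauge_\<Gamma>: "x \<in> \<Gamma> \<Longrightarrow> g x = 1"
proof -
  assume "x \<in> \<Gamma>"
  then obtain t where "x = \<gamma> t" using range_\<gamma> by (metis rangeE)
  then show "g x = 1" using gauge_\<gamma> by simp
qed

lemma gauge_1_in: "g x = 1 \<Longrightarrow> x \<in> \<Gamma>"
proof -
  assume *: "g x = 1"
  then have "x \<noteq> 0" by auto
  then obtain r t where rt: "r > 0" "x = r *\<^sub>R \<gamma> t" using polar by blast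
  then have "r = 1" using * gauge_polar by simp
  then show "x \<in> \<Gamma>" using rt by simp
qed

lemma ray_once: "x \<in> \<Gamma> \<Longrightarrow> r *\<^sub>R x \<in> \<Gamma> \<Longrightarrow> r > 0 \<Longrightarrow> r = 1"
  using gauge_\<Gamma>[of x] gauge_\<Gamma>[of "r *\<^sub>R x"] gauge_scale[of r x] by simp

lemma on_ray: "z \<noteq> 0 \<Longrightarrow> \<exists>x\<in>\<Gamma>. \<exists>r>0. z = of_real r * E x"
proof -
  assume "z \<noteq> 0"
  obtain v where v: "E v = z" using E_ex by blast
  then have "v \<noteq> 0" using \<open>z \<noteq> 0\<close> E_0_iff by auto
  then obtain r t where "r > 0" "v = r *\<^sub>R \<gamma> t" using polar by blast
  then show ?thesis using v E_scale by (intro bexI[of _ "\<gamma> t"]) auto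
qed

lemma curve_rot_inverse:
  assumes "curve_rot c" "c \<noteq> 0"
  shows "curve_rot (1 / c)"
  unfolding curve_rot_def
proof
  fix x assume x: "x \<in> \<Gamma>"
  then have "1 / c * E x \<noteq> 0" using assms(2) \<Gamma>_nz E_0_iff by simp
  then obtain y r where y: "y \<in> \<Gamma>" "r > 0" "1 / c * E x = of_real r * E y" using on_ray by blast
  obtain z where z: "z \<in> \<Gamma>" "E z = c * E y" using curve_rotE[OF assms(1) y(1)] by blast
  have "E x = of_real r * E z" using y(3) z(2) assms(2) by (simp add: field_simps)
  then have "x = r *\<^sub>R z" using E_inj E_scale by metis
  then have "r = 1" using ray_once z x y(2) by blast
  then show "\<exists>y\<in>\<Gamma>. E y = 1 / c * E x" using y by auto
qed

text \<open>
  The powers of \<open>c\<close> and of its inverse keep a point of \<open>\<Gamma>\<close> in a bounded set.\<close>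

lemma curve_rot_modulus:
  assumes c: "curve_rot c" "c \<noteq> 0"
  shows "norm c = 1"
proof -
  have contE: "continuous_on UNIV E" using E_lin by (rule linear_continuous_on[OF linear_conv_bounded_linear[THEN iffD1]])
  have "bounded (E ` \<Gamma>)"
    by (intro compact_imp_bounded compact_continuous_image continuous_on_subset[OF contE] compact_\<Gamma>) auto
  then obtain M where M: "\<And>x. x \<in> \<Gamma> \<Longrightarrow> norm (E x) \<le> M" unfolding bounded_iff by auto
  have le: "norm c \<le> 1" if c: "curve_rot c" for c
  proof (rule ccontr)
    assume "\<not> norm c \<le> 1"
    have pos: "norm (E (\<gamma> 0)) > 0" using \<gamma>_nz E_0_iff by simp
    obtain n where "M / norm (E (\<gamma> 0)) < norm c ^ n" using real_arch_pow \<open>\<not> norm c \<le> 1\<close> by (metis not_le)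
    then have "M < norm (c ^ n * E (\<gamma> 0))" using pos by (simp add: norm_mult norm_power field_simps)
    moreover obtain y where "y \<in> \<Gamma>" "E y = c ^ n * E (\<gamma> 0)" using curve_rotE[OF curve_rot_power[OF c] \<gamma>_in] by blast
    ultimately show False using M by (metis not_le)
  qed
  have "norm (1 / c) \<le> 1" by (rule le[OF curve_rot_inverse[OF c]])
  then show ?thesis using le[OF c(1)] c(2) by (simp add: norm_divide field_simps)
qed

text \<open>
  All the chords from \<open>x\<close> to \<open>B x\<close> have the same gauge \<open>r\<close>, where \<open>B\<close> is the rotation by \<open>c\<close>. So
  \<open>(B - I) / r\<close> maps \<open>\<Gamma>\<close>, the unit sphere of the gauge, to itself.\<close>

lemma curve_rot_chord:
  assumes c: "curve_rot c" "c ^ n = 1" "n \<ge> 1" "c \<noteq> 1"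
  shows "\<exists>r>0. curve_rot ((c - 1) / of_real r)"
proof -
  define B where "B x = inv E (c * E x)" for x
  have EB: "E (B x) = c * E x" for x using E_bij by (simp add: B_def bij_is_surj surj_f_inv_f)
  have "linear B"
    by (rule linearI; rule E_inj) (simp_all add: EB linear_add[OF E_lin] E_scale algebra_simps)
  moreover have "B x \<in> \<Gamma>" if x: "x \<in> \<Gamma>" for x
  proof -
    obtain y where "y \<in> \<Gamma>" "E y = c * E x" using curve_rotE[OF c(1) x] by blast
    then show ?thesis using EB E_inj by metis
  qed
  moreover have "B ^^ n = id"
  proof
    fix x
    have "E ((B ^^ i) x) = c ^ i * E x" for i by (induction i) (simp_all add: EB)
    then show "(B ^^ n) x = id x" using c(2) by (auto intro: E_inj)
  qed
  moreover have "B x \<noteq> x" if x: "x \<in> \<Gamma>" for x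
  proof
    assume "B x = x"
    then have "c * E x = E x" using EB by metis
    then show False using c(4) \<Gamma>_nz[OF x] E_0_iff by simp
  qed
  ultimately obtain r where r: "r > 0" "\<And>x. x \<in> \<Gamma> \<Longrightarrow> g (B x - x) = r"
    using symmetric_chords_constant[of B n] c(3) by blast
  have "curve_rot ((c - 1) / of_real r)"
    unfolding curve_rot_def
  proof
    fix x assume x: "x \<in> \<Gamma>"
    have "g ((1 / r) *\<^sub>R (B x - x)) = 1" using r x by (simp add: gauge_scale)
    then have "(1 / r) *\<^sub>R (B x - x) \<in> \<Gamma>" by (rule gauge_1_in)
    moreover have "E ((1 / r) *\<^sub>R (B x - x)) = (c - 1) / of_real r * E x"
      unfolding E_scale linear_diff[OF E_lin] EB by (simp add: field_simps)
    ultimately show "\<exists>y\<in>\<Gamma>. E y = (c - 1) / of_real r * E x" by blast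
  qed
  then show ?thesis using r(1) by blast
qed

lemma cis_minus_1: "cis \<phi> - 1 = of_real (2 * sin (\<phi> / 2)) * cis (\<phi> / 2 + pi / 2)"
proof -
  have "cos \<phi> = 1 - 2 * (sin (\<phi> / 2))\<^sup>2" using cos_double_sin[of "\<phi> / 2"] by simp
  moreover have "sin \<phi> = 2 * sin (\<phi> / 2) * cos (\<phi> / 2)" using sin_double[of "\<phi> / 2"] by simp
  ultimately show ?thesis by (simp add: complex_eq_iff cos_add sin_add power2_eq_square)
qed

text \<open>
  The number \<open>cis \<phi> - 1\<close> has the argument \<open>\<phi> / 2 + \<pi> / 2\<close>, and its quotient by \<open>r\<close> has modulus one
  by \<open>curve_rot_modulus\<close>.\<close>

lemma chord_direction:
  assumes "curve_rot (cis \<phi>)" "cis \<phi> ^ n = 1" "n \<ge> 1" "0 < \<phi>" "\<phi> < 2 * pi"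
  shows "curve_rot (cis (\<phi> / 2 + pi / 2))"
proof -
  have s: "sin (\<phi> / 2) > 0" using assms by (intro sin_gt_zero) auto
  then have "cis \<phi> - 1 \<noteq> 0" unfolding cis_minus_1 by simp
  then obtain r where r: "r > 0" "curve_rot ((cis \<phi> - 1) / of_real r)"
    using curve_rot_chord[OF assms(1-3)] by auto
  have "norm ((cis \<phi> - 1) / of_real r) = 1"
    using r \<open>cis \<phi> - 1 \<noteq> 0\<close> by (intro curve_rot_modulus) auto
  then have "2 * sin (\<phi> / 2) / r = 1" using s r(1) unfolding cis_minus_1 by (simp add: norm_mult norm_divide)
  then have "r = 2 * sin (\<phi> / 2)" using r(1) by (simp add: field_simps)
  then have "(cis \<phi> - 1) / of_real r = cis (\<phi> / 2 + pi / 2)" using s unfolding cis_minus_1 by simp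
  then show ?thesis using r(2) by simp
qed

text \<open>
  The chords of the rotations by \<open>\<phi>\<close> and by \<open>2 \<phi>\<close> give the rotations by \<open>\<phi> / 2 + \<pi> / 2\<close> and by
  \<open>\<phi> + \<pi> / 2\<close>, whose quotient is the rotation by \<open>\<phi> / 2\<close>. The bound \<open>\<phi> < \<pi>\<close> ensures that the
  double rotation has no fixed points.\<close>

lemma curve_rot_halve:
  assumes "curve_rot (cis \<phi>)" "cis \<phi> ^ n = 1" "n \<ge> 1" "0 < \<phi>" "\<phi> < pi"
  shows "curve_rot (cis (\<phi> / 2))"
proof -
  have 1: "curve_rot (cis (\<phi> / 2 + pi / 2))" using assms by (intro chord_direction[of _ n]) auto
  have "curve_rot (cis (2 * \<phi>))" using curve_rot_mult[OF assms(1,1)] by (simp add: cis_mult)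
  moreover have "cis (2 * \<phi>) ^ n = 1"
  proof -
    have "cis (2 * \<phi>) = cis \<phi> * cis \<phi>" by (simp add: cis_mult)
    then show ?thesis using assms(2) by (simp add: power_mult_distrib)
  qed
  ultimately have "curve_rot (cis (2 * \<phi> / 2 + pi / 2))" using assms by (intro chord_direction[of _ n]) auto
  then have "curve_rot (cis (\<phi> + pi / 2) * (1 / cis (\<phi> / 2 + pi / 2)))"
    using curve_rot_inverse[OF 1] by (intro curve_rot_mult) auto
  moreover have "cis (\<phi> + pi / 2) * (1 / cis (\<phi> / 2 + pi / 2)) = cis (\<phi> / 2)"
    by (simp add: cis_divide)
  ultimately show ?thesis by simp
qed

lemma curve_rot_closed:
  assumes "\<And>n. curve_rot (cis (u n))" "u \<longlonglongrightarrow> \<phi>"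
  shows "curve_rot (cis \<phi>)"
  unfolding curve_rot_def
proof
  fix x assume x: "x \<in> \<Gamma>"
  have contE: "continuous_on UNIV E" using E_lin by (rule linear_continuous_on[OF linear_conv_bounded_linear[THEN iffD1]])
  have "closed (E ` \<Gamma>)"
    by (intro compact_imp_closed compact_continuous_image continuous_on_subset[OF contE] compact_\<Gamma>) auto
  moreover have "cis (u n) * E x \<in> E ` \<Gamma>" for n using curve_rotE[OF assms(1) x] by (metis image_eqI)
  moreover have "(\<lambda>n. cis (u n) * E x) \<longlonglongrightarrow> cis \<phi> * E x"
    using assms(2) by (intro tendsto_intros)
  ultimately have "cis \<phi> * E x \<in> E ` \<Gamma>" by (rule closed_sequentially)
  then show "\<exists>y\<in>\<Gamma>. E y = cis \<phi> * E x" by (metis imageE)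
qed

text \<open>
  The number \<open>w\<close> is a primitive root of unity, so that some power of it is \<open>cis (2 \<pi> / k)\<close>. As
  \<open>2 \<pi> / k < \<pi>\<close>, this rotation can be halved again and again, and multiples of the resulting small
  angles approximate every angle.\<close>

theorem rotation_symmetric_is_ellipse:
  assumes w: "curve_rot w" "w ^ k = 1" "\<And>j. 0 < j \<Longrightarrow> j < k \<Longrightarrow> w ^ j \<noteq> 1" and k: "k \<ge> 3"
  shows "is_ellipse \<Gamma>"
proof -
  have "\<exists>j. w ^ j = cis (2 * pi / k)"
  proof -
    have inj: "inj_on (\<lambda>j. w ^ j) {..<k}"
    proof (rule linorder_inj_onI)
      fix i j assume ij: "i < j" "i \<in> {..<k}" "j \<in> {..<k}"
      have "w \<noteq> 0" using w(2) k by (cases "w = 0") (auto simp: power_0_left)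
      have "w ^ j = w ^ i * w ^ (j - i)" using ij by (simp flip: power_add)
      then show "w ^ i \<noteq> w ^ j" using w(3)[of "j - i"] ij \<open>w \<noteq> 0\<close> by auto
    qed auto
    have "(w ^ j) ^ k = (w ^ k) ^ j" for j
      unfolding power_mult[symmetric] by (simp only: mult.commute)
    then have sub: "(\<lambda>j. w ^ j) ` {..<k} \<subseteq> {z. z ^ k = 1}" using w(2) by auto
    have "(\<lambda>j. w ^ j) ` {..<k} = {z. z ^ k = 1}"
    proof (rule card_subset_eq[OF _ sub])
      show "finite {z::complex. z ^ k = 1}" using k by (intro finite_roots_unity) auto
      show "card ((\<lambda>j. w ^ j) ` {..<k}) = card {z::complex. z ^ k = 1}"
        using card_image[OF inj] card_roots_unity_eq[of k] k by simp
    qed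
    moreover have "cis (2 * pi / k) ^ k = 1" using k by (simp add: Complex.DeMoivre)
    ultimately have "cis (2 * pi / k) \<in> (\<lambda>j. w ^ j) ` {..<k}" by simp
    then obtain j where "cis (2 * pi / k) = w ^ j" by (rule imageE)
    then show ?thesis by (intro exI[of _ j]) (rule sym)
  qed
  then have base: "curve_rot (cis (2 * pi / k))" using curve_rot_power[OF w(1)] by metis
  define \<delta> where "\<delta> n = 2 * pi / (real k * 2 ^ n)" for n
  have \<delta>_pos: "\<delta> n > 0" for n using k by (simp add: \<delta>_def)
  have \<delta>_rot: "curve_rot (cis (\<delta> n))" for n
  proof (induction n)
    case 0
    then show ?case using base by (simp add: \<delta>_def)
  next
    case (Suc n)
    have "curve_rot (cis (\<delta> n / 2))"
    proof (rule curve_rot_halve[OF Suc, of "k * 2 ^ n"])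
      show "cis (\<delta> n) ^ (k * 2 ^ n) = 1" using k by (simp add: Complex.DeMoivre \<delta>_def)
      show "k * 2 ^ n \<ge> 1" using k by simp
      have "2 < real k * 2 ^ n"
      proof -
        have "3 * 1 \<le> real k * 2 ^ n" using k by (intro mult_mono) auto
        then show ?thesis by simp
      qed
      then show "\<delta> n < pi" by (simp add: \<delta>_def divide_less_eq)
    qed (rule \<delta>_pos)
    then show ?case by (simp add: \<delta>_def mult.commute mult.left_commute)
  qed
  have all: "curve_rot (cis \<phi>)" if "\<phi> \<ge> 0" for \<phi>
  proof (rule curve_rot_closed)
    define m where "m n = nat \<lfloor>\<phi> / \<delta> n\<rfloor>" for n
    show "curve_rot (cis (real (m n) * \<delta> n))" for n
      using curve_rot_power[OF \<delta>_rot, of n "m n"] by (simp add: Complex.DeMoivre)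
    have \<delta>0: "\<delta> \<longlonglongrightarrow> 0"
    proof -
      have "(\<lambda>n. 2 * pi / real k * (1 / 2) ^ n) \<longlonglongrightarrow> 2 * pi / real k * 0"
        by (intro tendsto_intros LIMSEQ_power_zero) auto
      then show ?thesis by (simp add: \<delta>_def[abs_def] power_divide)
    qed
    have bd: "\<bar>real (m n) * \<delta> n - \<phi>\<bar> \<le> \<delta> n" for n
    proof -
      have "real (m n) = of_int \<lfloor>\<phi> / \<delta> n\<rfloor>" using \<open>\<phi> \<ge> 0\<close> \<delta>_pos[of n] by (simp add: m_def)
      then have "real (m n) * \<delta> n \<le> \<phi>" "\<phi> < (real (m n) + 1) * \<delta> n"
        using floor_divide_lower[OF \<delta>_pos] floor_divide_upper[OF \<delta>_pos] by auto
      then show ?thesis by (simp add: algebra_simps)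
    qed
    have "\<forall>\<^sub>F n in sequentially. norm (real (m n) * \<delta> n - \<phi>) \<le> \<delta> n"
      by (rule always_eventually) (simp add: bd)
    then have "(\<lambda>n. real (m n) * \<delta> n - \<phi>) \<longlonglongrightarrow> 0"
      using \<delta>0 by (rule Lim_null_comparison)
    then show "(\<lambda>n. real (m n) * \<delta> n) \<longlonglongrightarrow> \<phi>" by (simp add: LIM_zero_cancel)
  qed
  define \<rho> where "\<rho> = norm (E (\<gamma> 0))"
  have \<rho>: "\<rho> > 0" using \<gamma>_nz E_0_iff by (simp add: \<rho>_def)
  have circle: "x \<in> \<Gamma>" if nx: "norm (E x) = \<rho>" for x
  proof -
    have nz: "E (\<gamma> 0) \<noteq> 0" using \<gamma>_nz E_0_iff by simp
    define c where "c = E x / E (\<gamma> 0)"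
    have "norm c = 1" using nx nz by (simp add: c_def norm_divide \<rho>_def)
    then have "c = cis (Arg2pi c)" using Arg2pi_eq[of c] by (simp add: cis_conv_exp)
    then have "curve_rot c" using all[of "Arg2pi c"] Arg2pi_ge_0 by simp
    then obtain y where "y \<in> \<Gamma>" "E y = c * E (\<gamma> 0)" using curve_rotE[OF _ \<gamma>_in] by blast
    moreover have "c * E (\<gamma> 0) = E x" using nz by (simp add: c_def)
    ultimately show ?thesis using E_inj by metis
  qed
  have circle': "norm (E x) = \<rho>" if x: "x \<in> \<Gamma>" for x
  proof -
    have n: "norm (E x) > 0" using \<Gamma>_nz[OF x] E_0_iff by simp
    have "norm (E ((\<rho> / norm (E x)) *\<^sub>R x)) = \<bar>\<rho> / norm (E x)\<bar> * norm (E x)"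
      unfolding E_scale norm_mult norm_of_real ..
    also have "\<dots> = \<rho>" using n \<rho> by simp
    finally have "norm (E ((\<rho> / norm (E x)) *\<^sub>R x)) = \<rho>" .
    then have "(\<rho> / norm (E x)) *\<^sub>R x \<in> \<Gamma>" by (rule circle)
    then have "\<rho> / norm (E x) = 1" by (rule ray_once[OF x]) (use n \<rho> in simp)
    then show ?thesis using n by (simp add: field_simps)
  qed
  obtain p q where p: "E p = of_real \<rho>" and q: "E q = of_real \<rho> * \<i>" using E_ex by metis
  have Epq: "E (a *\<^sub>R p + b *\<^sub>R q) = of_real \<rho> * Complex a b" for a b
    using linear_add[OF E_lin] by (simp add: E_scale p q complex_eq_iff)
  have "\<Gamma> = range (\<lambda>\<theta>. cos \<theta> *\<^sub>R p + sin \<theta> *\<^sub>R q)"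
  proof (intro subset_antisym subsetI)
    fix x assume x: "x \<in> \<Gamma>"
    define c where "c = E x / of_real \<rho>"
    have "norm c = 1" using circle'[OF x] \<rho> by (simp add: c_def norm_divide)
    then have "c = cis (Arg2pi c)" using Arg2pi_eq[of c] by (simp add: cis_conv_exp)
    then obtain \<theta> where "c = cis \<theta>" by (rule that)
    then have "E x = of_real \<rho> * Complex (cos \<theta>) (sin \<theta>)"
      using \<rho> unfolding c_def by (simp add: cis.ctr field_simps)
    then have "E x = E (cos \<theta> *\<^sub>R p + sin \<theta> *\<^sub>R q)" by (simp only: Epq)
    then have "x = cos \<theta> *\<^sub>R p + sin \<theta> *\<^sub>R q" by (rule E_inj)
    then show "x \<in> range (\<lambda>\<theta>. cos \<theta> *\<^sub>R p + sin \<theta> *\<^sub>R q)" by (rule range_eqI)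
  next
    fix x assume "x \<in> range (\<lambda>\<theta>. cos \<theta> *\<^sub>R p + sin \<theta> *\<^sub>R q)"
    then obtain \<theta> where "x = cos \<theta> *\<^sub>R p + sin \<theta> *\<^sub>R q" by blast
    then have "E x = of_real \<rho> * Complex (cos \<theta>) (sin \<theta>)" using Epq by simp
    then have "E x = of_real \<rho> * cis \<theta>" by (simp only: cis.ctr)
    then have "norm (E x) = \<rho>" using \<rho> by (simp add: norm_mult)
    then show "x \<in> \<Gamma>" by (rule circle)
  qed
  moreover have "is_ellipse (range (\<lambda>\<theta>. cos \<theta> *\<^sub>R p + sin \<theta> *\<^sub>R q))"
  proof (rule is_ellipse_range)
    fix a b assume "a *\<^sub>R p + b *\<^sub>R q = 0"
    then have "of_real \<rho> * Complex a b = 0" using Epq[of a b] linear_0[OF E_lin] by simp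
    then show "a = 0 \<and> b = 0" using \<rho> by (simp add: complex_eq_iff)
  qed
  ultimately show ?thesis by simp
qed

end

end

theorem theorem5:
  fixes \<Gamma> :: "plane set" and \<gamma> :: "real \<Rightarrow> plane" and P :: real
    and A :: "plane \<Rightarrow> plane" and k :: nat
  assumes "k \<ge> 3"
    and "C2_closed_curve \<Gamma>" and "strictly_convex_curve \<Gamma>"
    and "linear A" and "has_order A k" and "A ` \<Gamma> = \<Gamma>"
    and "minkowski_param \<Gamma> P \<gamma>"
    and "totally_integrable_on \<Gamma> \<gamma> (phase_cylinder \<Gamma>)"
  shows "is_ellipse \<Gamma>"
proof -
  obtain E :: "plane \<Rightarrow> complex" and w where E: "linear E" "bij E" "\<And>x. E (A x) = w * E x"
    and w: "w ^ k = 1" "\<And>j. 0 < j \<Longrightarrow> j < k \<Longrightarrow> w ^ j \<noteq> 1"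
    using finite_order_conjugate_rotation[OF assms(4,5,1)] by blast
  interpret convex_table \<Gamma> P \<gamma> by unfold_locales (fact assms(7), fact assms(3))
  have A: "A x \<in> \<Gamma>" if "x \<in> \<Gamma>" for x using assms(6) that by blast
  have "w \<noteq> 1" using w(2)[of 1] assms(1) by simp
  then have zero: "0 \<in> inside \<Gamma>" using zero_inside_of_rotation[OF E A w(1)] assms(1) by simp
  interpret integrable_table \<Gamma> P \<gamma> by unfold_locales (fact zero, fact assms(8))
  have "curve_rot E w" unfolding curve_rot_def[OF E(1,2)] using A E(3) by metis
  then show ?thesis by (rule rotation_symmetric_is_ellipse[OF E(1,2) _ w assms(1)])
qed

end
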